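(* Let $T\in{\rm Aut}(X,\mathcal B,\mu)$ be ergodic and suppose the topological lens $(C_2(\mu),\widetilde T)$ is distal. Then $T$ has discrete spectrum, and consequently $\widetilde T$ is equicontinuous.
   Context: $C_2(\mu)$: probability measures on $X\times X$ with both marginals $\mu$, with the compact metrizable topology $\rho_n\to\rho$ iff $\rho_n(A\times B)\to\rho(A\times B)$ for all measurable $A,B$; $\widetilde T(\rho)(A\times B)=\rho(T^{-1}A\times T^{-1}B)$. A homeomorphism $R$ of a compact metric space $Z$ is distal if for every pair of distinct points $z_1,z_2$ the closure of the $R\times R$-orbit of $(z_1,z_2)$ is disjoint from the diagonal of $Z\times Z$; equicontinuous if $\{R^n:n\in\mathbb Z\}$ is an equicontinuous family. $T$ has discrete spectrum if $L^2(\mu)$ is spanned by eigenfunctions of $U_Tf=f\circ T$. *)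

theory Defs
  imports "HOL-Probability.Probability"
begin

definition mp_aut :: "'a measure \<Rightarrow> ('a \<Rightarrow> 'a) \<Rightarrow> bool" where
  "mp_aut M T \<longleftrightarrow> bij_betw T (space M) (space M)
     \<and> T \<in> measurable M M
     \<and> inv_into (space M) T \<in> measurable M M
     \<and> distr M M T = M"

definition ergodic :: "'a measure \<Rightarrow> ('a \<Rightarrow> 'a) \<Rightarrow> bool" where
  "ergodic M T \<longleftrightarrow> (\<forall>A\<in>sets M. T -` A \<inter> space M = A \<longrightarrow>
       measure M A = 0 \<or> measure M A = 1)"

definition L2fun :: "'a measure \<Rightarrow> ('a \<Rightarrow> complex) \<Rightarrow> bool" where
  "L2fun M f \<longleftrightarrow> f \<in> borel_measurable M \<and> integrable M (\<lambda>x. (cmod (f x))\<^sup>2)"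

definition eigenfunction :: "'a measure \<Rightarrow> ('a \<Rightarrow> 'a) \<Rightarrow> ('a \<Rightarrow> complex) \<Rightarrow> bool" where
  "eigenfunction M T f \<longleftrightarrow> L2fun M f \<and> \<not> (AE x in M. f x = 0)
     \<and> (\<exists>c::complex. AE x in M. f (T x) = c * f x)"

definition discrete_spectrum :: "'a measure \<Rightarrow> ('a \<Rightarrow> 'a) \<Rightarrow> bool" where
  "discrete_spectrum M T \<longleftrightarrow> (\<forall>g. L2fun M g \<longrightarrow> (\<forall>e>0. \<exists>F c. finite F
      \<and> (\<forall>f\<in>F. eigenfunction M T f)
      \<and> (\<integral>x. (cmod (g x - (\<Sum>f\<in>F. c f * f x)))\<^sup>2 \<partial>M) < e))"

definition C2 :: "'a measure \<Rightarrow> ('a \<times> 'a) measure set" where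
  "C2 M = {\<rho>. sets \<rho> = sets (M \<Otimes>\<^sub>M M) \<and> prob_space \<rho>
      \<and> (\<forall>A\<in>sets M. emeasure \<rho> (A \<times> space M) = emeasure M A)
      \<and> (\<forall>B\<in>sets M. emeasure \<rho> (space M \<times> B) = emeasure M B)}"

text \<open>The topology on C_2(mu): the coarsest one making all maps rho |-> rho(A x B) continuous
  (its convergent sequences are exactly those with rho_n(A x B) -> rho(A x B) for all A, B).\<close>
definition C2_topology :: "'a measure \<Rightarrow> ('a \<times> 'a) measure topology" where
  "C2_topology M = topology_generated_by
     {{\<rho>\<in>C2 M. measure \<rho> (A \<times> B) \<in> U} | A B U. A \<in> sets M \<and> B \<in> sets M \<and> open U}"

definition lift_map :: "'a measure \<Rightarrow> ('a \<Rightarrow> 'a) \<Rightarrow> ('a \<times> 'a) measure \<Rightarrow> ('a \<times> 'a) measure" where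
  "lift_map M T \<rho> = distr \<rho> (M \<Otimes>\<^sub>M M) (\<lambda>(x, y). (T x, T y))"

definition zpow :: "'b topology \<Rightarrow> ('b \<Rightarrow> 'b) \<Rightarrow> int \<Rightarrow> 'b \<Rightarrow> 'b" where
  "zpow Z R n = (if 0 \<le> n then R ^^ nat n else inv_into (topspace Z) R ^^ nat (- n))"

definition distal :: "'b topology \<Rightarrow> ('b \<Rightarrow> 'b) \<Rightarrow> bool" where
  "distal Z R \<longleftrightarrow> homeomorphic_map Z Z R \<and>
     (\<forall>z1\<in>topspace Z. \<forall>z2\<in>topspace Z. z1 \<noteq> z2 \<longrightarrow>
        (prod_topology Z Z) closure_of {(zpow Z R n z1, zpow Z R n z2) | n. True}
          \<inter> {(z, z) | z. True} = {})"

text \<open>Equicontinuity of {R^n : n in Z}, with respect to any metric inducing the (compact) topology.\<close>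
definition equicontinuous :: "'b topology \<Rightarrow> ('b \<Rightarrow> 'b) \<Rightarrow> bool" where
  "equicontinuous Z R \<longleftrightarrow> (\<forall>d. Metric_space (topspace Z) d
      \<and> Metric_space.mtopology (topspace Z) d = Z \<longrightarrow>
      (\<forall>e>0. \<exists>\<delta>>0. \<forall>z\<in>topspace Z. \<forall>w\<in>topspace Z. d z w < \<delta> \<longrightarrow>
          (\<forall>n::int. d (zpow Z R n z) (zpow Z R n w) < e)))"

end

theory Submission
  imports Defs
begin

text \<open>
  If \<open>f\<close> is bounded and orthogonal to all eigenfunctions, then along suitable \<open>n\<close> the functions
  \<open>f \<circ> T\<^sup>n\<close> tend weakly to \<open>0\<close>. Up to scaling, the measure with density \<open>1 + f(x) f(y)\<close> with respect to
  \<open>M \<times> M\<close> is then a self-coupling that is proximal to the fixed point \<open>M \<times> M\<close>, so distality forces \<open>f = 0\<close>.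

  The weak convergence is proved without spectral measures. By the mean ergodic theorem the averages of
  \<open>l\<^sup>n (f \<circ> T\<^sup>n)\<close> are small for every \<open>l\<close> on the circle, hence uniformly small by compactness, and averaging the
  square of their squared norm over roots of unity bounds the mean square of the correlations of \<open>f\<close>.

  The functions with totally bounded orbit in \<open>L\<^sup>2\<close> form a closed lattice, so the best approximation of an
  indicator function among them is bounded and so is the remainder, which is orthogonal to the eigenfunctions
  and hence vanishes. So all indicator functions have totally bounded orbits; this yields that a function
  orthogonal to the eigenfunctions vanishes, and that the lifts act uniformly equicontinuously on rectangles.
  Equicontinuity for an arbitrary metric follows because the space of self-couplings is compact.
\<close>

section \<open>The Hilbert space of square-integrable functions\<close>

text \<open>Boundedness is the obstacle behind the detour through totally bounded orbits. A scaled
  density \<open>1 + f(x) f(y)\<close> is nonnegative only for bounded \<open>f\<close>, while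
  projecting an indicator function on the span of the eigenfunctions gives no evident bound. The
  functions with totally bounded orbit contain the eigenfunctions and are stable under truncation,
  so they do the work of conditional expectation on the Kronecker factor without constructing that
  factor. The price is that indicator functions are at first known only to be almost periodic, not
  to be limits of combinations of eigenfunctions. The way back uses the weak decay a second time,
  now against a precompact orbit, where it serves unbounded functions as well. The rank-one form of
  the density makes the correction on a rectangle a product of two integrals, so decay of one factor
  suffices. Functions are kept as functions with a seminorm, and a projection is characterised by
  approximability plus orthogonality.\<close>

definition L2ip :: "'a measure \<Rightarrow> ('a \<Rightarrow> complex) \<Rightarrow> ('a \<Rightarrow> complex) \<Rightarrow> complex" where
  "L2ip M f g = (\<integral>x. f x * cnj (g x) \<partial>M)"

definition L2norm :: "'a measure \<Rightarrow> ('a \<Rightarrow> complex) \<Rightarrow> real" where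
  "L2norm M f = sqrt (\<integral>x. (cmod (f x))\<^sup>2 \<partial>M)"

lemma borel_measurable_cnj [measurable]: "cnj \<in> borel_measurable borel"
  by (intro borel_measurable_continuous_onI continuous_intros)

lemma L2fun_add:
  assumes "L2fun M f" "L2fun M g" shows "L2fun M (\<lambda>x. f x + g x)"
proof -
  have [measurable]: "f \<in> borel_measurable M" "g \<in> borel_measurable M"
    using assms by (auto simp: L2fun_def)
  have "(cmod (a + b))\<^sup>2 \<le> 2 * (cmod a)\<^sup>2 + 2 * (cmod b)\<^sup>2" for a b
  proof -
    have "(cmod (a + b))\<^sup>2 \<le> (cmod a + cmod b)\<^sup>2" by (intro power_mono norm_triangle_ineq) auto
    also have "\<dots> \<le> 2 * (cmod a)\<^sup>2 + 2 * (cmod b)\<^sup>2"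
      using sum_squares_ge_zero[of "cmod a - cmod b" 0] by (simp add: power2_eq_square algebra_simps)
    finally show ?thesis .
  qed
  from this[of "f x" "g x" for x]
  have le: "norm ((cmod (f x + g x))\<^sup>2) \<le> norm (2 * (cmod (f x))\<^sup>2 + 2 * (cmod (g x))\<^sup>2)" for x
    by simp
  have "integrable M (\<lambda>x. 2 * (cmod (f x))\<^sup>2 + 2 * (cmod (g x))\<^sup>2)"
    using assms by (simp add: L2fun_def)
  then have "integrable M (\<lambda>x. (cmod (f x + g x))\<^sup>2)"
    by (rule Bochner_Integration.integrable_bound) (measurable, rule AE_I2, rule le)
  then show ?thesis by (simp add: L2fun_def)
qed

lemma L2fun_cmult: "L2fun M f \<Longrightarrow> L2fun M (\<lambda>x. c * f x)"
  by (auto simp: L2fun_def norm_mult power_mult_distrib)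

lemma L2fun_zero: "L2fun M (\<lambda>x. 0)"
  by (auto simp: L2fun_def)

lemma L2fun_uminus: "L2fun M f \<Longrightarrow> L2fun M (\<lambda>x. - f x)"
  by (auto simp: L2fun_def)

lemma L2fun_diff: "L2fun M f \<Longrightarrow> L2fun M g \<Longrightarrow> L2fun M (\<lambda>x. f x - g x)"
  using L2fun_add[of M f "\<lambda>x. - g x"] L2fun_uminus[of M g] by simp

lemma L2fun_sum: "(\<And>i. i \<in> I \<Longrightarrow> L2fun M (f i)) \<Longrightarrow> L2fun M (\<lambda>x. \<Sum>i\<in>I. f i x)"
  by (induction I rule: infinite_finite_induct) (auto intro: L2fun_add L2fun_zero)

lemma L2fun_bounded:
  assumes "finite_measure M" "f \<in> borel_measurable M" "\<And>x. cmod (f x) \<le> B"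
  shows "L2fun M f"
proof -
  interpret finite_measure M by fact
  have "(cmod (f x))\<^sup>2 \<le> B\<^sup>2" for x using assms(3)[of x] by (intro power_mono) auto
  then show ?thesis using assms(2) unfolding L2fun_def
    by (intro conjI integrable_const_bound[of _ "B\<^sup>2"]) auto
qed

lemmas L2fun_intros = L2fun_add L2fun_cmult L2fun_zero L2fun_uminus L2fun_diff L2fun_sum

lemma integrable_mult_cnj:
  assumes "L2fun M f" "L2fun M g" shows "integrable M (\<lambda>x. f x * cnj (g x))"
proof -
  have [measurable]: "f \<in> borel_measurable M" "g \<in> borel_measurable M"
    using assms by (auto simp: L2fun_def)
  have "cmod (a * cnj b) \<le> (cmod a)\<^sup>2 + (cmod b)\<^sup>2" for a b
  proof -
    have "2 * (cmod a * cmod b) \<le> (cmod a)\<^sup>2 + (cmod b)\<^sup>2"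
      using sum_squares_bound[of "cmod a" "cmod b"] by simp
    moreover have "0 \<le> cmod a * cmod b" by simp
    ultimately show ?thesis unfolding norm_mult complex_mod_cnj by linarith
  qed
  from this[of "f x" "g x" for x]
  have le: "norm (f x * cnj (g x)) \<le> norm ((cmod (f x))\<^sup>2 + (cmod (g x))\<^sup>2)" for x
    by simp
  have "integrable M (\<lambda>x. (cmod (f x))\<^sup>2 + (cmod (g x))\<^sup>2)"
    using assms by (simp add: L2fun_def)
  then show ?thesis
    by (rule Bochner_Integration.integrable_bound) (measurable, rule AE_I2, rule le)
qed

lemma L2ip_add_left: "L2fun M f \<Longrightarrow> L2fun M g \<Longrightarrow> L2fun M h \<Longrightarrow>
    L2ip M (\<lambda>x. f x + g x) h = L2ip M f h + L2ip M g h"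
  unfolding L2ip_def by (subst Bochner_Integration.integral_add[symmetric]) (auto simp: integrable_mult_cnj algebra_simps)

lemma L2ip_cnj: "cnj (L2ip M f g) = L2ip M g f"
  proof -
  have "cnj (L2ip M f g) = (\<integral>x. cnj (f x * cnj (g x)) \<partial>M)"
    unfolding L2ip_def by (rule Bochner_Integration.integral_cnj[symmetric])
  then show ?thesis by (simp add: L2ip_def mult.commute del: Bochner_Integration.integral_cnj)
qed

lemma L2ip_cmult_left: "L2ip M (\<lambda>x. c * f x) g = c * L2ip M f g"
  unfolding L2ip_def by (simp add: mult.assoc)

lemma L2ip_cmult_right: "L2ip M f (\<lambda>x. c * g x) = cnj c * L2ip M f g"
  using L2ip_cmult_left[of M c g f] by (metis L2ip_cnj complex_cnj_mult)

lemma L2ip_add_right: "L2fun M f \<Longrightarrow> L2fun M g \<Longrightarrow> L2fun M h \<Longrightarrow>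
    L2ip M f (\<lambda>x. g x + h x) = L2ip M f g + L2ip M f h"
  unfolding L2ip_cnj[of M _ f, symmetric] by (simp add: L2ip_add_left)

lemma L2ip_diff_left: "L2fun M f \<Longrightarrow> L2fun M g \<Longrightarrow> L2fun M h \<Longrightarrow>
    L2ip M (\<lambda>x. f x - g x) h = L2ip M f h - L2ip M g h"
  using L2ip_add_left[of M f "\<lambda>x. (-1) * g x" h] L2ip_cmult_left[of M "-1" g h] L2fun_uminus[of M g] by simp

lemma L2ip_diff_right: "L2fun M f \<Longrightarrow> L2fun M g \<Longrightarrow> L2fun M h \<Longrightarrow>
    L2ip M f (\<lambda>x. g x - h x) = L2ip M f g - L2ip M f h"
  unfolding L2ip_cnj[of M _ f, symmetric] by (simp add: L2ip_diff_left)

lemma L2ip_sum_left: "(\<And>i. i \<in> I \<Longrightarrow> L2fun M (f i)) \<Longrightarrow> L2fun M g \<Longrightarrow>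
    L2ip M (\<lambda>x. \<Sum>i\<in>I. f i x) g = (\<Sum>i\<in>I. L2ip M (f i) g)"
  by (induction I rule: infinite_finite_induct) (auto simp: L2ip_add_left L2fun_sum, auto simp: L2ip_def)

lemma L2ip_sum_right: "(\<And>i. i \<in> I \<Longrightarrow> L2fun M (f i)) \<Longrightarrow> L2fun M g \<Longrightarrow>
    L2ip M g (\<lambda>x. \<Sum>i\<in>I. f i x) = (\<Sum>i\<in>I. L2ip M g (f i))"
  by (induction I rule: infinite_finite_induct) (auto simp: L2ip_add_right L2fun_sum, auto simp: L2ip_def)

lemma L2ip_self: "L2ip M f f = of_real ((L2norm M f)\<^sup>2)"
proof -
  have "L2ip M f f = (\<integral>x. complex_of_real ((cmod (f x))\<^sup>2) \<partial>M)"
    unfolding L2ip_def complex_norm_square by simp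
  also have "\<dots> = of_real ((L2norm M f)\<^sup>2)"
    by (subst integral_complex_of_real) (simp add: L2norm_def)
  finally show ?thesis .
qed

lemma L2norm_nonneg [simp]: "0 \<le> L2norm M f"
  by (simp add: L2norm_def)

lemma L2norm_square: "(L2norm M f)\<^sup>2 = (\<integral>x. (cmod (f x))\<^sup>2 \<partial>M)"
  by (simp add: L2norm_def)

lemma L2norm_cmult: "L2norm M (\<lambda>x. c * f x) = cmod c * L2norm M f"
  by (simp add: L2norm_def norm_mult power_mult_distrib real_sqrt_mult)

lemma L2norm_square_add:
  assumes "L2fun M f" "L2fun M g"
  shows "(L2norm M (\<lambda>x. f x + g x))\<^sup>2 = (L2norm M f)\<^sup>2 + 2 * Re (L2ip M f g) + (L2norm M g)\<^sup>2"
proof -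
  have "L2ip M (\<lambda>x. f x + g x) (\<lambda>x. f x + g x) = L2ip M f f + L2ip M f g + (L2ip M g f + L2ip M g g)"
    using assms by (simp add: L2ip_add_left L2ip_add_right L2fun_add)
  also have "L2ip M g f = cnj (L2ip M f g)" by (simp add: L2ip_cnj)
  finally have "Re (L2ip M (\<lambda>x. f x + g x) (\<lambda>x. f x + g x)) = Re (L2ip M f f) + 2 * Re (L2ip M f g) + Re (L2ip M g g)"
    by simp
  then show ?thesis by (simp add: L2ip_self)
qed

lemma L2norm_square_diff:
  assumes "L2fun M f" "L2fun M g"
  shows "(L2norm M (\<lambda>x. f x - g x))\<^sup>2 = (L2norm M f)\<^sup>2 - 2 * Re (L2ip M f g) + (L2norm M g)\<^sup>2"
  using L2norm_square_add[of M f "\<lambda>x. (-1) * g x"] L2ip_cmult_right[of M f "-1" g] assms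
    L2norm_cmult[of M "-1" g] L2fun_uminus[of M g] by simp

text \<open>Weighting \<open>g\<close> by \<open>p = L2ip M f g\<close> makes the cross term real,
  so nonnegativity of a real quadratic in \<open>t\<close> decides the complex case.\<close>

lemma Cauchy_Schwarz_L2:
  assumes f: "L2fun M f" and g: "L2fun M g"
  shows "cmod (L2ip M f g) \<le> L2norm M f * L2norm M g"
proof -
  define p where "p = L2ip M f g"
  define a where "a = L2norm M f"
  define b where "b = L2norm M g"
  have *: "0 \<le> t\<^sup>2 * a\<^sup>2 - 2 * t * (cmod p)\<^sup>2 + (cmod p)\<^sup>2 * b\<^sup>2" for t :: real
  proof -
    have "0 \<le> (L2norm M (\<lambda>x. of_real t * f x - p * g x))\<^sup>2" by simp
    also have "\<dots> = (L2norm M (\<lambda>x. of_real t * f x))\<^sup>2 - 2 * Re (L2ip M (\<lambda>x. of_real t * f x) (\<lambda>x. p * g x)) + (L2norm M (\<lambda>x. p * g x))\<^sup>2"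
      using assms by (intro L2norm_square_diff) (auto intro: L2fun_cmult)
    also have "L2ip M (\<lambda>x. of_real t * f x) (\<lambda>x. p * g x) = of_real t * (cnj p * p)"
      unfolding L2ip_cmult_left L2ip_cmult_right p_def by simp
    also have "cnj p * p = of_real ((cmod p)\<^sup>2)" by (simp add: complex_norm_square mult.commute del: of_real_power)
    finally show ?thesis by (simp add: L2norm_cmult a_def b_def power_mult_distrib)
  qed
  have "(cmod p)\<^sup>2 \<le> a\<^sup>2 * b\<^sup>2"
  proof (cases "a = 0")
    case True
    \<comment> \<open>With \<open>a = 0\<close> the quadratic degenerates to an affine function of
      \<open>t\<close>, and one large value of \<open>t\<close> forces \<open>p = 0\<close>.\<close>
    have "2 * t * (cmod p)\<^sup>2 \<le> (cmod p)\<^sup>2 * b\<^sup>2" for t using *[of t] True by simp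
    from this[of "b\<^sup>2 + 1"] have "(b\<^sup>2 + 2) * (cmod p)\<^sup>2 \<le> 0" by (simp add: algebra_simps)
    moreover have "0 < b\<^sup>2 + 2" by (simp add: add_nonneg_pos)
    ultimately have "(cmod p)\<^sup>2 \<le> 0" by (meson mult_pos_pos not_le)
    then show ?thesis by simp
  next
    case False
    then have a: "a\<^sup>2 > 0" by simp
    \<comment> \<open>This is the value of \<open>t\<close> that minimises the quadratic.\<close>
    have "0 \<le> ((cmod p)\<^sup>2 / a\<^sup>2)\<^sup>2 * a\<^sup>2 - 2 * ((cmod p)\<^sup>2 / a\<^sup>2) * (cmod p)\<^sup>2 + (cmod p)\<^sup>2 * b\<^sup>2"
      by (rule *)
    also have "\<dots> = (cmod p)\<^sup>2 * (b\<^sup>2 - (cmod p)\<^sup>2 / a\<^sup>2)"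
      using a by (simp add: field_simps power2_eq_square)
    finally have "(cmod p)\<^sup>2 = 0 \<or> (cmod p)\<^sup>2 / a\<^sup>2 \<le> b\<^sup>2"
      by (smt (verit) mult_pos_neg zero_le_power2)
    then show ?thesis using a by (auto simp: field_simps)
  qed
  then have "(cmod p)\<^sup>2 \<le> (a * b)\<^sup>2" by (simp add: power_mult_distrib)
  then show ?thesis unfolding p_def a_def b_def by (rule power2_le_imp_le) simp
qed

lemma L2norm_triangle:
  assumes "L2fun M f" "L2fun M g"
  shows "L2norm M (\<lambda>x. f x + g x) \<le> L2norm M f + L2norm M g"
proof (rule power2_le_imp_le)
  have "Re (L2ip M f g) \<le> L2norm M f * L2norm M g"
    using Cauchy_Schwarz_L2[OF assms] complex_Re_le_cmod order_trans by blast
  then show "(L2norm M (\<lambda>x. f x + g x))\<^sup>2 \<le> (L2norm M f + L2norm M g)\<^sup>2"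
    by (simp add: L2norm_square_add[OF assms] power2_sum)
qed simp

lemma L2norm_minus_commute: "L2norm M (\<lambda>x. f x - g x) = L2norm M (\<lambda>x. g x - f x)"
  by (simp add: L2norm_def norm_minus_commute)

lemma L2norm_triangle_diff:
  assumes "L2fun M f" "L2fun M g" "L2fun M h"
  shows "L2norm M (\<lambda>x. f x - h x) \<le> L2norm M (\<lambda>x. f x - g x) + L2norm M (\<lambda>x. g x - h x)"
  using L2norm_triangle[of M "\<lambda>x. f x - g x" "\<lambda>x. g x - h x"] assms by (simp add: L2fun_diff)

lemma L2norm_triangle_sum:
  assumes "\<And>i. i \<in> I \<Longrightarrow> L2fun M (f i)"
  shows "L2norm M (\<lambda>x. \<Sum>i\<in>I. f i x) \<le> (\<Sum>i\<in>I. L2norm M (f i))"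
  using assms
proof (induction I rule: infinite_finite_induct)
  case (insert i I)
  then have "L2norm M (\<lambda>x. \<Sum>i\<in>insert i I. f i x) \<le> L2norm M (f i) + L2norm M (\<lambda>x. \<Sum>i\<in>I. f i x)"
    using L2norm_triangle[of M "f i" "\<lambda>x. \<Sum>i\<in>I. f i x"] by (simp add: L2fun_sum)
  with insert show ?case by simp
qed (auto simp: L2norm_def)

lemma L2norm_eq_0_iff:
  assumes "L2fun M f" shows "L2norm M f = 0 \<longleftrightarrow> (AE x in M. f x = 0)"
proof -
  have "L2norm M f = 0 \<longleftrightarrow> (\<integral>x. (cmod (f x))\<^sup>2 \<partial>M) = 0" by (simp add: L2norm_def)
  also have "\<dots> \<longleftrightarrow> (AE x in M. (cmod (f x))\<^sup>2 = 0)"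
    using assms by (intro integral_nonneg_eq_0_iff_AE) (auto simp: L2fun_def)
  finally show ?thesis by simp
qed

lemma L2norm_cong_AE:
  assumes "f \<in> borel_measurable M" "f' \<in> borel_measurable M" "AE x in M. f x = f' x"
  shows "L2norm M f = L2norm M f'"
  unfolding L2norm_def by (rule arg_cong[where f=sqrt], rule integral_cong_AE) (use assms in \<open>auto elim!: eventually_mono\<close>)

lemma L2norm_eq_nn_integral:
  "L2fun M f \<Longrightarrow> (\<integral>\<^sup>+x. ennreal ((cmod (f x))\<^sup>2) \<partial>M) = ennreal ((L2norm M f)\<^sup>2)"
  unfolding L2norm_square L2fun_def by (subst nn_integral_eq_integral) auto

lemma (in prob_space) L1_le_L2norm:
  assumes f: "L2fun M f"
  shows "integrable M f" "(\<integral>x. cmod (f x) \<partial>M) \<le> L2norm M f"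
proof -
  let ?f = "\<lambda>x. complex_of_real (cmod (f x))"
  have [measurable]: "f \<in> borel_measurable M" using f by (simp add: L2fun_def)
  have L: "L2fun M ?f" "L2fun M (\<lambda>x. 1)" using f by (auto simp: L2fun_def)
  have "integrable M (\<lambda>x. f x * cnj 1)" using integrable_mult_cnj[OF f L(2)] by simp
  then show "integrable M f" by simp
  have "(\<integral>x. cmod (f x) \<partial>M) \<le> cmod (L2ip M ?f (\<lambda>x. 1))"
    unfolding L2ip_def by simp
  also have "\<dots> \<le> L2norm M ?f * L2norm M (\<lambda>x. 1)" by (rule Cauchy_Schwarz_L2[OF L])
  also have "\<dots> = L2norm M f" by (simp add: L2norm_def prob_space)
  finally show "(\<integral>x. cmod (f x) \<partial>M) \<le> L2norm M f" .
qed

section \<open>Completeness and orthogonal projection\<close>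

lemma L2norm_telescope:
  assumes g: "\<And>k. L2fun M (g k)" and d: "\<And>k. L2norm M (\<lambda>x. g (Suc k) x - g k x) \<le> (1/2)^k"
  shows "L2norm M (\<lambda>x. g (k + j) x - g k x) \<le> 2 * (1/2)^k * (1 - (1/2)^j)"
proof (induction j)
  case 0 then show ?case by (simp add: L2norm_def)
next
  case (Suc j)
  have "L2norm M (\<lambda>x. g (k + Suc j) x - g k x) \<le> L2norm M (\<lambda>x. g (k + Suc j) x - g (k + j) x) + L2norm M (\<lambda>x. g (k + j) x - g k x)"
    by (intro L2norm_triangle_diff g)
  also have "\<dots> \<le> (1/2)^(k + j) + 2 * (1/2)^k * (1 - (1/2)^j)"
    using d[of "k + j"] Suc by simp
  \<comment> \<open>The factor \<open>1 - (1/2)^j\<close> is the exact geometric partial sum, which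
    closes the induction; the bound \<open>2 * (1/2)^k\<close> alone would not.\<close>
  also have "\<dots> = 2 * (1/2)^k * (1 - (1/2)^Suc j)"
    by (simp add: power_add algebra_simps)
  finally show ?case .
qed

text \<open>Riesz-Fischer for geometrically fast sequences. Summable increments in
  \<open>L^1\<close> give convergence almost everywhere, and Fatou's lemma turns the telescoped
  distances into the rate. Where the sequence diverges, \<open>lim\<close> takes a default value on
  a null set.\<close>

lemma (in prob_space) L2_complete:
  assumes g: "\<And>k. L2fun M (g k)" and d: "\<And>k. L2norm M (\<lambda>x. g (Suc k) x - g k x) \<le> (1/2)^k"
  obtains h where "L2fun M h" "\<And>k. L2norm M (\<lambda>x. g k x - h x) \<le> 2 * (1/2)^k"
proof -
  have [measurable]: "g k \<in> borel_measurable M" for k using g[of k] by (simp add: L2fun_def)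
  define h where "h x = lim (\<lambda>k. g k x)" for x
  have [measurable]: "h \<in> borel_measurable M" unfolding h_def by measurable
  have "(\<integral>\<^sup>+x. (\<Sum>k. ennreal (cmod (g (Suc k) x - g k x))) \<partial>M) = (\<Sum>k. \<integral>\<^sup>+x. ennreal (cmod (g (Suc k) x - g k x)) \<partial>M)"
    by (rule nn_integral_suminf) auto
  also have "\<dots> \<le> (\<Sum>k. ennreal ((1/2)^k))"
  proof (intro suminf_le summableI)
    fix k
    have L: "L2fun M (\<lambda>x. g (Suc k) x - g k x)" by (intro L2fun_diff g)
    have "(\<integral>\<^sup>+x. ennreal (cmod (g (Suc k) x - g k x)) \<partial>M) = ennreal (\<integral>x. cmod (g (Suc k) x - g k x) \<partial>M)"
      using L1_le_L2norm(1)[OF L] by (intro nn_integral_eq_integral) auto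
    also have "\<dots> \<le> ennreal ((1/2)^k)" using L1_le_L2norm(2)[OF L] d[of k] by (intro ennreal_leI) linarith
    finally show "(\<integral>\<^sup>+x. ennreal (cmod (g (Suc k) x - g k x)) \<partial>M) \<le> ennreal ((1/2)^k)" .
  qed
  also have "\<dots> = ennreal (\<Sum>k. (1/2)^k)" by (intro suminf_ennreal2) (auto intro: summable_geometric)
  also have "\<dots> < \<infinity>" by simp
  finally have fin: "(\<integral>\<^sup>+x. (\<Sum>k. ennreal (cmod (g (Suc k) x - g k x))) \<partial>M) \<noteq> \<infinity>" by simp
  have "AE x in M. (\<Sum>k. ennreal (cmod (g (Suc k) x - g k x))) \<noteq> \<infinity>"
    by (rule nn_integral_PInf_AE) (use fin in auto)
  then have lim: "AE x in M. (\<lambda>k. g k x) \<longlonglongrightarrow> h x"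
  proof eventually_elim
    case (elim x)
    then have "summable (\<lambda>k. cmod (g (Suc k) x - g k x))"
      by (intro summable_suminf_not_top) auto
    then have "summable (\<lambda>k. g (Suc k) x - g k x)" by (rule summable_norm_cancel)
    then have "convergent (\<lambda>n. \<Sum>k<n. g (Suc k) x - g k x)" by (simp add: summable_iff_convergent)
    then have "convergent (\<lambda>n. g n x - g 0 x)" by (simp only: sum_lessThan_telescope[of "\<lambda>k. g k x"])
    then have "convergent (\<lambda>n. g n x)" by (simp add: convergent_diff_const_right_iff)
    then show ?case unfolding h_def by (simp add: convergent_LIMSEQ_iff)
  qed
  have bd: "(\<integral>\<^sup>+x. ennreal ((cmod (g k x - h x))\<^sup>2) \<partial>M) \<le> ennreal ((2 * (1/2)^k)\<^sup>2)" for k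
  proof -
    have "(\<integral>\<^sup>+x. ennreal ((cmod (g k x - h x))\<^sup>2) \<partial>M)
        = (\<integral>\<^sup>+x. liminf (\<lambda>j. ennreal ((cmod (g k x - g (k + j) x))\<^sup>2)) \<partial>M)"
    proof (rule nn_integral_cong_AE, use lim in eventually_elim)
      case (elim x)
      have "(\<lambda>j. g (k + j) x) \<longlonglongrightarrow> h x"
        using LIMSEQ_ignore_initial_segment[OF elim, of k] by (simp add: add.commute)
      then have "(\<lambda>j. ennreal ((cmod (g k x - g (k + j) x))\<^sup>2)) \<longlonglongrightarrow> ennreal ((cmod (g k x - h x))\<^sup>2)"
        by (intro tendsto_intros)
      then show ?case using lim_imp_Liminf trivial_limit_sequentially by metis
    qed
    also have "\<dots> \<le> liminf (\<lambda>j. \<integral>\<^sup>+x. ennreal ((cmod (g k x - g (k + j) x))\<^sup>2) \<partial>M)"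
      by (rule nn_integral_liminf) auto
    also have "\<dots> \<le> liminf (\<lambda>j::nat. ennreal ((2 * (1/2)^k)\<^sup>2))"
    proof (intro Liminf_mono always_eventually allI)
      fix j
      have "L2norm M (\<lambda>x. g k x - g (k + j) x) = L2norm M (\<lambda>x. g (k + j) x - g k x)"
        by (rule L2norm_minus_commute)
      also have "\<dots> \<le> 2 * (1/2)^k * (1 - (1/2)^j)" by (rule L2norm_telescope[OF g d])
      also have "\<dots> \<le> 2 * (1/2)^k * 1" by (intro mult_left_mono) auto
      finally have "(L2norm M (\<lambda>x. g k x - g (k + j) x))\<^sup>2 \<le> (2 * (1/2)^k)\<^sup>2"
        by (intro power_mono) auto
      then show "(\<integral>\<^sup>+x. ennreal ((cmod (g k x - g (k + j) x))\<^sup>2) \<partial>M) \<le> ennreal ((2 * (1/2)^k)\<^sup>2)"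
        by (subst L2norm_eq_nn_integral) (auto intro!: L2fun_diff g ennreal_leI)
    qed
    also have "\<dots> = ennreal ((2 * (1/2)^k)\<^sup>2)" by (simp add: Liminf_const)
    finally show ?thesis .
  qed
  have gh: "L2fun M (\<lambda>x. g k x - h x)" for k
  proof -
    have "integrable M (\<lambda>x. (cmod (g k x - h x))\<^sup>2)"
      by (rule integrableI_nonneg) (use le_less_trans[OF bd[of k] ennreal_less_top] in auto)
    then show ?thesis by (simp add: L2fun_def)
  qed
  have "L2fun M (\<lambda>x. g 0 x - (g 0 x - h x))" by (intro L2fun_diff[OF g gh])
  then have h: "L2fun M h" by simp
  have "L2norm M (\<lambda>x. g k x - h x) \<le> 2 * (1/2)^k" for k
  proof (rule power2_le_imp_le)
    show "(L2norm M (\<lambda>x. g k x - h x))\<^sup>2 \<le> (2 * (1/2)^k)\<^sup>2"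
      using bd[of k] unfolding L2norm_eq_nn_integral[OF gh] by (subst (asm) ennreal_le_iff) auto
  qed simp
  with h that show thesis by blast
qed


text \<open>\<open>S\<close> is a real subspace that need not be closed: the almost periodic
  functions projected on later are real valued, and twisted coboundaries or finite combinations of
  eigenfunctions need not form a closed set. Hence orthogonality concerns real parts, and
  \<open>p\<close> is in the closure in the sense of approximation.\<close>

lemma (in prob_space) L2_projection:
  assumes f: "L2fun M f" and S: "\<And>s. s \<in> S \<Longrightarrow> L2fun M s" and z: "(\<lambda>x. 0) \<in> S"
    and lin: "\<And>s t (a::real). s \<in> S \<Longrightarrow> t \<in> S \<Longrightarrow> (\<lambda>x. s x + of_real a * t x) \<in> S"
  obtains p where "L2fun M p" "\<And>e. e > 0 \<Longrightarrow> \<exists>s\<in>S. L2norm M (\<lambda>x. p x - s x) < e"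
    "\<And>s. s \<in> S \<Longrightarrow> Re (L2ip M (\<lambda>x. f x - p x) s) = 0"
proof -
  define d where "d = Inf ((\<lambda>s. (L2norm M (\<lambda>x. f x - s x))\<^sup>2) ` S)"
  have bdd: "bdd_below ((\<lambda>s. (L2norm M (\<lambda>x. f x - s x))\<^sup>2) ` S)" by (rule bdd_belowI[of _ 0]) auto
  have d_le: "d \<le> (L2norm M (\<lambda>x. f x - s x))\<^sup>2" if "s \<in> S" for s
    unfolding d_def using bdd that by (auto intro: cINF_lower)
  have d0: "0 \<le> d" unfolding d_def using z by (intro cINF_greatest) auto
  \<comment> \<open>The slack \<open>(1/4)^n / 8\<close> is small enough for the parallelogram
    identity to bound the squared distance of consecutive terms by \<open>(1/4)^n\<close>.\<close>
  have "\<exists>s\<in>S. (L2norm M (\<lambda>x. f x - s x))\<^sup>2 < d + (1/4)^n / 8" for n :: nat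
  proof -
    have "Inf ((\<lambda>s. (L2norm M (\<lambda>x. f x - s x))\<^sup>2) ` S) < d + (1/4)^n / 8" by (simp add: d_def)
    then show ?thesis using z bdd by (subst (asm) cInf_less_iff) auto
  qed
  then obtain g where gS: "\<And>n. g n \<in> S" and gd: "\<And>n::nat. (L2norm M (\<lambda>x. f x - g n x))\<^sup>2 < d + (1/4)^n / 8"
    by metis
  note gL = S[OF gS]
  have fg: "L2fun M (\<lambda>x. f x - g n x)" for n by (intro L2fun_diff f gL)
  have "L2norm M (\<lambda>x. g (Suc n) x - g n x) \<le> (1/2)^n" for n
  proof (rule power2_le_imp_le)
    let ?u = "\<lambda>x. f x - g n x" and ?v = "\<lambda>x. f x - g (Suc n) x"
    \<comment> \<open>The midpoint of two consecutive terms, assembled from \<open>0\<close> because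
      \<open>lin\<close> adds one real multiple at a time, is again at squared distance at least
      \<open>d\<close> from \<open>f\<close>.\<close>
    have "(\<lambda>x. (0 + of_real (1/2) * g n x) + of_real (1/2) * g (Suc n) x) \<in> S"
      by (intro lin gS z)
    then have "d \<le> (L2norm M (\<lambda>x. f x - ((0 + of_real (1/2) * g n x) + of_real (1/2) * g (Suc n) x)))\<^sup>2"
      by (rule d_le)
    also have "(\<lambda>x. f x - ((0 + of_real (1/2) * g n x) + of_real (1/2) * g (Suc n) x)) = (\<lambda>x. (1/2) * (?u x + ?v x))"
      by (auto simp: algebra_simps)
    finally have "4 * d \<le> (L2norm M (\<lambda>x. ?u x + ?v x))\<^sup>2"
      unfolding L2norm_cmult by (simp add: power2_eq_square)
    moreover have "(L2norm M (\<lambda>x. ?u x - ?v x))\<^sup>2 + (L2norm M (\<lambda>x. ?u x + ?v x))\<^sup>2 = 2 * (L2norm M ?u)\<^sup>2 + 2 * (L2norm M ?v)\<^sup>2"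
      by (simp only: L2norm_square_add[OF fg fg] L2norm_square_diff[OF fg fg])
    moreover have "(1/4)^Suc n \<le> (1/4::real)^n" by simp
    moreover have "(L2norm M (\<lambda>x. ?u x - ?v x))\<^sup>2 = (L2norm M (\<lambda>x. g (Suc n) x - g n x))\<^sup>2"
      by simp
    moreover have "0 \<le> (1/4::real)^n" by simp
    ultimately have "(L2norm M (\<lambda>x. g (Suc n) x - g n x))\<^sup>2 \<le> (1/4)^n"
      using gd[of n] gd[of "Suc n"] by linarith
    then show "(L2norm M (\<lambda>x. g (Suc n) x - g n x))\<^sup>2 \<le> ((1/2)^n)\<^sup>2"
      by (simp add: power_divide flip: power_mult) (simp add: power_mult mult.commute[of n])
  qed simp
  from L2_complete[of g, OF gL this]
  obtain p where p: "L2fun M p" and gp: "\<And>k. L2norm M (\<lambda>x. g k x - p x) \<le> 2 * (1/2)^k"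
    by blast
  have lim0: "(\<lambda>k. c * (1/2::real)^k) \<longlonglongrightarrow> 0" for c
    by (intro tendsto_mult_right_zero LIMSEQ_realpow_zero) auto
  have fp: "L2norm M (\<lambda>x. f x - p x) \<le> sqrt d"
  proof (rule LIMSEQ_le_const)
    show "(\<lambda>k. sqrt d + 3 * (1/2)^k) \<longlonglongrightarrow> sqrt d" using tendsto_add[OF tendsto_const lim0, of "sqrt d" 3] by simp
    have "L2norm M (\<lambda>x. f x - p x) \<le> sqrt d + 3 * (1/2)^k" for k
    proof -
      have "L2norm M (\<lambda>x. f x - g k x) \<le> sqrt (d + ((1/2)^k)\<^sup>2)"
      proof (rule real_le_rsqrt)
        have "(1/4)^k = ((1/2::real)^k)\<^sup>2" by (simp add: power_divide flip: power_mult) (simp add: power_mult mult.commute[of k])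
        then show "(L2norm M (\<lambda>x. f x - g k x))\<^sup>2 \<le> d + ((1/2)^k)\<^sup>2"
          using gd[of k] zero_le_power[of "1/4::real" k] by linarith
      qed
      also have "\<dots> \<le> sqrt d + sqrt (((1/2)^k)\<^sup>2)" by (rule sqrt_add_le_add_sqrt) (use d0 in auto)
      finally have "L2norm M (\<lambda>x. f x - g k x) \<le> sqrt d + (1/2)^k" by simp
      with gp[of k] L2norm_triangle_diff[OF f gL[of k] p] show ?thesis by simp
    qed
    then show "\<exists>N. \<forall>n\<ge>N. L2norm M (\<lambda>x. f x - p x) \<le> sqrt d + 3 * (1/2)^n" by blast
  qed
  \<comment> \<open>Moving \<open>p\<close> by a real multiple of \<open>t\<close> cannot bring it
    closer to \<open>f\<close> than \<open>sqrt d\<close>: with \<open>g k\<close> in place of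
    \<open>p\<close> the moved function lies in \<open>S\<close>, and the error vanishes.\<close>
  have low: "sqrt d \<le> L2norm M (\<lambda>x. (f x - p x) - of_real a * t x)" if t: "t \<in> S" for t a
  proof (rule LIMSEQ_le_const)
    let ?L = "L2norm M (\<lambda>x. (f x - p x) - of_real a * t x)"
    show "(\<lambda>k. ?L + 2 * (1/2)^k) \<longlonglongrightarrow> ?L" using tendsto_add[OF tendsto_const lim0, of ?L 2] by simp
    have "sqrt d \<le> ?L + 2 * (1/2)^k" for k
    proof -
      have "sqrt d \<le> sqrt ((L2norm M (\<lambda>x. f x - (g k x + of_real a * t x)))\<^sup>2)"
        by (intro real_sqrt_le_mono d_le lin gS t)
      also have "\<dots> = L2norm M (\<lambda>x. (f x - p x - of_real a * t x) + (p x - g k x))" by (simp add: algebra_simps)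
      also have "\<dots> \<le> ?L + L2norm M (\<lambda>x. p x - g k x)"
        by (intro L2norm_triangle L2fun_intros f p gL S t)
      also have "\<dots> \<le> ?L + 2 * (1/2)^k" using gp[of k] L2norm_minus_commute[of M p "g k"] by simp
      finally show ?thesis .
    qed
    then show "\<exists>N. \<forall>n\<ge>N. sqrt d \<le> ?L + 2 * (1/2)^n" by blast
  qed
  have q: "L2fun M (\<lambda>x. f x - p x)" by (intro L2fun_diff f p)
  show thesis
  proof (rule that[OF p])
    fix e :: real assume "e > 0"
    then have "\<forall>\<^sub>F k in sequentially. 2 * (1/2::real)^k < e" using order_tendstoD(2)[OF lim0] by blast
    then obtain k where "2 * (1/2::real)^k < e" by (auto simp: eventually_sequentially)
    then show "\<exists>s\<in>S. L2norm M (\<lambda>x. p x - s x) < e"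
      using gp[of k] gS[of k] L2norm_minus_commute[of M p "g k"] by (intro bexI[of _ "g k"]) auto
  next
    fix t assume t: "t \<in> S"
    define r where "r = Re (L2ip M (\<lambda>x. f x - p x) t)"
    define c where "c = (L2norm M t)\<^sup>2"
    have c0: "c \<ge> 0" by (simp add: c_def)
    have "2 * a * r \<le> a\<^sup>2 * c" for a
    proof -
      have "(L2norm M (\<lambda>x. f x - p x))\<^sup>2 \<le> (L2norm M (\<lambda>x. (f x - p x) - of_real a * t x))\<^sup>2"
        using fp low[OF t, of a] by (intro power_mono) auto
      also have "\<dots> = (L2norm M (\<lambda>x. f x - p x))\<^sup>2 - 2 * Re (L2ip M (\<lambda>x. f x - p x) (\<lambda>x. of_real a * t x)) + (L2norm M (\<lambda>x. of_real a * t x))\<^sup>2"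
        by (intro L2norm_square_diff q L2fun_cmult S t)
      finally show ?thesis by (simp add: L2ip_cmult_right L2norm_cmult power_mult_distrib r_def c_def)
    qed
    \<comment> \<open>The minimiser of \<open>a\<^sup>2 * c - 2 * a * r\<close> would be
      \<open>r / c\<close>; the \<open>+ 1\<close> covers \<open>c = 0\<close>.\<close>
    from this[of "r / (c + 1)"] have "2 * (r / (c + 1)) * r * (c + 1)\<^sup>2 \<le> (r / (c + 1))\<^sup>2 * c * (c + 1)\<^sup>2"
      by (rule mult_right_mono) auto
    also have "(r / (c + 1))\<^sup>2 * c * (c + 1)\<^sup>2 = r\<^sup>2 * c" using c0 by (simp add: power_divide)
    also have "2 * (r / (c + 1)) * r * (c + 1)\<^sup>2 = 2 * r\<^sup>2 * (c + 1)" using c0 by (simp add: power2_eq_square)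
    finally have "r\<^sup>2 * (c + 2) \<le> 0" by (simp add: algebra_simps)
    moreover have "0 < c + 2" using c0 by simp
    ultimately have "r\<^sup>2 \<le> 0" by (meson mult_pos_pos not_le)
    then show "Re (L2ip M (\<lambda>x. f x - p x) t) = 0" by (simp add: r_def)
  qed
qed

section \<open>Ergodic sums of functions orthogonal to the eigenfunctions\<close>

text \<open>Invertibility is left out so that one set of invariance lemmas serves \<open>T\<close>,
  its inverse and all iterates.\<close>

definition mp_map :: "'a measure \<Rightarrow> ('a \<Rightarrow> 'a) \<Rightarrow> bool" where
  "mp_map M R \<longleftrightarrow> R \<in> measurable M M \<and> distr M M R = M"

lemma mp_map_funpow: "mp_map M R \<Longrightarrow> mp_map M (R ^^ n)"
proof (induction n)
  case 0
  have "distr M M (\<lambda>x. x) = M" by (rule distr_id2) simp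
  then show ?case by (simp add: mp_map_def id_def)
next
  case (Suc n)
  then have R: "R \<in> measurable M M" "R ^^ n \<in> measurable M M" and "distr M M R = M" "distr M M (R ^^ n) = M"
    by (auto simp: mp_map_def)
  then have "distr M M (R \<circ> R ^^ n) = M" using distr_distr[OF R] by simp
  moreover have "R \<circ> R ^^ n \<in> measurable M M" using R by (rule measurable_comp[rotated])
  ultimately show ?case unfolding mp_map_def funpow.simps by blast
qed

lemma AE_mp_map: "mp_map M R \<Longrightarrow> AE x in M. P x \<Longrightarrow> AE x in M. P (R x)"
  unfolding mp_map_def by (metis AE_distrD)

lemma integrable_mp_map:
  fixes f :: "'a \<Rightarrow> 'b::{banach, second_countable_topology}"
  assumes "mp_map M R" "integrable M f" shows "integrable M (\<lambda>x. f (R x))"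
  using assms integrable_distr[of R M M f] by (simp add: mp_map_def)

lemma integral_mp_map:
  fixes f :: "'a \<Rightarrow> 'b::{banach, second_countable_topology}"
  assumes "mp_map M R" "f \<in> borel_measurable M"
  shows "(\<integral>x. f (R x) \<partial>M) = (\<integral>x. f x \<partial>M)"
  using assms integral_distr[of R M M f] by (simp add: mp_map_def)

lemma L2fun_mp_map: "mp_map M R \<Longrightarrow> L2fun M f \<Longrightarrow> L2fun M (\<lambda>x. f (R x))"
  unfolding L2fun_def using integrable_mp_map[of M R "\<lambda>x. (cmod (f x))\<^sup>2"]
  by (auto simp: mp_map_def)

lemma L2ip_mp_map:
  assumes "mp_map M R" "L2fun M f" "L2fun M g"
  shows "L2ip M (\<lambda>x. f (R x)) (\<lambda>x. g (R x)) = L2ip M f g"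
  unfolding L2ip_def using integral_mp_map[OF assms(1), of "\<lambda>x. f x * cnj (g x)"]
    integrable_mult_cnj[OF assms(2,3)] by auto

lemma L2norm_mp_map:
  assumes "mp_map M R" "L2fun M f" shows "L2norm M (\<lambda>x. f (R x)) = L2norm M f"
  unfolding L2norm_def using integral_mp_map[OF assms(1), of "\<lambda>x. (cmod (f x))\<^sup>2"] assms(2)
  by (auto simp: L2fun_def)

text \<open>Von Neumann's argument: the orthogonal complement of the twisted coboundaries
  \<open>h - l (h \<circ> T)\<close> consists of eigenfunctions, so \<open>f\<close> is a limit of coboundaries,
  whose ergodic sums telescope.\<close>

lemma (in prob_space) twisted_ergodic_sums_small:
  assumes T: "mp_map M T" and f: "L2fun M f"
    and orth: "\<And>g. eigenfunction M T g \<Longrightarrow> L2ip M f g = 0"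
    and l: "cmod l = 1" and e: "e > 0"
  obtains N where "N \<ge> 1" "L2norm M (\<lambda>x. \<Sum>n<N. l ^ n * f ((T ^^ n) x)) < e * real N"
proof -
  note Tn = mp_map_funpow[OF T]
  define S where "S = {\<lambda>x. h x - l * h (T x) | h. L2fun M h}"
  have S: "L2fun M s" if "s \<in> S" for s
    using that by (auto simp: S_def intro!: L2fun_intros L2fun_mp_map[OF T])
  have SI: "(\<lambda>x. h x - l * h (T x)) \<in> S" if "L2fun M h" for h
    unfolding S_def mem_Collect_eq by (intro exI[of _ h] conjI refl that)
  have z: "(\<lambda>x. 0) \<in> S" unfolding S_def mem_Collect_eq by (intro exI[of _ "\<lambda>x. 0"]) (simp add: L2fun_zero)
  have lin: "(\<lambda>x. s x + of_real a * t x) \<in> S" if st: "s \<in> S" "t \<in> S" for s t and a :: real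
  proof -
    obtain h k where h: "L2fun M h" "s = (\<lambda>x. h x - l * h (T x))" and k: "L2fun M k" "t = (\<lambda>x. k x - l * k (T x))"
      using st unfolding S_def mem_Collect_eq by blast
    have "(\<lambda>x. s x + of_real a * t x) = (\<lambda>x. (h x + of_real a * k x) - l * (h (T x) + of_real a * k (T x)))"
      unfolding h k by (auto simp: algebra_simps)
    moreover have "L2fun M (\<lambda>x. h x + of_real a * k x)" by (intro L2fun_intros h k)
    ultimately show ?thesis using SI[of "\<lambda>x. h x + of_real a * k x"] by simp
  qed
  obtain p where p: "L2fun M p" and pS: "\<And>e. e > 0 \<Longrightarrow> \<exists>s\<in>S. L2norm M (\<lambda>x. p x - s x) < e"
    and po: "\<And>s. s \<in> S \<Longrightarrow> Re (L2ip M (\<lambda>x. f x - p x) s) = 0"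
    using L2_projection[of f S, OF f S z lin] by blast
  define r where "r = (\<lambda>x. f x - p x)"
  have r: "L2fun M r" unfolding r_def by (intro L2fun_diff f p)
  have rT: "L2fun M (\<lambda>x. l * r (T x))" by (intro L2fun_cmult L2fun_mp_map[OF T] r)
  \<comment> \<open>The coboundary of \<open>r\<close> itself belongs to \<open>S\<close>. Its
    orthogonality to \<open>r\<close> is equality in the Cauchy-Schwarz inequality for
    \<open>r\<close> and \<open>l * r (T x)\<close>, two functions of equal norm, so they coincide
    almost everywhere.\<close>
  have "(\<lambda>x. r x - l * r (T x)) \<in> S" by (rule SI[OF r])
  then have "Re (L2ip M r (\<lambda>x. r x - l * r (T x))) = 0" using po by (simp add: r_def)
  then have "Re (L2ip M r (\<lambda>x. l * r (T x))) = (L2norm M r)\<^sup>2"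
    by (simp add: L2ip_diff_right[OF r r rT] L2ip_self)
  moreover have "L2norm M (\<lambda>x. l * r (T x)) = L2norm M r"
    by (simp add: L2norm_cmult l L2norm_mp_map[OF T r])
  ultimately have "(L2norm M (\<lambda>x. r x - l * r (T x)))\<^sup>2 = 0"
    by (simp add: L2norm_square_diff[OF r rT])
  then have "AE x in M. r x - l * r (T x) = 0"
    using L2norm_eq_0_iff[OF L2fun_diff[OF r rT]] by simp
  then have "AE x in M. r (T x) = cnj l * r x"
  proof eventually_elim
    case (elim x)
    have "cnj l * l = 1" using l by (metis complex_norm_square mult.commute of_real_1 one_power2)
    then have "cnj l * (l * r (T x)) = r (T x)" by (simp flip: mult.assoc)
    then show ?case using elim by simp
  qed
  have r0: "L2norm M r = 0"
  proof (rule ccontr)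
    \<comment> \<open>Now \<open>r\<close> is an eigenfunction for \<open>cnj l\<close>, hence
      orthogonal to \<open>f\<close>. In real part it is also orthogonal to \<open>S\<close>, hence
      to the limit \<open>p\<close> of elements of \<open>S\<close>, and so to
      \<open>r = f - p\<close> itself.\<close>
    assume n0: "L2norm M r \<noteq> 0"
    then have "eigenfunction M T r" unfolding eigenfunction_def
      using r \<open>AE x in M. r (T x) = cnj l * r x\<close> L2norm_eq_0_iff[OF r] by blast
    then have fr: "L2ip M r f = 0" using orth[of r] by (metis L2ip_cnj complex_cnj_zero)
    have "(L2norm M r)\<^sup>2 = Re (L2ip M r (\<lambda>x. f x - p x))" using L2ip_self[of M r] by (simp add: r_def)
    also have "\<dots> = - Re (L2ip M r p)" by (simp add: L2ip_diff_right[OF r f p] fr)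
    finally have rp: "(L2norm M r)\<^sup>2 = - Re (L2ip M r p)" .
    obtain s where s: "s \<in> S" "L2norm M (\<lambda>x. p x - s x) < L2norm M r"
      using pS[of "L2norm M r"] n0 by (metis L2norm_nonneg less_eq_real_def)
    have ps: "L2fun M (\<lambda>x. p x - s x)" by (intro L2fun_diff p S s)
    have "Re (L2ip M r s) = 0" using po[OF s(1)] by (simp add: r_def)
    then have "Re (L2ip M r p) = Re (L2ip M r (\<lambda>x. p x - s x))"
      by (simp add: L2ip_diff_right[OF r p S[OF s(1)]])
    then have "(L2norm M r)\<^sup>2 \<le> cmod (L2ip M r (\<lambda>x. p x - s x))"
      using rp abs_Re_le_cmod[of "L2ip M r (\<lambda>x. p x - s x)"] by linarith
    also have "\<dots> \<le> L2norm M r * L2norm M (\<lambda>x. p x - s x)" by (rule Cauchy_Schwarz_L2[OF r ps])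
    also have "\<dots> < L2norm M r * L2norm M r"
      using s(2) n0 by (intro mult_strict_left_mono) (auto simp: less_le)
    finally show False by (simp add: power2_eq_square)
  qed
  obtain s where s: "s \<in> S" "L2norm M (\<lambda>x. p x - s x) < e / 2" using pS[of "e/2"] e by auto
  obtain h where h: "L2fun M h" and sh: "s = (\<lambda>x. h x - l * h (T x))" using s(1) unfolding S_def mem_Collect_eq by blast
  note sL = S[OF s(1)]
  have fs: "L2norm M (\<lambda>x. f x - s x) < e / 2"
    using L2norm_triangle_diff[OF f p sL] r0 s(2) by (simp add: r_def)
  \<comment> \<open>Half of the budget \<open>e * real N\<close> pays for replacing \<open>f\<close>
    by \<open>s\<close>, the other half for the boundary term \<open>2 * L2norm M h\<close>, which
    does not grow with \<open>N\<close>.\<close>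
  obtain N :: nat where N: "real N > 4 * L2norm M h / e" using reals_Archimedean2 by blast
  have tel: "(\<Sum>n<k. l ^ n * s ((T ^^ n) x)) = h x - l ^ k * h ((T ^^ k) x)" for k x
    by (induction k) (auto simp: sh algebra_simps)
  have sum: "L2norm M (\<lambda>x. \<Sum>n<k. l ^ n * f ((T ^^ n) x)) \<le> real k * (e / 2) + 2 * L2norm M h" for k
  proof -
    have eq: "(\<lambda>x. \<Sum>n<k. l ^ n * f ((T ^^ n) x))
        = (\<lambda>x. (\<Sum>n<k. l ^ n * (f ((T ^^ n) x) - s ((T ^^ n) x))) + (h x - l ^ k * h ((T ^^ k) x)))"
      by (simp flip: tel sum.distrib) (simp add: algebra_simps)
    have "L2norm M (\<lambda>x. \<Sum>n<k. l ^ n * f ((T ^^ n) x))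
        \<le> L2norm M (\<lambda>x. \<Sum>n<k. l ^ n * (f ((T ^^ n) x) - s ((T ^^ n) x)))
        + L2norm M (\<lambda>x. h x - l ^ k * h ((T ^^ k) x))"
      unfolding eq by (intro L2norm_triangle L2fun_intros L2fun_mp_map[OF Tn] f sL h)
    moreover have "L2norm M (\<lambda>x. \<Sum>n<k. l ^ n * (f ((T ^^ n) x) - s ((T ^^ n) x))) \<le> real k * (e / 2)"
    proof -
      have "L2norm M (\<lambda>x. \<Sum>n<k. l ^ n * (f ((T ^^ n) x) - s ((T ^^ n) x)))
          \<le> (\<Sum>n<k. L2norm M (\<lambda>x. l ^ n * (f ((T ^^ n) x) - s ((T ^^ n) x))))"
        by (intro L2norm_triangle_sum L2fun_intros L2fun_mp_map[OF Tn] f sL)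
      also have "\<dots> = (\<Sum>n<k. L2norm M (\<lambda>x. f x - s x))"
        using L2norm_mp_map[OF Tn L2fun_diff[OF f sL]] by (simp add: L2norm_cmult norm_power l)
      also have "\<dots> \<le> real k * (e / 2)"
        unfolding sum_constant card_lessThan by (intro mult_left_mono less_imp_le[OF fs]) simp
      finally show ?thesis .
    qed
    moreover have "L2norm M (\<lambda>x. h x - l ^ k * h ((T ^^ k) x)) \<le> 2 * L2norm M h"
    proof -
      have "L2norm M (\<lambda>x. h x + - (l ^ k) * h ((T ^^ k) x)) \<le> L2norm M h + L2norm M (\<lambda>x. - (l ^ k) * h ((T ^^ k) x))"
        by (intro L2norm_triangle h L2fun_cmult L2fun_mp_map[OF Tn])
      also have "\<dots> = 2 * L2norm M h" unfolding L2norm_cmult by (simp add: norm_power l L2norm_mp_map[OF Tn h])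
      finally show ?thesis by simp
    qed
    ultimately show ?thesis by linarith
  qed
  have "N \<ge> 1"
  proof (rule ccontr)
    assume "\<not> N \<ge> 1"
    then have "4 * L2norm M h / e < 0" using N by simp
    then show False using e L2norm_nonneg[of M h] by (simp add: divide_less_0_iff del: L2norm_nonneg)
  qed
  moreover have "L2norm M (\<lambda>x. \<Sum>n<N. l ^ n * f ((T ^^ n) x)) < e * real N"
  proof -
    have "4 * L2norm M h < e * real N" using N e by (simp add: field_simps)
    then show ?thesis using sum[of N] by (simp add: field_simps)
  qed
  ultimately show thesis by (rule that)
qed

text \<open>A sum of length \<open>k * N\<close> consists of \<open>k\<close> blocks, each a
  unimodular multiple of the first block composed with a measure-preserving power, so all blocks
  have the same norm.\<close>

lemma (in prob_space) twisted_ergodic_sums_multiple: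
  assumes T: "mp_map M T" and f: "L2fun M f" and l: "cmod l = 1"
  shows "L2norm M (\<lambda>x. \<Sum>n<k * N. l ^ n * f ((T ^^ n) x)) \<le> real k * L2norm M (\<lambda>x. \<Sum>n<N. l ^ n * f ((T ^^ n) x))"
proof (induction k)
  case 0 then show ?case by (simp add: L2norm_def)
next
  case (Suc k)
  note Tn = mp_map_funpow[OF T]
  define v where "v = (\<lambda>N x. \<Sum>n<N. l ^ n * f ((T ^^ n) x))"
  have v: "L2fun M (v N)" for N unfolding v_def by (intro L2fun_intros L2fun_mp_map[OF Tn] f)
  have "v (k * N + j) x = v (k * N) x + l ^ (k * N) * v j ((T ^^ (k * N)) x)" for x j
  proof (induction j)
    case (Suc j)
    have "(T ^^ (k * N + j)) x = (T ^^ j) ((T ^^ (k * N)) x)"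
      by (metis add.commute comp_apply funpow_add)
    then show ?case using Suc by (simp add: v_def power_add algebra_simps)
  qed (simp add: v_def)
  from this[of N] have vk: "v (Suc k * N) = (\<lambda>x. v (k * N) x + l ^ (k * N) * v N ((T ^^ (k * N)) x))"
    by (auto simp: add.commute)
  have "L2norm M (v (Suc k * N)) \<le> L2norm M (v (k * N)) + L2norm M (\<lambda>x. l ^ (k * N) * v N ((T ^^ (k * N)) x))"
    unfolding vk by (intro L2norm_triangle L2fun_intros L2fun_mp_map[OF Tn] v)
  also have "\<dots> = L2norm M (v (k * N)) + L2norm M (v N)"
    by (simp add: L2norm_cmult norm_power l L2norm_mp_map[OF Tn v])
  also have "\<dots> \<le> real (Suc k) * L2norm M (v N)" using Suc by (simp add: v_def algebra_simps)
  finally show ?case unfolding v_def .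
qed

text \<open>In this form the squared norm is a polynomial in the coefficients and their conjugates.
  This gives continuity in \<open>l\<close> of the norms of the ergodic sums and feeds the Toeplitz
  estimate.\<close>

lemma L2norm_lincomb:
  assumes F: "\<And>n. L2fun M (F n)"
  shows "complex_of_real ((L2norm M (\<lambda>x. \<Sum>n<(N::nat). c n * F n x))\<^sup>2) = (\<Sum>n<N. \<Sum>m<N. c n * cnj (c m) * L2ip M (F n) (F m))"
proof -
  have "complex_of_real ((L2norm M (\<lambda>x. \<Sum>n<(N::nat). c n * F n x))\<^sup>2)
      = L2ip M (\<lambda>x. \<Sum>n<N. c n * F n x) (\<lambda>x. \<Sum>m<N. c m * F m x)" by (simp add: L2ip_self)
  also have "\<dots> = (\<Sum>n<N. L2ip M (\<lambda>x. c n * F n x) (\<lambda>x. \<Sum>m<N. c m * F m x))"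
    by (intro L2ip_sum_left L2fun_intros F)
  also have "\<dots> = (\<Sum>n<N. \<Sum>m<N. L2ip M (\<lambda>x. c n * F n x) (\<lambda>x. c m * F m x))"
    by (intro sum.cong refl L2ip_sum_right L2fun_intros F)
  finally show ?thesis by (simp add: L2ip_cmult_left L2ip_cmult_right mult.assoc)
qed

text \<open>A Dini argument: the normalised ergodic sums decrease along multiples, and the circle is compact.\<close>

lemma (in prob_space) twisted_ergodic_sums_uniformly_small:
  assumes T: "mp_map M T" and f: "L2fun M f"
    and orth: "\<And>g. eigenfunction M T g \<Longrightarrow> L2ip M f g = 0" and e: "e > 0"
  obtains K where "K \<ge> 1"
    "\<And>l. cmod l = 1 \<Longrightarrow> L2norm M (\<lambda>x. \<Sum>n<2 * K. l ^ n * f ((T ^^ n) x)) \<le> e * real (2 * K)"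
proof -
  define B where "B N l = L2norm M (\<lambda>x. \<Sum>n<N. l ^ n * f ((T ^^ n) x))" for N l
  have Fn: "L2fun M (\<lambda>x. f ((T ^^ n) x))" for n by (rule L2fun_mp_map[OF mp_map_funpow[OF T] f])
  have B_eq: "B N l = sqrt (Re (\<Sum>n<N. \<Sum>m<N. l ^ n * cnj (l ^ m) * L2ip M (\<lambda>x. f ((T ^^ n) x)) (\<lambda>x. f ((T ^^ m) x))))" for N l
  proof -
    have "complex_of_real ((B N l)\<^sup>2) = (\<Sum>n<N. \<Sum>m<N. l ^ n * cnj (l ^ m) * L2ip M (\<lambda>x. f ((T ^^ n) x)) (\<lambda>x. f ((T ^^ m) x)))"
      unfolding B_def by (rule L2norm_lincomb[where F = "\<lambda>n x. f ((T ^^ n) x)" and c = "\<lambda>n. l ^ n", OF Fn])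
    from this[symmetric] show ?thesis by (simp only: Re_complex_of_real) (simp add: B_def)
  qed
  have cont: "continuous_on UNIV (B N)" for N
    unfolding B_eq by (intro continuous_intros)
  have op: "open {l. B N l < e * real N}" for N
    by (intro open_Collect_less cont continuous_on_const)
  have cov: "sphere 0 1 \<subseteq> (\<Union>N\<in>{1..}. {l. B N l < e * real N})"
  proof
    fix l :: complex assume "l \<in> sphere 0 1"
    then have "cmod l = 1" by simp
    from twisted_ergodic_sums_small[OF T f orth this e]
    show "l \<in> (\<Union>N\<in>{1..}. {l. B N l < e * real N})" unfolding B_def by fastforce
  qed
  obtain C where C: "C \<subseteq> {1..}" "finite C" "sphere 0 1 \<subseteq> (\<Union>N\<in>C. {l. B N l < e * real N})"
    using compactE_image[OF compact_sphere op cov] by metis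
  have "\<Prod>C \<ge> 1" using C(1) by (intro prod_ge_1) auto
  moreover have "B (2 * \<Prod>C) l \<le> e * real (2 * \<Prod>C)" if l: "cmod l = 1" for l
  proof -
    have "l \<in> sphere 0 1" using l by simp
    then obtain N where N: "N \<in> C" "B N l < e * real N" using C(3) by auto
    \<comment> \<open>The product of the lengths in the finite subcover is a common multiple of
      them; the factor 2 provides the even length that the Toeplitz estimate compares with blocks of
      half the size.\<close>
    have "N dvd 2 * \<Prod>C" using dvd_prodI[OF C(2) N(1), of id] by simp
    then obtain k where k: "2 * \<Prod>C = k * N" by (metis dvd_def mult.commute)
    have "B (k * N) l \<le> real k * B N l" unfolding B_def by (rule twisted_ergodic_sums_multiple[OF T f l])
    also have "\<dots> \<le> real k * (e * real N)" using N(2) by (intro mult_left_mono) auto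
    finally show ?thesis unfolding k by (simp add: mult.left_commute)
  qed
  ultimately show thesis using that[of "\<Prod>C"] by (simp add: B_def)
qed

section \<open>Mean squares of correlations\<close>

lemma sum_roots_unity_character:
  assumes a: "a < L" and b: "b < L"
  defines "w \<equiv> \<lambda>j::nat. cis (2 * pi * real j / real L)"
  shows "(\<Sum>j<L. w j ^ a * cnj (w j) ^ b) = (if a = b then of_nat L else 0)"
proof -
  \<comment> \<open>Each term is a power of the single root of unity \<open>z\<close>, so the sum is
    geometric. The bounds \<open>a < L\<close> and \<open>b < L\<close> exclude \<open>z = 1\<close>
    for distinct exponents.\<close>
  define z where "z = cis (2 * pi * (real a - real b) / real L)"
  have L: "real L > 0" using a by simp
  have eq: "w j ^ a * cnj (w j) ^ b = z ^ j" for j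
  proof -
    have "w j ^ a * cnj (w j) ^ b = cis (real a * (2 * pi * real j / real L)) * cis (real b * (- (2 * pi * real j / real L)))"
      unfolding w_def cis_cnj by (simp only: Complex.DeMoivre)
    also have "\<dots> = cis (real j * (2 * pi * (real a - real b) / real L))"
      using L by (simp add: cis_mult field_simps)
    also have "\<dots> = z ^ j" unfolding z_def by (simp only: Complex.DeMoivre)
    finally show ?thesis .
  qed
  show ?thesis
  proof (cases "a = b")
    case True
    then show ?thesis unfolding eq by (simp add: z_def)
  next
    case False
    have "real L * (2 * pi * (real a - real b) / real L) = 2 * pi * of_int (int a - int b)"
      using L by simp
    then have "z ^ L = cis (2 * pi * of_int (int a - int b))"
      unfolding z_def Complex.DeMoivre by (rule arg_cong)
    then have zL: "z ^ L = 1" by (simp only: cis_multiple_2pi[OF Ints_of_int])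
    have "z \<noteq> 1"
    proof
      assume "z = 1"
      then have "cos (2 * pi * (real a - real b) / real L) = 1" unfolding z_def by (simp add: complex_eq_iff)
      then obtain k :: int where "2 * pi * (real a - real b) / real L = of_int k * 2 * pi"
        by (auto simp: cos_one_2pi_int)
      then have "2 * pi * ((real a - real b) / real L) = 2 * pi * of_int k" by simp
      then have "(real a - real b) / real L = of_int k" by (subst (asm) mult_left_cancel) simp_all
      then have "real a - real b = of_int k * real L" using L by (simp add: field_simps)
      then have "of_int (int a - int b) = (of_int (k * int L) :: real)" by simp
      then have k: "int a - int b = k * int L" by (simp only: of_int_eq_iff)
      have "\<bar>k * int L\<bar> < int L" using a b k by linarith
      then have "\<bar>k\<bar> * int L < 1 * int L" by (simp add: abs_mult)
      then have "\<bar>k\<bar> < 1" by (rule mult_right_less_imp_less) simp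
      then show False using k False by simp
    qed
    have "(\<Sum>j<L. z ^ j) = 0" using \<open>z \<noteq> 1\<close> zL by (simp add: geometric_sum)
    then show ?thesis using False unfolding eq by simp
  qed
qed

text \<open>Parseval for the quadratic form in the assumption: average its square over the roots of unity of
  order \<open>4 K\<close>, and use that a diagonal meeting the first \<open>K\<close> rows and columns occurs at least \<open>K\<close> times.\<close>

lemma toeplitz_square_sum_bound:
  fixes A :: "nat \<Rightarrow> nat \<Rightarrow> complex" and K :: nat
  assumes toep: "\<And>n m j. A (n + j) (m + j) = A n m" and K: "K \<ge> 1"
    and G: "\<And>l. cmod l = 1 \<Longrightarrow> \<exists>g::real. 0 \<le> g \<and> g \<le> C \<and>
      (\<Sum>n<2*K. \<Sum>m<2*K. l ^ n * cnj (l ^ m) * A n m) = of_real g"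
  shows "(\<Sum>n<K. \<Sum>m<K. (cmod (A n m))\<^sup>2) \<le> 2 * C * Re (A 0 0)"
proof -
  define N where "N = 2 * K"
  \<comment> \<open>Exponents such as \<open>n + m'\<close> stay below \<open>2 * N\<close>, so
    roots of unity of this order separate them without aliasing.\<close>
  define L where "L = 2 * N"
  define w where "w = (\<lambda>j::nat. cis (2 * pi * real j / real L))"
  have L0: "L > 0" using K by (simp add: L_def N_def)
  have "\<exists>g. \<forall>j. 0 \<le> g j \<and> g j \<le> C \<and> (\<Sum>n<N. \<Sum>m<N. w j ^ n * cnj (w j ^ m) * A n m) = complex_of_real (g j)"
    unfolding N_def by (intro choice allI G) (simp add: w_def)
  then obtain g where g0: "\<And>j. 0 \<le> g j" and gC: "\<And>j. g j \<le> C"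
    and geq: "\<And>j. (\<Sum>n<N. \<Sum>m<N. w j ^ n * cnj (w j ^ m) * A n m) = complex_of_real (g j)"
    by blast
  have char: "(\<Sum>j<L. w j ^ a * cnj (w j) ^ b) = (if a = b then of_nat L else 0)" if "a < L" "b < L" for a b
    unfolding w_def using that by (rule sum_roots_unity_character)
  have sum1: "(\<Sum>j<L. g j) = real L * real N * Re (A 0 0)"
  proof -
    have "complex_of_real (\<Sum>j<L. g j) = (\<Sum>j<L. \<Sum>n<N. \<Sum>m<N. (w j ^ n * cnj (w j) ^ m) * A n m)"
      unfolding of_real_sum geq[symmetric] by simp
    also have "\<dots> = (\<Sum>n<N. \<Sum>j<L. \<Sum>m<N. (w j ^ n * cnj (w j) ^ m) * A n m)" by (rule sum.swap)
    also have "\<dots> = (\<Sum>n<N. \<Sum>m<N. \<Sum>j<L. (w j ^ n * cnj (w j) ^ m) * A n m)"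
      by (intro sum.cong refl sum.swap)
    also have "\<dots> = (\<Sum>n<N. \<Sum>m<N. (if n = m then of_nat L else 0) * A n m)"
      unfolding sum_distrib_right[symmetric] by (intro sum.cong refl arg_cong2[where f="(*)"] char) (auto simp: L_def)
    also have "\<dots> = (\<Sum>n<N. of_nat L * A n n)" by (intro sum.cong refl) (simp add: if_distrib[of "\<lambda>x. x * _"] cong: if_cong)
    also have "\<dots> = (\<Sum>n<N. of_nat L * A 0 0)"
    proof (intro sum.cong refl)
      fix n show "of_nat L * A n n = of_nat L * A 0 0" using toep[of 0 n 0] by simp
    qed
    finally have "complex_of_real (\<Sum>j<L. g j) = of_nat N * (of_nat L * A 0 0)" by simp
    from arg_cong[OF this, of Re] show ?thesis by simp
  qed
  \<comment> \<open>The condition \<open>n + m' = m + n'\<close> says, without subtraction on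
    naturals, that \<open>(n, m)\<close> and \<open>(n', m')\<close> lie on one diagonal. There
    \<open>A\<close> is constant, so the product of \<open>A n m\<close> with the conjugate of
    \<open>A n' m'\<close> is a squared modulus.\<close>
  define Q where "Q = (\<Sum>n<N. \<Sum>m<N. \<Sum>n'<N. \<Sum>m'<N. if n + m' = m + n' then (cmod (A n m))\<^sup>2 else 0)"
  have A_eq: "A n m = A n' m'" if "n + m' = m + n'" for n m n' m'
  proof (cases "n \<le> n'")
    case True
    then obtain j where "n' = n + j" using le_Suc_ex by blast
    then show ?thesis using that toep[of n j m] by (metis add.assoc add.commute add_left_cancel)
  next
    case False
    then obtain j where "n = n' + j" using le_Suc_ex nat_le_linear by blast
    then show ?thesis using that toep[of n' j m'] by (metis add.assoc add.commute add_left_cancel)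
  qed
  have sum2: "(\<Sum>j<L. (g j)\<^sup>2) = real L * Q"
  proof -
    have "complex_of_real (\<Sum>j<L. (g j)\<^sup>2) = (\<Sum>j<L. cnj (complex_of_real (g j)) * complex_of_real (g j))"
      by (simp add: power2_eq_square)
    also have "\<dots> = (\<Sum>j<L. \<Sum>n<N. \<Sum>m<N. \<Sum>n'<N. \<Sum>m'<N. (w j ^ (n + m') * cnj (w j) ^ (m + n')) * (A n m * cnj (A n' m')))"
      unfolding geq[symmetric] cnj_sum sum_distrib_left sum_distrib_right
      by (intro sum.cong refl) (simp add: power_add algebra_simps)
    also have "\<dots> = (\<Sum>n<N. \<Sum>m<N. \<Sum>n'<N. \<Sum>m'<N. \<Sum>j<L. (w j ^ (n + m') * cnj (w j) ^ (m + n')) * (A n m * cnj (A n' m')))"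
      by (rule trans[OF sum.swap sum.cong[OF refl]])+ (rule refl)
    also have "\<dots> = (\<Sum>n<N. \<Sum>m<N. \<Sum>n'<N. \<Sum>m'<N. (if n + m' = m + n' then of_nat L else 0) * (A n m * cnj (A n' m')))"
      unfolding sum_distrib_right[symmetric] by (intro sum.cong refl arg_cong2[where f="(*)"] char) (auto simp: L_def)
    also have "\<dots> = (\<Sum>n<N. \<Sum>m<N. \<Sum>n'<N. \<Sum>m'<N. of_nat L * complex_of_real (if n + m' = m + n' then (cmod (A n m))\<^sup>2 else 0))"
    proof (intro sum.cong refl)
      fix n m n' m'
      show "(if n + m' = m + n' then of_nat L else 0) * (A n m * cnj (A n' m'))
          = of_nat L * complex_of_real (if n + m' = m + n' then (cmod (A n m))\<^sup>2 else 0)"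
        using A_eq[of n m' m n'] by (simp add: complex_norm_square del: of_real_power)
    qed
    also have "\<dots> = complex_of_real (real L * Q)"
      unfolding Q_def by (simp add: sum_distrib_left)
    finally show ?thesis by (simp only: of_real_eq_iff)
  qed
  have "real K * (\<Sum>n<K. \<Sum>m<K. (cmod (A n m))\<^sup>2) \<le> Q"
  proof -
    define c where "c = (\<lambda>n m. (cmod (A n m))\<^sup>2)"
    \<comment> \<open>For each row \<open>n'\<close> in \<open>{n..<n+K}\<close> the diagonal of
      \<open>(n, m)\<close> is met at column \<open>m + n' - n\<close>, which is below
      \<open>2 * K\<close>; this supplies the \<open>K\<close> copies.\<close>
    have low: "real K * c n m \<le> (\<Sum>n'<N. \<Sum>m'<N. if n + m' = m + n' then c n m else 0)" if "n < K" "m < K" for n m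
    proof -
      have "real K * c n m = (\<Sum>n'\<in>{n..<n+K}. \<Sum>m'<N. if n + m' = m + n' then c n m else 0)"
      proof -
        have "(\<Sum>m'<N. if n + m' = m + n' then c n m else 0) = c n m" if "n' \<in> {n..<n+K}" for n'
        proof -
          have "(\<Sum>m'<N. if n + m' = m + n' then c n m else 0) = (\<Sum>m'<N. if m' = m + n' - n then c n m else 0)"
            using that by (intro sum.cong refl if_cong) auto
          also have "\<dots> = c n m"
          proof -
            have "m + n' - n < N" using that \<open>m < K\<close> by (auto simp: N_def)
            then show ?thesis by simp
          qed
          finally show ?thesis .
        qed
        then show ?thesis by simp
      qed
      also have "\<dots> \<le> (\<Sum>n'<N. \<Sum>m'<N. if n + m' = m + n' then c n m else 0)"
        using that by (intro sum_mono2 sum_nonneg) (auto simp: N_def c_def)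
      finally show ?thesis .
    qed
    have "real K * (\<Sum>n<K. \<Sum>m<K. c n m) \<le> (\<Sum>n<K. \<Sum>m<K. \<Sum>n'<N. \<Sum>m'<N. if n + m' = m + n' then c n m else 0)"
      unfolding sum_distrib_left by (intro sum_mono low) auto
    also have "\<dots> \<le> (\<Sum>n<K. \<Sum>m<N. \<Sum>n'<N. \<Sum>m'<N. if n + m' = m + n' then c n m else 0)"
      by (intro sum_mono sum_mono2 sum_nonneg) (auto simp: N_def c_def)
    also have "\<dots> \<le> (\<Sum>n<N. \<Sum>m<N. \<Sum>n'<N. \<Sum>m'<N. if n + m' = m + n' then c n m else 0)"
      by (intro sum_mono2 sum_nonneg) (auto simp: N_def c_def)
    finally show ?thesis unfolding Q_def c_def .
  qed
  moreover have "real L * Q \<le> real L * (C * real N * Re (A 0 0))"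
  proof -
    \<comment> \<open>Since \<open>g\<close> takes values between \<open>0\<close> and
      \<open>C\<close>, its mean square is at most \<open>C\<close> times its mean, and the mean
      retains only the diagonal of \<open>A\<close>.\<close>
    have "(g j)\<^sup>2 \<le> C * g j" for j using mult_right_mono[OF gC[of j] g0[of j]] by (simp add: power2_eq_square)
    then have "(\<Sum>j<L. (g j)\<^sup>2) \<le> C * (\<Sum>j<L. g j)" unfolding sum_distrib_left by (intro sum_mono)
    then show ?thesis unfolding sum1 sum2 by (simp add: algebra_simps)
  qed
  then have "Q \<le> C * real N * Re (A 0 0)" using L0 by simp
  ultimately have "real K * (\<Sum>n<K. \<Sum>m<K. (cmod (A n m))\<^sup>2) \<le> real K * (2 * C * Re (A 0 0))"
    by (simp add: N_def algebra_simps)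
  then show ?thesis using K by simp
qed

text \<open>A duality argument: \<open>g\<close> is tested against the combination of the
  \<open>F n\<close> whose coefficients are the conjugate correlations, since its inner product with
  \<open>g\<close> is the sum to be bounded. The norm of this combination is controlled by the
  Hilbert-Schmidt norm of the Gram matrix, through Cauchy-Schwarz over pairs of indices.\<close>

lemma sum_square_correlations_le:
  fixes K :: nat
  assumes F: "\<And>n. L2fun M (F n)" and g: "L2fun M g"
  shows "(\<Sum>n<K. (cmod (L2ip M (F n) g))\<^sup>2) \<le> (L2norm M g)\<^sup>2 * sqrt (\<Sum>n<K. \<Sum>m<K. (cmod (L2ip M (F n) (F m)))\<^sup>2)"
proof -
  define c where "c = (\<lambda>n. L2ip M (F n) g)"
  define A where "A = (\<lambda>n m. L2ip M (F n) (F m))"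
  define s where "s = (\<Sum>n<K. (cmod (c n))\<^sup>2)"
  define Q where "Q = (\<Sum>n<K. \<Sum>m<K. (cmod (A n m))\<^sup>2)"
  define v where "v = (\<lambda>x. \<Sum>n<K. cnj (c n) * F n x)"
  have v: "L2fun M v" unfolding v_def by (intro L2fun_intros F)
  have s0: "s \<ge> 0" unfolding s_def by (intro sum_nonneg) auto
  have Q0: "Q \<ge> 0" unfolding Q_def by (intro sum_nonneg) auto
  have "L2ip M v g = (\<Sum>n<K. L2ip M (\<lambda>x. cnj (c n) * F n x) g)"
    unfolding v_def by (intro L2ip_sum_left L2fun_intros F g)
  also have "\<dots> = of_real s"
    unfolding s_def of_real_sum L2ip_cmult_left by (intro sum.cong refl) (simp add: complex_norm_square c_def mult.commute del: of_real_power)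
  finally have vg: "L2ip M v g = of_real s" .
  have sv: "s \<le> L2norm M v * L2norm M g" using Cauchy_Schwarz_L2[OF v g] s0 by (simp add: vg)
  have "(L2norm M v)\<^sup>2 = cmod (complex_of_real ((L2norm M v)\<^sup>2))" by (simp del: of_real_power)
  also have "\<dots> = cmod (\<Sum>n<K. \<Sum>m<K. cnj (c n) * cnj (cnj (c m)) * A n m)"
    unfolding v_def L2norm_lincomb[OF F] A_def ..
  also have "\<dots> \<le> (\<Sum>n<K. \<Sum>m<K. cmod (cnj (c n) * cnj (cnj (c m)) * A n m))"
    by (intro order_trans[OF norm_sum] sum_mono norm_sum)
  also have "\<dots> = (\<Sum>(n,m)\<in>{..<K}\<times>{..<K}. (cmod (c n) * cmod (c m)) * cmod (A n m))"
    by (simp add: sum.cartesian_product norm_mult)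
  also have "\<dots> \<le> sqrt (s\<^sup>2 * Q)"
  proof (rule real_le_rsqrt)
    have "(\<Sum>(n,m)\<in>{..<K}\<times>{..<K}. (cmod (c n) * cmod (c m)) * cmod (A n m))\<^sup>2
       \<le> (\<Sum>(n,m)\<in>{..<K}\<times>{..<K}. (cmod (c n) * cmod (c m))\<^sup>2) * (\<Sum>(n,m)\<in>{..<K}\<times>{..<K}. (cmod (A n m))\<^sup>2)"
      unfolding case_prod_unfold by (rule Cauchy_Schwarz_ineq_sum)
    also have "(\<Sum>(n,m)\<in>{..<K}\<times>{..<K}. (cmod (c n) * cmod (c m))\<^sup>2) = s\<^sup>2"
      unfolding s_def power2_eq_square[of "sum _ _"] sum_product sum.cartesian_product by (simp add: power_mult_distrib)
    also have "(\<Sum>(n,m)\<in>{..<K}\<times>{..<K}. (cmod (A n m))\<^sup>2) = Q" unfolding Q_def sum.cartesian_product ..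
    finally show "(\<Sum>(n,m)\<in>{..<K}\<times>{..<K}. (cmod (c n) * cmod (c m)) * cmod (A n m))\<^sup>2 \<le> s\<^sup>2 * Q" .
  qed
  finally have vs: "(L2norm M v)\<^sup>2 \<le> s * sqrt Q" using s0 by (simp add: real_sqrt_mult)
  have "s\<^sup>2 \<le> (L2norm M v)\<^sup>2 * (L2norm M g)\<^sup>2" using power_mono[OF sv s0, of 2] by (simp add: power_mult_distrib)
  also have "\<dots> \<le> s * sqrt Q * (L2norm M g)\<^sup>2" using vs by (rule mult_right_mono) simp
  finally have "s * s \<le> s * ((L2norm M g)\<^sup>2 * sqrt Q)" by (simp add: power2_eq_square mult.assoc mult.commute)
  then have "s \<le> (L2norm M g)\<^sup>2 * sqrt Q"
    using s0 Q0 by (cases "s = 0") (auto simp: mult_le_cancel_left)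
  then show ?thesis by (simp add: s_def Q_def c_def A_def)
qed

text \<open>On average over \<open>n < K\<close> the sum over \<open>I\<close> of the squared
  correlations is below \<open>e\<^sup>2\<close>, so a single \<open>n\<close> serves all of the
  finitely many \<open>h i\<close> at once.\<close>

lemma (in prob_space) exists_small_correlations:
  assumes T: "mp_map M T" and f: "L2fun M f"
    and orth: "\<And>g. eigenfunction M T g \<Longrightarrow> L2ip M f g = 0" and e: "e > 0"
    and I: "finite I" and h: "\<And>i. i \<in> I \<Longrightarrow> L2fun M (h i)"
  obtains n where "\<And>i. i \<in> I \<Longrightarrow> cmod (L2ip M (\<lambda>x. f ((T ^^ n) x)) (h i)) < e"
proof -
  define H where "H = (\<Sum>i\<in>I. (L2norm M (h i))\<^sup>2)"
  \<comment> \<open>Chosen so that \<open>3 * \<delta> * L2norm M f * H\<close> falls below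
    \<open>e\<^sup>2\<close>; the \<open>+ 1\<close> keeps the denominator positive.\<close>
  define \<delta> where "\<delta> = e\<^sup>2 / (3 * L2norm M f * H + 1)"
  define F where "F = (\<lambda>n x. f ((T ^^ n) x))"
  define A where "A = (\<lambda>n m. L2ip M (F n) (F m))"
  have H0: "H \<ge> 0" unfolding H_def by (intro sum_nonneg) auto
  have den: "3 * L2norm M f * H + 1 > 0" using H0 by (simp add: add_nonneg_pos)
  have d0: "\<delta> > 0" using e den by (simp add: \<delta>_def)
  note Tn = mp_map_funpow[OF T]
  have F: "L2fun M (F n)" for n unfolding F_def by (rule L2fun_mp_map[OF Tn f])
  obtain K where K: "K \<ge> 1"
    and "\<And>l. cmod l = 1 \<Longrightarrow> L2norm M (\<lambda>x. \<Sum>n<2 * K. l ^ n * f ((T ^^ n) x)) \<le> \<delta> * real (2 * K)"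
    by (rule twisted_ergodic_sums_uniformly_small[OF T f orth d0], assumption, rule that, assumption, blast)
  then have Kb: "L2norm M (\<lambda>x. \<Sum>n<2 * K. l ^ n * F n x) \<le> \<delta> * real (2 * K)" if "cmod l = 1" for l
    using that by (simp only: F_def)
  have toep: "A (n + j) (m + j) = A n m" for n m j
  proof -
    have "F (n + j) = (\<lambda>x. F n ((T ^^ j) x))" for n unfolding F_def by (simp add: funpow_add)
    then show ?thesis unfolding A_def using L2ip_mp_map[OF Tn F F] by simp
  qed
  have A0: "Re (A 0 0) = (L2norm M f)\<^sup>2" by (simp add: A_def F_def L2ip_self)
  have "(\<Sum>n<K. \<Sum>m<K. (cmod (A n m))\<^sup>2) \<le> 2 * (\<delta> * real (2 * K))\<^sup>2 * Re (A 0 0)"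
  proof (rule toeplitz_square_sum_bound[of A, OF toep K])
    fix l :: complex assume l: "cmod l = 1"
    have "(\<Sum>n<2*K. \<Sum>m<2*K. l ^ n * cnj (l ^ m) * A n m) = complex_of_real ((L2norm M (\<lambda>x. \<Sum>n<2 * K. l ^ n * F n x))\<^sup>2)"
      unfolding L2norm_lincomb[OF F] A_def ..
    moreover have "(L2norm M (\<lambda>x. \<Sum>n<2 * K. l ^ n * F n x))\<^sup>2 \<le> (\<delta> * real (2 * K))\<^sup>2"
      by (intro power_mono Kb l) simp
    ultimately show "\<exists>g\<ge>0. g \<le> (\<delta> * real (2 * K))\<^sup>2 \<and> (\<Sum>n<2*K. \<Sum>m<2*K. l ^ n * cnj (l ^ m) * A n m) = complex_of_real g"
      by (intro exI[of _ "(L2norm M (\<lambda>x. \<Sum>n<2 * K. l ^ n * F n x))\<^sup>2"]) simp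
  qed
  \<comment> \<open>The factor \<open>8 = 2 * 2\<^sup>2\<close> is rounded up to the perfect square
    \<open>9\<close>.\<close>
  also have "\<dots> \<le> (3 * real K * \<delta> * L2norm M f)\<^sup>2"
    unfolding A0 by (simp add: power_mult_distrib mult_right_mono)
  finally have "sqrt (\<Sum>n<K. \<Sum>m<K. (cmod (A n m))\<^sup>2) \<le> sqrt ((3 * real K * \<delta> * L2norm M f)\<^sup>2)"
    by (rule real_sqrt_le_mono)
  also have "\<dots> = 3 * real K * \<delta> * L2norm M f" using d0 by (simp add: real_sqrt_mult real_sqrt_abs)
  finally have sq: "sqrt (\<Sum>n<K. \<Sum>m<K. (cmod (A n m))\<^sup>2) \<le> 3 * real K * \<delta> * L2norm M f" .
  have "(\<Sum>n<K. \<Sum>i\<in>I. (cmod (L2ip M (F n) (h i)))\<^sup>2) = (\<Sum>i\<in>I. \<Sum>n<K. (cmod (L2ip M (F n) (h i)))\<^sup>2)" by (rule sum.swap)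
  also have "\<dots> \<le> (\<Sum>i\<in>I. (L2norm M (h i))\<^sup>2 * (3 * real K * \<delta> * L2norm M f))"
    using sq unfolding A_def
    by (intro sum_mono order_trans[OF sum_square_correlations_le[OF F h]] mult_left_mono) auto
  also have "\<dots> = real K * (\<delta> * (3 * L2norm M f * H))" unfolding H_def sum_distrib_right[symmetric] by (simp add: algebra_simps)
  also have "\<dots> < real K * e\<^sup>2"
  proof -
    have "\<delta> * (3 * L2norm M f * H) < \<delta> * (3 * L2norm M f * H + 1)" using d0 by simp
    also have "\<dots> = e\<^sup>2" using den by (simp add: \<delta>_def)
    finally show ?thesis using K by simp
  qed
  also have "\<dots> = (\<Sum>n<K. e\<^sup>2)" by simp
  finally obtain n where n: "(\<Sum>i\<in>I. (cmod (L2ip M (F n) (h i)))\<^sup>2) < e\<^sup>2"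
    by (metis (no_types, lifting) linorder_not_le sum_mono)
  have "cmod (L2ip M (F n) (h i)) < e" if "i \<in> I" for i
  proof -
    have "(cmod (L2ip M (F n) (h i)))\<^sup>2 \<le> (\<Sum>i\<in>I. (cmod (L2ip M (F n) (h i)))\<^sup>2)"
      using I that by (intro member_le_sum) auto
    then show ?thesis using n e by (intro power2_less_imp_less[of _ e]) auto
  qed
  then show thesis using that unfolding F_def by blast
qed

section \<open>Self-couplings and their lifts\<close>

lemma C2D:
  assumes "\<rho> \<in> C2 M"
  shows "sets \<rho> = sets (M \<Otimes>\<^sub>M M)" "prob_space \<rho>" "space \<rho> = space M \<times> space M"
    "\<And>A. A \<in> sets M \<Longrightarrow> measure \<rho> (A \<times> space M) = measure M A"
    "\<And>B. B \<in> sets M \<Longrightarrow> measure \<rho> (space M \<times> B) = measure M B"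
  using assms sets_eq_imp_space_eq[of \<rho> "M \<Otimes>\<^sub>M M"] by (auto simp: C2_def measure_def space_pair_measure)

section \<open>The topology on self-couplings\<close>

lemma topspace_C2_topology [simp]: "topspace (C2_topology M) = C2 M"
  unfolding C2_topology_def topology_generated_by_topspace
proof (intro equalityI subsetI)
  fix \<rho> assume "\<rho> \<in> C2 M"
  then have "\<rho> \<in> {\<rho> \<in> C2 M. measure \<rho> ({} \<times> {}) \<in> UNIV}" by simp
  then show "\<rho> \<in> \<Union> {{\<rho> \<in> C2 M. measure \<rho> (A \<times> B) \<in> U} |A B U. A \<in> sets M \<and> B \<in> sets M \<and> open U}"
    by (intro UnionI[rotated], assumption) (use open_UNIV in blast)
qed blast

lemma C2_eqI:
  assumes r: "\<rho> \<in> C2 M" "\<sigma> \<in> C2 M"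
    and eq: "\<And>A B. A \<in> sets M \<Longrightarrow> B \<in> sets M \<Longrightarrow> measure \<rho> (A \<times> B) = measure \<sigma> (A \<times> B)"
  shows "\<rho> = \<sigma>"
proof (rule measure_eqI_generator_eq[of "{A \<times> B | A B. A \<in> sets M \<and> B \<in> sets M}" "space M \<times> space M" \<rho> \<sigma> "\<lambda>_. space M \<times> space M"])
  interpret \<rho>: prob_space \<rho> by (rule C2D(2)[OF r(1)])
  interpret \<sigma>: prob_space \<sigma> by (rule C2D(2)[OF r(2)])
  show "Int_stable {A \<times> B | A B. A \<in> sets M \<and> B \<in> sets M}" by (rule Int_stable_pair_measure_generator)
  show "{A \<times> B | A B. A \<in> sets M \<and> B \<in> sets M} \<subseteq> Pow (space M \<times> space M)" by (rule pair_measure_closed)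
  show "sets \<rho> = sigma_sets (space M \<times> space M) {A \<times> B | A B. A \<in> sets M \<and> B \<in> sets M}"
    "sets \<sigma> = sigma_sets (space M \<times> space M) {A \<times> B | A B. A \<in> sets M \<and> B \<in> sets M}"
    using C2D(1)[OF r(1)] C2D(1)[OF r(2)] by (simp_all add: sets_pair_measure)
  show "emeasure \<rho> X = emeasure \<sigma> X" if "X \<in> {A \<times> B | A B. A \<in> sets M \<and> B \<in> sets M}" for X
    using that eq by (auto simp: \<rho>.emeasure_eq_measure \<sigma>.emeasure_eq_measure)
  show "emeasure \<rho> (space M \<times> space M) \<noteq> \<infinity>" by (simp add: \<rho>.emeasure_eq_measure)
qed auto

text \<open>The generating sets are only a subbase, so the induction follows the generation of
  \<open>V\<close>; intersections are the reason for finitely many rectangles and for the minimum of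
  the tolerances.\<close>

lemma C2_topology_neighbourhood:
  assumes "openin (C2_topology M) V" "\<rho>0 \<in> V"
  obtains P e where "finite P" "P \<subseteq> sets M \<times> sets M" "e > 0"
    "\<And>\<rho>. \<rho> \<in> C2 M \<Longrightarrow> (\<And>A B. (A, B) \<in> P \<Longrightarrow> \<bar>measure \<rho> (A \<times> B) - measure \<rho>0 (A \<times> B)\<bar> < e) \<Longrightarrow> \<rho> \<in> V"
proof -
  let ?N = "\<lambda>V. \<exists>P e. finite P \<and> P \<subseteq> sets M \<times> sets M \<and> e > 0 \<and>
    (\<forall>\<rho>\<in>C2 M. (\<forall>(A, B)\<in>P. \<bar>measure \<rho> (A \<times> B) - measure \<rho>0 (A \<times> B)\<bar> < e) \<longrightarrow> \<rho> \<in> V)"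
  have "generate_topology_on {{\<rho>\<in>C2 M. measure \<rho> (A \<times> B) \<in> U} | A B U. A \<in> sets M \<and> B \<in> sets M \<and> open U} V"
    using assms(1) by (simp add: C2_topology_def openin_topology_generated_by_iff)
  then have "\<rho>0 \<in> V \<longrightarrow> ?N V"
  proof (induction rule: generate_topology_on.induct)
    case (Int a b)
    show ?case
    proof
      assume "\<rho>0 \<in> a \<inter> b"
      then obtain P e Q d where P: "finite P" "P \<subseteq> sets M \<times> sets M" "e > 0"
        "\<forall>\<rho>\<in>C2 M. (\<forall>(A, B)\<in>P. \<bar>measure \<rho> (A \<times> B) - measure \<rho>0 (A \<times> B)\<bar> < e) \<longrightarrow> \<rho> \<in> a"
        and Q: "finite Q" "Q \<subseteq> sets M \<times> sets M" "d > 0"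
        "\<forall>\<rho>\<in>C2 M. (\<forall>(A, B)\<in>Q. \<bar>measure \<rho> (A \<times> B) - measure \<rho>0 (A \<times> B)\<bar> < d) \<longrightarrow> \<rho> \<in> b"
        using Int by auto
      show "?N (a \<inter> b)"
      proof (intro exI[of _ "P \<union> Q"] exI[of _ "min e d"] conjI ballI impI)
        fix \<rho> assume "\<rho> \<in> C2 M" "\<forall>(A, B)\<in>P \<union> Q. \<bar>measure \<rho> (A \<times> B) - measure \<rho>0 (A \<times> B)\<bar> < min e d"
        then show "\<rho> \<in> a \<inter> b" using P(4) Q(4) by (auto simp: case_prod_unfold)
      qed (use P Q in auto)
    qed
  next
    case (UN K)
    show ?case
    proof
      assume "\<rho>0 \<in> \<Union>K"
      then obtain k where "k \<in> K" "\<rho>0 \<in> k" by blast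
      with UN show "?N (\<Union>K)" by (meson UnionI)
    qed
  next
    case (Basis s)
    show ?case
    proof
      assume s: "\<rho>0 \<in> s"
      obtain A B U where ABU: "A \<in> sets M" "B \<in> sets M" "open U" "s = {\<rho>\<in>C2 M. measure \<rho> (A \<times> B) \<in> U}"
        using Basis by blast
      with s obtain e where "e > 0" "\<forall>y. dist y (measure \<rho>0 (A \<times> B)) < e \<longrightarrow> y \<in> U"
        by (auto simp: open_dist)
      with ABU show "?N s" by (intro exI[of _ "{(A, B)}"] exI[of _ e]) (auto simp: dist_real_def)
    qed
  qed simp
  with assms(2) that show thesis by (auto simp: case_prod_unfold)
qed

section \<open>Lifted maps and their integer powers\<close>

lemma lift_map_measurable:
  assumes "\<rho> \<in> C2 M" "R \<in> measurable M M"
  shows "(\<lambda>(x, y). (R x, R y)) \<in> measurable \<rho> (M \<Otimes>\<^sub>M M)"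
proof -
  note [measurable] = assms(2)
  show ?thesis by (subst measurable_cong_sets[OF C2D(1)[OF assms(1)] refl]) measurable
qed

lemma measure_lift_map:
  assumes "\<rho> \<in> C2 M" "R \<in> measurable M M" "A \<in> sets M" "B \<in> sets M"
  shows "emeasure (lift_map M R \<rho>) (A \<times> B) = emeasure \<rho> ((R -` A \<inter> space M) \<times> (R -` B \<inter> space M))"
    and "measure (lift_map M R \<rho>) (A \<times> B) = measure \<rho> ((R -` A \<inter> space M) \<times> (R -` B \<inter> space M))"
proof -
  show "emeasure (lift_map M R \<rho>) (A \<times> B) = emeasure \<rho> ((R -` A \<inter> space M) \<times> (R -` B \<inter> space M))"
    unfolding lift_map_def using assms
    by (subst emeasure_distr[OF lift_map_measurable]) (auto simp: C2D(3) intro!: arg_cong[where f="emeasure \<rho>"])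
  then show "measure (lift_map M R \<rho>) (A \<times> B) = measure \<rho> ((R -` A \<inter> space M) \<times> (R -` B \<inter> space M))"
    by (simp add: measure_def)
qed

lemma lift_map_in_C2:
  assumes r: "\<rho> \<in> C2 M" and R: "mp_map M R"
  shows "lift_map M R \<rho> \<in> C2 M"
proof -
  have m: "R \<in> measurable M M" and d: "distr M M R = M" using R by (auto simp: mp_map_def)
  have inv: "emeasure M (R -` A \<inter> space M) = emeasure M A" if "A \<in> sets M" for A
    using emeasure_distr[OF m that] d by simp
  have sp: "R -` space M \<inter> space M = space M" using measurable_space[OF m] by auto
  have "prob_space (lift_map M R \<rho>)" unfolding lift_map_def
    by (rule prob_space.prob_space_distr[OF C2D(2)[OF r] lift_map_measurable[OF r m]])
  moreover have "emeasure (lift_map M R \<rho>) (A \<times> space M) = emeasure M A"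
    "emeasure (lift_map M R \<rho>) (space M \<times> A) = emeasure M A" if A: "A \<in> sets M" for A
    using r A measurable_sets[OF m A] by (simp_all add: measure_lift_map(1)[OF r m] sp inv C2_def)
  moreover have "sets (lift_map M R \<rho>) = sets (M \<Otimes>\<^sub>M M)" by (simp add: lift_map_def)
  ultimately show ?thesis unfolding C2_def by blast
qed

lemma lift_map_comp:
  assumes r: "\<rho> \<in> C2 M" and R: "R \<in> measurable M M" "R' \<in> measurable M M"
  shows "lift_map M R (lift_map M R' \<rho>) = lift_map M (\<lambda>x. R (R' x)) \<rho>"
  unfolding lift_map_def
  by (subst distr_distr[OF _ lift_map_measurable[OF r R(2)]])
    (use R in \<open>auto simp: comp_def case_prod_unfold\<close>)

lemma lift_map_id: "\<rho> \<in> C2 M \<Longrightarrow> lift_map M (\<lambda>x. x) \<rho> = \<rho>"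
  using distr_id2[of "M \<Otimes>\<^sub>M M" \<rho>] C2D(1)[of \<rho> M] by (simp add: lift_map_def id_def)

locale standard_aut = prob_space M for M :: "'a::polish_space measure" +
  fixes T :: "'a \<Rightarrow> 'a"
  assumes sets_M: "sets M = sets borel" and aut: "mp_aut M T"
begin

text \<open>\<open>space M\<close> is the whole type, so the inverse relative to
  \<open>space M\<close> in \<open>mp_aut\<close> is the total inverse.\<close>

definition S :: "'a \<Rightarrow> 'a" where "S = inv T"

text \<open>Split by sign exactly like \<open>zpow\<close>, so that integer powers of the lift are
  lifts of these maps.\<close>

definition Tpow :: "int \<Rightarrow> 'a \<Rightarrow> 'a" where
  "Tpow n = (if 0 \<le> n then T ^^ nat n else S ^^ nat (- n))"

lemma space_M [simp]: "space M = UNIV"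
  using sets_eq_imp_space_eq[OF sets_M] by simp

lemma bij_T: "bij T" using aut by (simp add: mp_aut_def bij_def bij_betw_def)

lemma T_S [simp]: "T (S x) = x" unfolding S_def using bij_T by (simp add: bij_is_surj surj_f_inv_f)
lemma S_T [simp]: "S (T x) = x" unfolding S_def using bij_T by (simp add: bij_is_inj inv_f_f)

lemma funpow_S_T [simp]: "(S ^^ n) ((T ^^ n) x) = x"
  by (induction n arbitrary: x) (simp_all add: funpow_swap1)

lemma mp_T: "mp_map M T" using aut by (simp add: mp_aut_def mp_map_def)

lemma mp_S: "mp_map M S"
proof -
  have m: "S \<in> measurable M M" "T \<in> measurable M M" and d: "distr M M T = M"
    using aut by (auto simp: mp_aut_def S_def)
  have "distr M M S = distr (distr M M T) M S" by (simp add: d)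
  also have "\<dots> = distr M M (S \<circ> T)" by (rule distr_distr[OF m])
  also have "\<dots> = M" by (simp add: comp_def distr_id2)
  finally show ?thesis using m by (simp add: mp_map_def)
qed

lemma mp_Tpow: "mp_map M (Tpow n)"
  by (simp add: Tpow_def mp_map_funpow mp_T mp_S)

lemma funpow_lift_map:
  assumes "mp_map M R" "\<rho> \<in> C2 M"
  shows "(lift_map M R ^^ n) \<rho> = lift_map M (R ^^ n) \<rho>"
proof (induction n)
  case 0 then show ?case using lift_map_id[OF assms(2)] by (simp add: id_def)
next
  case (Suc n)
  then show ?case
    using lift_map_comp[OF assms(2), of R "R ^^ n"] assms(1) mp_map_funpow[OF assms(1), of n]
    by (simp add: mp_map_def comp_def)
qed

lemma inv_lift_map:
  assumes r: "\<rho> \<in> C2 M" shows "inv_into (C2 M) (lift_map M T) \<rho> = lift_map M S \<rho>"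
proof (rule inv_into_f_eq)
  have m: "S \<in> measurable M M" "T \<in> measurable M M" using mp_S mp_T by (auto simp: mp_map_def)
  show "inj_on (lift_map M T) (C2 M)"
  proof (rule inj_on_inverseI[of _ "lift_map M S"])
    fix \<sigma> assume "\<sigma> \<in> C2 M"
    then show "lift_map M S (lift_map M T \<sigma>) = \<sigma>" using lift_map_comp[of \<sigma> M S T] m lift_map_id by simp
  qed
  show "lift_map M S \<rho> \<in> C2 M" by (rule lift_map_in_C2[OF r mp_S])
  show "lift_map M T (lift_map M S \<rho>) = \<rho>" using lift_map_comp[OF r, of T S] m lift_map_id[OF r] by simp
qed

lemma zpow_lift_map:
  assumes r: "\<rho> \<in> C2 M"
  shows "zpow (C2_topology M) (lift_map M T) n \<rho> = lift_map M (Tpow n) \<rho>"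
proof -
  \<comment> \<open>\<open>inv_into (C2 M)\<close> is known to be the inverse lift only on
    \<open>C2 M\<close>, so the induction carries membership along with the equation.\<close>
  have "(inv_into (C2 M) (lift_map M T) ^^ k) \<rho> = (lift_map M S ^^ k) \<rho> \<and> (lift_map M S ^^ k) \<rho> \<in> C2 M" for k
    by (induction k) (use r in \<open>auto simp: inv_lift_map lift_map_in_C2[OF _ mp_S]\<close>)
  then show ?thesis
    by (simp add: zpow_def Tpow_def funpow_lift_map[OF mp_T r] funpow_lift_map[OF mp_S r])
qed

lemma measure_zpow_lift_map:
  assumes "\<rho> \<in> C2 M" "A \<in> sets M" "B \<in> sets M"
  shows "measure (zpow (C2_topology M) (lift_map M T) n \<rho>) (A \<times> B) = measure \<rho> ((Tpow n -` A) \<times> (Tpow n -` B))"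
  using measure_lift_map(2)[OF assms(1), of "Tpow n" A B] mp_Tpow[of n] assms
  by (simp add: zpow_lift_map mp_map_def)

end

section \<open>Distality and orthogonality to the eigenfunctions\<close>

lemma (in prob_space) integral_pair_mult:
  fixes u v :: "'a \<Rightarrow> real"
  assumes [measurable]: "u \<in> borel_measurable M" "v \<in> borel_measurable M"
    and u: "\<And>x. \<bar>u x\<bar> \<le> B" and v: "\<And>x. \<bar>v x\<bar> \<le> C"
  shows "integrable (M \<Otimes>\<^sub>M M) (\<lambda>z. u (fst z) * v (snd z))"
    "(\<integral>z. u (fst z) * v (snd z) \<partial>(M \<Otimes>\<^sub>M M)) = (\<integral>x. u x \<partial>M) * (\<integral>y. v y \<partial>M)"
proof -
  interpret P: pair_prob_space M M ..
  have B0: "B \<ge> 0" using u[of undefined] by linarith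
  have "\<bar>u x * v y\<bar> \<le> B * C" for x y
    unfolding abs_mult by (intro mult_mono u v B0) auto
  then show int: "integrable (M \<Otimes>\<^sub>M M) (\<lambda>z. u (fst z) * v (snd z))"
    by (intro P.P.integrable_const_bound[of _ "B * C"]) auto
  have "(\<integral>x. (\<integral>y. u x * v y \<partial>M) \<partial>M) = (\<integral>z. u (fst z) * v (snd z) \<partial>(M \<Otimes>\<^sub>M M))"
    using P.integral_fst'[OF int] by simp
  then show "(\<integral>z. u (fst z) * v (snd z) \<partial>(M \<Otimes>\<^sub>M M)) = (\<integral>x. u x \<partial>M) * (\<integral>y. v y \<partial>M)"
    by simp
qed

text \<open>Both marginals of this measure are \<open>M\<close> when \<open>f\<close> has integral zero.\<close>

definition rank_one_coupling :: "'a measure \<Rightarrow> ('a \<Rightarrow> real) \<Rightarrow> ('a \<times> 'a) measure" where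
  "rank_one_coupling M f = density (M \<Otimes>\<^sub>M M) (\<lambda>z. ennreal (1 + f (fst z) * f (snd z)))"

lemma (in prob_space) rank_one_coupling:
  fixes f :: "'a \<Rightarrow> real"
  assumes f[measurable]: "f \<in> borel_measurable M" and b: "\<And>x. \<bar>f x\<bar> \<le> 1" and z: "(\<integral>x. f x \<partial>M) = 0"
  shows "\<And>A B. A \<in> sets M \<Longrightarrow> B \<in> sets M \<Longrightarrow> measure (rank_one_coupling M f) (A \<times> B)
      = measure M A * measure M B + (\<integral>x. f x * indicator A x \<partial>M) * (\<integral>x. f x * indicator B x \<partial>M)"
    and "rank_one_coupling M f \<in> C2 M"
proof -
  let ?\<rho> = "rank_one_coupling M f"
  have fb: "\<bar>f x * f y\<bar> \<le> 1" for x y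
    unfolding abs_mult using mult_mono[OF b[of x] b[of y]] by simp
  have nn: "0 \<le> 1 + f x * f y" for x y using fb[of x y] by linarith
  have em: "emeasure ?\<rho> (A \<times> B)
      = ennreal (measure M A * measure M B + (\<integral>x. f x * indicator A x \<partial>M) * (\<integral>x. f x * indicator B x \<partial>M))"
    if [measurable]: "A \<in> sets M" "B \<in> sets M" for A B
  proof -
    \<comment> \<open>On a rectangle the density splits into two products of one-variable functions,
      to which Fubini applies.\<close>
    let ?g = "\<lambda>z. indicator A (fst z) * indicator B (snd z) + (f (fst z) * indicator A (fst z)) * (f (snd z) * indicator B (snd z)) :: real"
    have bd: "\<bar>indicator A x :: real\<bar> \<le> 1" "\<bar>f x * indicator A x\<bar> \<le> 1" for x A
      using b[of x] by (auto simp: indicator_def)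
    have m1: "(\<lambda>x. indicator A x :: real) \<in> borel_measurable M" "(\<lambda>x. indicator B x :: real) \<in> borel_measurable M"
      "(\<lambda>x. f x * indicator A x) \<in> borel_measurable M" "(\<lambda>x. f x * indicator B x) \<in> borel_measurable M" by measurable
    note p1 = integral_pair_mult[OF m1(1,2) bd(1) bd(1)] and p2 = integral_pair_mult[OF m1(3,4) bd(2) bd(2)]
    have "emeasure ?\<rho> (A \<times> B) = (\<integral>\<^sup>+z. ennreal (1 + f (fst z) * f (snd z)) * indicator (A \<times> B) z \<partial>(M \<Otimes>\<^sub>M M))"
      unfolding rank_one_coupling_def by (rule emeasure_density) measurable
    also have "\<dots> = (\<integral>\<^sup>+z. ennreal (?g z) \<partial>(M \<Otimes>\<^sub>M M))"
      by (intro nn_integral_cong) (auto simp: indicator_def)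
    also have "\<dots> = ennreal (\<integral>z. ?g z \<partial>(M \<Otimes>\<^sub>M M))"
    proof (intro nn_integral_eq_integral Bochner_Integration.integrable_add p1 p2 AE_I2)
      fix z show "0 \<le> ?g z" using nn[of "fst z" "snd z"] by (auto simp: indicator_def)
    qed
    also have "(\<integral>z. ?g z \<partial>(M \<Otimes>\<^sub>M M)) = measure M A * measure M B + (\<integral>x. f x * indicator A x \<partial>M) * (\<integral>x. f x * indicator B x \<partial>M)"
      by (subst Bochner_Integration.integral_add[OF p1(1) p2(1)]) (simp add: p1(2) p2(2))
    finally show ?thesis .
  qed
  \<comment> \<open>Needed to leave \<open>ennreal\<close>, which truncates negative values. As
    \<open>f\<close> is bounded by 1, each integral is at most the measure of its set.\<close>
  have nn2: "0 \<le> measure M A * measure M B + (\<integral>x. f x * indicator A x \<partial>M) * (\<integral>x. f x * indicator B x \<partial>M)"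
    if "A \<in> sets M" "B \<in> sets M" for A B
  proof -
    have [measurable]: "A \<in> sets M" "B \<in> sets M" by fact+
    have le: "\<bar>\<integral>x. f x * indicator A x \<partial>M\<bar> \<le> measure M A" if [measurable]: "A \<in> sets M" for A
    proof -
      have "\<bar>\<integral>x. f x * indicator A x \<partial>M\<bar> \<le> (\<integral>x. \<bar>f x * indicator A x\<bar> \<partial>M)" by (rule integral_abs_bound)
      also have "\<dots> \<le> (\<integral>x. indicator A x \<partial>M)"
        using b by (intro integral_mono integrable_const_bound[of _ 1]) (auto simp: indicator_def)
      finally show ?thesis by simp
    qed
    have "\<bar>(\<integral>x. f x * indicator A x \<partial>M) * (\<integral>x. f x * indicator B x \<partial>M)\<bar> \<le> measure M A * measure M B"
      unfolding abs_mult by (intro mult_mono le) (use that in auto)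
    then show ?thesis by linarith
  qed
  show "measure ?\<rho> (A \<times> B) = measure M A * measure M B + (\<integral>x. f x * indicator A x \<partial>M) * (\<integral>x. f x * indicator B x \<partial>M)"
    if "A \<in> sets M" "B \<in> sets M" for A B
    unfolding measure_def[of ?\<rho>] em[OF that] using nn2[OF that] by simp
  have sp: "(\<integral>x. f x * indicator (space M) x \<partial>M) = 0"
    using z by (subst Bochner_Integration.integral_cong[OF refl, of _ _ f]) auto
  have s: "sets ?\<rho> = sets (M \<Otimes>\<^sub>M M)" by (simp add: rank_one_coupling_def)
  have marg: "emeasure ?\<rho> (A \<times> space M) = emeasure M A" "emeasure ?\<rho> (space M \<times> A) = emeasure M A" if "A \<in> sets M" for A
    using em[OF that sets.top] em[OF sets.top that] by (simp_all add: sp prob_space emeasure_eq_measure)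
  have "prob_space ?\<rho>"
    by (rule prob_spaceI) (use marg(1)[OF sets.top] sets_eq_imp_space_eq[OF s] in \<open>simp add: space_pair_measure emeasure_space_1\<close>)
  with s marg show "?\<rho> \<in> C2 M" unfolding C2_def by blast
qed

text \<open>The product measure is treated as the case \<open>f = 0\<close>, so that both couplings
  in the proximality argument obey one rectangle formula.\<close>

lemma (in prob_space) rank_one_coupling_zero:
  "rank_one_coupling M (\<lambda>_. 0) \<in> C2 M"
  "A \<in> sets M \<Longrightarrow> B \<in> sets M \<Longrightarrow> measure (rank_one_coupling M (\<lambda>_. 0)) (A \<times> B) = measure M A * measure M B"
  using rank_one_coupling[of "\<lambda>_. 0"] by simp_all

lemma AE_zero_if_integrals_zero:
  fixes f :: "'a \<Rightarrow> real"
  assumes f: "integrable M f" and z: "\<And>A. A \<in> sets M \<Longrightarrow> (\<integral>x. f x * indicator A x \<partial>M) = 0"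
  shows "AE x in M. f x = 0"
proof -
  have [measurable]: "f \<in> borel_measurable M" using f by auto
  have pos: "AE x in M. g x * indicator {x \<in> space M. g x > 0} x = 0"
    if g: "integrable M g" "\<And>A. A \<in> sets M \<Longrightarrow> (\<integral>x. g x * indicator A x \<partial>M) = 0" for g :: "'a \<Rightarrow> real"
  proof -
    have [measurable]: "g \<in> borel_measurable M" using g by auto
    have "(\<integral>x. g x * indicator {x \<in> space M. g x > 0} x \<partial>M) = 0" by (rule g(2)) measurable
    moreover have "integrable M (\<lambda>x. g x * indicator {x \<in> space M. g x > 0} x)"
      by (rule integrable_real_mult_indicator[OF _ g(1)]) measurable
    ultimately show ?thesis
      by (subst (asm) integral_nonneg_eq_0_iff_AE) (auto simp: indicator_def)
  qed
  have "AE x in M. f x * indicator {x \<in> space M. f x > 0} x = 0" by (rule pos[OF f z])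
  moreover have "AE x in M. - f x * indicator {x \<in> space M. - f x > 0} x = 0"
    by (rule pos) (use f z in auto)
  ultimately show ?thesis
    by (rule AE_mp[OF _ AE_mp]) (auto intro!: AE_I2 simp: indicator_def split: if_splits)
qed

context standard_aut begin

text \<open>Orthogonality to this eigenfunction gives \<open>f\<close> mean zero, hence the right
  marginals of its coupling.\<close>

lemma eigenfunction_const_one: "eigenfunction M T (\<lambda>x. 1)"
  unfolding eigenfunction_def L2fun_def
  by (auto intro!: exI[of _ 1] simp: AE_iff_null emeasure_space_1 null_sets_def)

text \<open>If \<open>f\<close> is orthogonal to the eigenfunctions, then along some powers of the inverse of \<open>T\<close>
  the coupling with density \<open>1 + f(x) f(y)\<close> approaches the product measure, which is fixed.\<close>

lemma distal_orthogonal_eq_zero: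
  fixes f :: "'a \<Rightarrow> real"
  assumes dist: "distal (C2_topology M) (lift_map M T)"
    and f[measurable]: "f \<in> borel_measurable M" and b: "\<And>x. \<bar>f x\<bar> \<le> 1"
    and orth: "\<And>g. eigenfunction M T g \<Longrightarrow> L2ip M (\<lambda>x. complex_of_real (f x)) g = 0"
  shows "AE x in M. f x = 0"
proof -
  let ?f = "\<lambda>x. complex_of_real (f x)"
  have fL: "L2fun M ?f" by (rule L2fun_bounded[OF finite_measure_axioms _ ]) (use b in auto)
  have "L2ip M ?f (\<lambda>x. 1) = 0" by (rule orth[OF eigenfunction_const_one])
  then have z: "(\<integral>x. f x \<partial>M) = 0" by (simp add: L2ip_def)
  have intf: "integrable M f" by (rule integrable_const_bound[of _ 1]) (use b in auto)
  let ?\<pi> = "rank_one_coupling M (\<lambda>_. 0)" and ?\<rho> = "rank_one_coupling M f"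
  note rho = rank_one_coupling[OF f b z]
  note pi = rank_one_coupling_zero
  let ?Z = "C2_topology M" and ?R = "lift_map M T"
  have inv: "measure M (Tpow n -` A) = measure M A" "Tpow n -` A \<in> sets M" if "A \<in> sets M" for n A
    using mp_Tpow[of n] measure_distr[of "Tpow n" M M A] measurable_sets[of "Tpow n" M M A] that by (auto simp: mp_map_def)
  have pi_fixed: "zpow ?Z ?R n ?\<pi> = ?\<pi>" for n
  proof (rule C2_eqI)
    show "zpow ?Z ?R n ?\<pi> \<in> C2 M" unfolding zpow_lift_map[OF pi(1)] by (rule lift_map_in_C2[OF pi(1) mp_Tpow])
  qed (use pi inv in \<open>auto simp: measure_zpow_lift_map\<close>)
  have "(?\<pi>, ?\<pi>) \<in> (prod_topology ?Z ?Z) closure_of {(zpow ?Z ?R n ?\<pi>, zpow ?Z ?R n ?\<rho>) | n. True}"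
    unfolding in_closure_of
  proof (intro conjI allI impI)
    show "(?\<pi>, ?\<pi>) \<in> topspace (prod_topology ?Z ?Z)" using pi(1) by simp
    fix W assume W: "(?\<pi>, ?\<pi>) \<in> W \<and> openin (prod_topology ?Z ?Z) W"
    then obtain U V where UV: "openin ?Z U" "openin ?Z V" "?\<pi> \<in> U" "?\<pi> \<in> V" "U \<times> V \<subseteq> W"
      unfolding openin_prod_topology_alt by meson
    obtain P e where P: "finite P" "P \<subseteq> sets M \<times> sets M" "e > 0"
      "\<And>\<rho>. \<rho> \<in> C2 M \<Longrightarrow> (\<And>A B. (A, B) \<in> P \<Longrightarrow> \<bar>measure \<rho> (A \<times> B) - measure ?\<pi> (A \<times> B)\<bar> < e) \<Longrightarrow> \<rho> \<in> V"
      using C2_topology_neighbourhood[OF UV(2,4)] by blast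
    \<comment> \<open>The change on \<open>A \<times> B\<close> is an integral for \<open>A\<close>
      times one for \<open>B\<close>. The latter is at most 1 in absolute value, so only the first
      sides need small correlations.\<close>
    define I where "I = fst ` P"
    have I: "finite I" "I \<subseteq> sets M" using P by (auto simp: I_def)
    have hL: "L2fun M (\<lambda>x. indicator A x)" if "A \<in> I" for A
      by (rule L2fun_bounded[OF finite_measure_axioms, of _ 1]) (use I that in \<open>auto simp: indicator_def\<close>)
    obtain n where n: "\<And>A. A \<in> I \<Longrightarrow> cmod (L2ip M (\<lambda>x. ?f ((T ^^ n) x)) (\<lambda>x. indicator A x)) < e"
      by (rule exists_small_correlations[where h = "\<lambda>A x. indicator A x", OF mp_T fL orth P(3) I(1) hL], assumption, assumption, rule that)
    define k where "k = - int n"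
    have k: "Tpow k = S ^^ n" by (auto simp: k_def Tpow_def)
    \<comment> \<open>Substituting \<open>(T ^^ n) x\<close> for \<open>x\<close> moves the inverse
      power from the set to \<open>f\<close>, which is why \<open>k\<close> is the negative of
      \<open>n\<close>.\<close>
    have corr: "(\<integral>x. f x * indicator (Tpow k -` A) x \<partial>M) = Re (L2ip M (\<lambda>x. ?f ((T ^^ n) x)) (\<lambda>x. indicator A x))"
      if [measurable]: "A \<in> sets M" for A
    proof -
      have [measurable]: "Tpow k -` A \<in> sets M" by (rule inv(2)) fact
      have "(\<integral>x. f x * indicator (Tpow k -` A) x \<partial>M) = (\<integral>x. f ((T ^^ n) x) * indicator (Tpow k -` A) ((T ^^ n) x) \<partial>M)"
        by (rule integral_mp_map[OF mp_map_funpow[OF mp_T], symmetric]) measurable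
      also have "\<dots> = (\<integral>x. f ((T ^^ n) x) * indicator A x \<partial>M)"
        by (simp add: k indicator_def)
      finally have eq: "(\<integral>x. f x * indicator (Tpow k -` A) x \<partial>M) = (\<integral>x. f ((T ^^ n) x) * indicator A x \<partial>M)" .
      have "L2ip M (\<lambda>x. ?f ((T ^^ n) x)) (\<lambda>x. indicator A x) = (\<integral>x. complex_of_real (f ((T ^^ n) x) * indicator A x) \<partial>M)"
        unfolding L2ip_def by (intro Bochner_Integration.integral_cong refl) (auto simp: indicator_def)
      also have "\<dots> = of_real (\<integral>x. f ((T ^^ n) x) * indicator A x \<partial>M)" by (rule integral_complex_of_real)
      finally show ?thesis by (simp add: eq)
    qed
    have bd1: "\<bar>\<integral>x. f x * indicator A x \<partial>M\<bar> \<le> 1" if [measurable]: "A \<in> sets M" for A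
    proof -
      have "\<bar>\<integral>x. f x * indicator A x \<partial>M\<bar> \<le> (\<integral>x. \<bar>f x * indicator A x\<bar> \<partial>M)" by (rule integral_abs_bound)
      also have "\<dots> \<le> (\<integral>x. 1 \<partial>M)"
        using b by (intro integral_mono integrable_const_bound[of _ 1]) (auto simp: indicator_def)
      finally show ?thesis using prob_space by simp
    qed
    have "zpow ?Z ?R k ?\<rho> \<in> V"
    proof (rule P(4))
      show "zpow ?Z ?R k ?\<rho> \<in> C2 M" unfolding zpow_lift_map[OF rho(2)] by (rule lift_map_in_C2[OF rho(2) mp_Tpow])
      fix A B assume AB: "(A, B) \<in> P"
      then have s: "A \<in> sets M" "B \<in> sets M" "A \<in> I" using P(2) by (auto simp: I_def image_iff intro: bexI[of _ "(A, B)"])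
      have "measure (zpow ?Z ?R k ?\<rho>) (A \<times> B) - measure ?\<pi> (A \<times> B)
        = (\<integral>x. f x * indicator (Tpow k -` A) x \<partial>M) * (\<integral>x. f x * indicator (Tpow k -` B) x \<partial>M)"
        using s inv by (simp add: measure_zpow_lift_map[OF rho(2)] rho(1) pi(2))
      also have "\<bar>\<dots>\<bar> \<le> \<bar>\<integral>x. f x * indicator (Tpow k -` A) x \<partial>M\<bar> * 1"
        unfolding abs_mult by (intro mult_left_mono bd1 inv s) auto
      also have "\<dots> < e" unfolding corr[OF s(1)] using n[OF s(3)] abs_Re_le_cmod le_less_trans by fastforce
      finally show "\<bar>measure (zpow ?Z ?R k ?\<rho>) (A \<times> B) - measure ?\<pi> (A \<times> B)\<bar> < e" .
    qed
    then have "(zpow ?Z ?R k ?\<pi>, zpow ?Z ?R k ?\<rho>) \<in> W" using UV pi_fixed by auto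
    then show "\<exists>y. y \<in> {(zpow ?Z ?R n ?\<pi>, zpow ?Z ?R n ?\<rho>) | n. True} \<and> y \<in> W" by blast
  qed
  then have "?\<pi> = ?\<rho>" using dist pi(1) rho(2) unfolding distal_def by (auto 4 4)
  \<comment> \<open>For equal sides the correction is a square, so equality of the couplings makes
    each integral vanish.\<close>
  then have sq: "(\<integral>x. f x * indicator A x \<partial>M) * (\<integral>x. f x * indicator A x \<partial>M) = 0" if "A \<in> sets M" for A
    using rho(1)[OF that that] pi(2)[OF that that] by simp
  show ?thesis by (rule AE_zero_if_integrals_zero[OF intf]) (use sq in simp)
qed

end

section \<open>Almost periodic functions\<close>

lemma L2norm_mono:
  assumes "f \<in> borel_measurable M" "L2fun M g" "\<And>x. cmod (f x) \<le> cmod (g x)"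
  shows "L2fun M f" "L2norm M f \<le> L2norm M g"
proof -
  have le: "(cmod (f x))\<^sup>2 \<le> (cmod (g x))\<^sup>2" for x using assms(3)[of x] by (intro power_mono) auto
  have g: "integrable M (\<lambda>x. (cmod (g x))\<^sup>2)" using assms(2) by (simp add: L2fun_def)
  have f: "integrable M (\<lambda>x. (cmod (f x))\<^sup>2)"
    by (rule Bochner_Integration.integrable_bound[OF g]) (use assms(1) le in auto)
  then show "L2fun M f" using assms(1) by (simp add: L2fun_def)
  show "L2norm M f \<le> L2norm M g" unfolding L2norm_def
    by (intro real_sqrt_le_mono integral_mono f g le)
qed

text \<open>Continuity of the inner product: the tolerance is the putative nonzero value divided by
  \<open>L2norm M r + 1\<close>, which contradicts Cauchy-Schwarz.\<close>

lemma L2ip_orthogonal_closure: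
  assumes r: "L2fun M r" and p: "L2fun M p" and S: "\<And>s. s \<in> S \<Longrightarrow> L2fun M s"
    and cl: "\<And>e. e > 0 \<Longrightarrow> \<exists>s\<in>S. L2norm M (\<lambda>x. p x - s x) < e"
    and o: "\<And>s. s \<in> S \<Longrightarrow> Re (L2ip M r s) = 0"
  shows "Re (L2ip M r p) = 0"
proof (rule ccontr)
  assume n0: "Re (L2ip M r p) \<noteq> 0"
  define e where "e = \<bar>Re (L2ip M r p)\<bar> / (L2norm M r + 1)"
  have pos: "L2norm M r + 1 > 0" by (simp add: add_nonneg_pos)
  have "e > 0" unfolding e_def using n0 pos by simp
  then obtain s where s: "s \<in> S" "L2norm M (\<lambda>x. p x - s x) < e" using cl by blast
  have "\<bar>Re (L2ip M r p)\<bar> = \<bar>Re (L2ip M r (\<lambda>x. p x - s x))\<bar>"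
    using o[OF s(1)] by (simp add: L2ip_diff_right[OF r p S[OF s(1)]])
  also have "\<dots> \<le> L2norm M r * L2norm M (\<lambda>x. p x - s x)"
    using Cauchy_Schwarz_L2[OF r L2fun_diff[OF p S[OF s(1)]]] abs_Re_le_cmod order_trans by blast
  also have "\<dots> \<le> L2norm M r * e" using s(2) by (intro mult_left_mono) auto
  also have "\<dots> < (L2norm M r + 1) * e" using \<open>e > 0\<close> by (simp add: algebra_simps)
  also have "\<dots> = \<bar>Re (L2ip M r p)\<bar>" unfolding e_def using pos by simp
  finally show False by simp
qed

context standard_aut begin

text \<open>Total boundedness of the two-sided orbit, that is, a compact vector of the Koopman
  operator. The centres may lie anywhere in \<open>L^2\<close> rather than on the orbit, so that
  sums and images of nets are nets without further choices.\<close>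

definition almost_periodic :: "('a \<Rightarrow> complex) \<Rightarrow> bool" where
  "almost_periodic f \<longleftrightarrow> L2fun M f \<and> (\<forall>e>0. \<exists>C. finite C \<and> (\<forall>c\<in>C. L2fun M c) \<and>
    (\<forall>n. \<exists>c\<in>C. L2norm M (\<lambda>x. f (Tpow n x) - c x) < e))"

lemma almost_periodic_L2fun: "almost_periodic f \<Longrightarrow> L2fun M f" by (simp add: almost_periodic_def)

lemma almost_periodicD:
  assumes "almost_periodic f" "e > 0"
  obtains C where "finite C" "\<And>c. c \<in> C \<Longrightarrow> L2fun M c" "\<And>n. \<exists>c\<in>C. L2norm M (\<lambda>x. f (Tpow n x) - c x) < e"
  using assms unfolding almost_periodic_def by metis

lemma L2fun_Tpow: "L2fun M f \<Longrightarrow> L2fun M (\<lambda>x. f (Tpow n x))"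
  by (rule L2fun_mp_map[OF mp_Tpow])

text \<open>Combinations of centres form the new net; dividing the tolerance by
  \<open>cmod a + 1\<close> rather than \<open>cmod a\<close> allows \<open>a = 0\<close>.\<close>

lemma almost_periodic_add_scaled:
  assumes f: "almost_periodic f" and g: "almost_periodic g" shows "almost_periodic (\<lambda>x. f x + a * g x)"
proof -
  note fL = almost_periodic_L2fun[OF f] and gL = almost_periodic_L2fun[OF g]
  have "\<exists>E. finite E \<and> (\<forall>c\<in>E. L2fun M c) \<and> (\<forall>n. \<exists>c\<in>E. L2norm M (\<lambda>x. (f (Tpow n x) + a * g (Tpow n x)) - c x) < e)"
    if e: "e > 0" for e
  proof -
    have a: "cmod a + 1 > 0" by (simp add: add_nonneg_pos)
    obtain C where C: "finite C" "\<And>c. c \<in> C \<Longrightarrow> L2fun M c" "\<And>n. \<exists>c\<in>C. L2norm M (\<lambda>x. f (Tpow n x) - c x) < e / 2"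
      using almost_periodicD[OF f, of "e/2"] e by (metis half_gt_zero)
    have "e / (2 * (cmod a + 1)) > 0" using e a by simp
    then obtain D where D: "finite D" "\<And>d. d \<in> D \<Longrightarrow> L2fun M d"
      "\<And>n. \<exists>d\<in>D. L2norm M (\<lambda>x. g (Tpow n x) - d x) < e / (2 * (cmod a + 1))"
      using almost_periodicD[OF g] by metis
    let ?h = "\<lambda>(c, d) x. c x + a * d x"
    have "\<exists>c\<in>?h ` (C \<times> D). L2norm M (\<lambda>x. (f (Tpow n x) + a * g (Tpow n x)) - c x) < e" for n
    proof -
      obtain c where c: "c \<in> C" "L2norm M (\<lambda>x. f (Tpow n x) - c x) < e / 2" using C(3) by blast
      obtain d where d: "d \<in> D" "L2norm M (\<lambda>x. g (Tpow n x) - d x) < e / (2 * (cmod a + 1))" using D(3) by blast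
      have "L2norm M (\<lambda>x. (f (Tpow n x) - c x) + a * (g (Tpow n x) - d x))
        \<le> L2norm M (\<lambda>x. f (Tpow n x) - c x) + L2norm M (\<lambda>x. a * (g (Tpow n x) - d x))"
        by (intro L2norm_triangle L2fun_diff L2fun_cmult L2fun_Tpow fL gL C(2) D(2) c d)
      also have "L2norm M (\<lambda>x. a * (g (Tpow n x) - d x)) = cmod a * L2norm M (\<lambda>x. g (Tpow n x) - d x)"
        by (rule L2norm_cmult)
      also have "\<dots> \<le> (cmod a + 1) * (e / (2 * (cmod a + 1)))" using d(2) by (intro mult_mono) auto
      also have "\<dots> = e / 2" using a by (simp add: field_simps)
      finally have "L2norm M (\<lambda>x. (f (Tpow n x) - c x) + a * (g (Tpow n x) - d x)) < e" using c(2) by simp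
      also have "(\<lambda>x. (f (Tpow n x) - c x) + a * (g (Tpow n x) - d x)) = (\<lambda>x. (f (Tpow n x) + a * g (Tpow n x)) - ?h (c, d) x)"
        by (auto simp: algebra_simps)
      finally show ?thesis using c(1) d(1) by blast
    qed
    moreover have "\<forall>c\<in>?h ` (C \<times> D). L2fun M c" using C(2) D(2) by (auto intro!: L2fun_add L2fun_cmult)
    ultimately show ?thesis using C(1) D(1) by (intro exI[of _ "?h ` (C \<times> D)"]) auto
  qed
  then show ?thesis unfolding almost_periodic_def using fL gL by (auto intro!: L2fun_add L2fun_cmult)
qed

lemma almost_periodic_closed:
  assumes p: "L2fun M p" and cl: "\<And>e. e > 0 \<Longrightarrow> \<exists>s. almost_periodic s \<and> L2norm M (\<lambda>x. p x - s x) < e"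
  shows "almost_periodic p"
proof -
  have "\<exists>C. finite C \<and> (\<forall>c\<in>C. L2fun M c) \<and> (\<forall>n. \<exists>c\<in>C. L2norm M (\<lambda>x. p (Tpow n x) - c x) < e)"
    if e: "e > 0" for e
  proof -
    obtain s where s: "almost_periodic s" "L2norm M (\<lambda>x. p x - s x) < e / 2" using cl[of "e/2"] e by auto
    note sL = almost_periodic_L2fun[OF s(1)]
    obtain C where C: "finite C" "\<And>c. c \<in> C \<Longrightarrow> L2fun M c" "\<And>n. \<exists>c\<in>C. L2norm M (\<lambda>x. s (Tpow n x) - c x) < e / 2"
      using almost_periodicD[OF s(1), of "e/2"] e by (metis half_gt_zero)
    have "\<exists>c\<in>C. L2norm M (\<lambda>x. p (Tpow n x) - c x) < e" for n
    proof -
      obtain c where c: "c \<in> C" "L2norm M (\<lambda>x. s (Tpow n x) - c x) < e / 2" using C(3) by blast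
      have "L2norm M (\<lambda>x. p (Tpow n x) - s (Tpow n x)) < e / 2"
        using L2norm_mp_map[OF mp_Tpow L2fun_diff[OF p sL], of n] s(2) by simp
      then show ?thesis
        using L2norm_triangle_diff[OF L2fun_Tpow[OF p] L2fun_Tpow[OF sL] C(2)[OF c(1)], of n n] c
        by (intro bexI[of _ c]) auto
    qed
    then show ?thesis using C by blast
  qed
  then show ?thesis unfolding almost_periodic_def using p by blast
qed

text \<open>A 1-Lipschitz \<open>\<phi>\<close> carries nets to nets. One statement thus covers
  truncation to the unit interval and the passage to real and imaginary parts;
  \<open>\<phi> 0 = 0\<close> gives \<open>cmod (\<phi> a) \<le> cmod a\<close>, hence square
  integrability.\<close>

lemma almost_periodic_contraction:
  assumes f: "almost_periodic f" and lip: "\<And>a b. cmod (\<phi> a - \<phi> b) \<le> cmod (a - b)" and z: "\<phi> 0 = 0"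
  shows "almost_periodic (\<lambda>x. \<phi> (f x))"
proof -
  have "continuous_on UNIV \<phi>"
    by (rule lipschitz_on_continuous_on[of 1]) (auto intro!: lipschitz_onI simp: dist_norm lip)
  then have \<phi>[measurable]: "\<phi> \<in> borel_measurable borel" by (rule borel_measurable_continuous_onI)
  have \<phi>L: "L2fun M (\<lambda>x. \<phi> (g x))" if g: "L2fun M g" for g
    by (rule L2norm_mono[OF _ g]) (use g lip[of _ 0] z in \<open>auto simp: L2fun_def\<close>)
  have "\<exists>C. finite C \<and> (\<forall>c\<in>C. L2fun M c) \<and> (\<forall>n. \<exists>c\<in>C. L2norm M (\<lambda>x. \<phi> (f (Tpow n x)) - c x) < e)"
    if e: "e > 0" for e
  proof -
    obtain C where C: "finite C" "\<And>c. c \<in> C \<Longrightarrow> L2fun M c" "\<And>n. \<exists>c\<in>C. L2norm M (\<lambda>x. f (Tpow n x) - c x) < e"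
      using almost_periodicD[OF f e] by metis
    have "\<exists>c\<in>(\<lambda>c x. \<phi> (c x)) ` C. L2norm M (\<lambda>x. \<phi> (f (Tpow n x)) - c x) < e" for n
    proof -
      obtain c where c: "c \<in> C" "L2norm M (\<lambda>x. f (Tpow n x) - c x) < e" using C(3) by blast
      note fn = L2fun_Tpow[OF almost_periodic_L2fun[OF f], of n] and cL = C(2)[OF c(1)]
      have "L2norm M (\<lambda>x. \<phi> (f (Tpow n x)) - \<phi> (c x)) \<le> L2norm M (\<lambda>x. f (Tpow n x) - c x)"
      proof (rule L2norm_mono)
        show "(\<lambda>x. \<phi> (f (Tpow n x)) - \<phi> (c x)) \<in> borel_measurable M"
          using L2fun_diff[OF \<phi>L[OF fn] \<phi>L[OF cL]] by (simp add: L2fun_def)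
      qed (auto intro: L2fun_diff fn cL lip)
      then show ?thesis using c by (intro bexI[of _ "\<lambda>x. \<phi> (c x)"]) auto
    qed
    moreover have "\<forall>c\<in>(\<lambda>c x. \<phi> (c x)) ` C. L2fun M c" using C(2) by (auto intro: \<phi>L)
    ultimately show ?thesis using C(1) by (intro exI[of _ "(\<lambda>c x. \<phi> (c x)) ` C"]) auto
  qed
  then show ?thesis unfolding almost_periodic_def using \<phi>L[OF almost_periodic_L2fun[OF f]] by auto
qed

lemma eigenfunction_funpow:
  fixes g :: "'a \<Rightarrow> complex"
  assumes R: "mp_map M R" and ev: "AE x in M. g (R x) = d * g x"
  shows "AE x in M. g ((R ^^ n) x) = d ^ n * g x"
proof (induction n)
  case (Suc n)
  show ?case using AE_mp_map[OF mp_map_funpow[OF R, of n] ev] Suc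
    by eventually_elim (simp add: mult.assoc)
qed simp

text \<open>Composition with \<open>T\<close> preserves the norm and \<open>g\<close> is not null,
  so the eigenvalue has modulus one; it can then be inverted for negative \<open>n\<close>.\<close>

lemma eigenfunction_Tpow:
  assumes g: "eigenfunction M T g"
  shows "\<exists>d. cmod d = 1 \<and> (AE x in M. g (Tpow n x) = d * g x)"
proof -
  obtain c where c: "AE x in M. g (T x) = c * g x" and gL: "L2fun M g" and n0: "\<not> (AE x in M. g x = 0)"
    using g by (auto simp: eigenfunction_def)
  have "L2norm M g = L2norm M (\<lambda>x. g (T x))" by (rule L2norm_mp_map[OF mp_T gL, symmetric])
  also have "\<dots> = L2norm M (\<lambda>x. c * g x)"
    by (rule L2norm_cong_AE) (use L2fun_mp_map[OF mp_T gL] L2fun_cmult[OF gL] c in \<open>auto simp: L2fun_def\<close>)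
  finally have c1: "cmod c = 1" using n0 L2norm_eq_0_iff[OF gL] by (simp add: L2norm_cmult)
  show ?thesis
  proof (cases "0 \<le> n")
    case True
    then show ?thesis using eigenfunction_funpow[OF mp_T c] c1 by (auto simp: Tpow_def norm_power intro!: exI[of _ "c ^ nat n"])
  next
    case False
    have "AE x in M. g (T (S x)) = c * g (S x)" by (rule AE_mp_map[OF mp_S c])
    then have "AE x in M. g (S x) = inverse c * g x"
      by eventually_elim (use c1 in \<open>auto simp: field_simps\<close>)
    from eigenfunction_funpow[OF mp_S this, of "nat (- n)"] show ?thesis
      using False c1 by (intro exI[of _ "inverse c ^ nat (- n)"]) (auto simp: Tpow_def norm_power norm_inverse)
  qed
qed

text \<open>Up to null sets the orbit lies in the multiples of \<open>g\<close> by the unit circle,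
  which is compact.\<close>

lemma almost_periodic_eigenfunction:
  assumes g: "eigenfunction M T g" shows "almost_periodic g"
proof -
  have gL: "L2fun M g" using g by (simp add: eigenfunction_def)
  have "\<exists>C. finite C \<and> (\<forall>c\<in>C. L2fun M c) \<and> (\<forall>n. \<exists>c\<in>C. L2norm M (\<lambda>x. g (Tpow n x) - c x) < e)"
    if e: "e > 0" for e
  proof -
    have pos: "L2norm M g + 1 > 0" by (simp add: add_nonneg_pos)
    define \<delta> where "\<delta> = e / (L2norm M g + 1)"
    have d0: "\<delta> > 0" using e pos by (simp add: \<delta>_def)
    have cov: "sphere (0::complex) 1 \<subseteq> (\<Union>x\<in>sphere 0 1. ball x \<delta>)" using d0 by auto
    obtain D where D: "finite D" "sphere (0::complex) 1 \<subseteq> (\<Union>x\<in>D. ball x \<delta>)"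
      by (rule compactE_image[OF compact_sphere open_ball cov]) (rule that)
    have "\<exists>c\<in>(\<lambda>d x. d * g x) ` D. L2norm M (\<lambda>x. g (Tpow n x) - c x) < e" for n
    proof -
      obtain c where c: "cmod c = 1" "AE x in M. g (Tpow n x) = c * g x" using eigenfunction_Tpow[OF g] by blast
      then have "c \<in> sphere 0 1" by simp
      then obtain d where d: "d \<in> D" "dist d c < \<delta>" using D(2) by auto
      have "L2norm M (\<lambda>x. g (Tpow n x) - d * g x) = L2norm M (\<lambda>x. (c - d) * g x)"
      proof (rule L2norm_cong_AE)
        show "AE x in M. g (Tpow n x) - d * g x = (c - d) * g x" using c(2) by eventually_elim (simp add: algebra_simps)
      qed (use L2fun_diff[OF L2fun_Tpow[OF gL] L2fun_cmult[OF gL]] L2fun_cmult[OF gL] in \<open>auto simp: L2fun_def\<close>)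
      also have "\<dots> = cmod (c - d) * L2norm M g" by (rule L2norm_cmult)
      also have "\<dots> \<le> \<delta> * L2norm M g" using d(2) by (intro mult_right_mono) (auto simp: dist_norm norm_minus_commute)
      also have "\<dots> < \<delta> * (L2norm M g + 1)" using d0 by simp
      also have "\<dots> = e" using pos by (simp add: \<delta>_def)
      finally show ?thesis using d(1) by (intro bexI[of _ "\<lambda>x. d * g x"]) auto
    qed
    then show ?thesis using D(1) gL by (intro exI[of _ "(\<lambda>d x. d * g x) ` D"]) (auto intro: L2fun_cmult)
  qed
  then show ?thesis unfolding almost_periodic_def using gL by blast
qed

lemma L2fun_indicator: "A \<in> sets M \<Longrightarrow> L2fun M (\<lambda>x. indicator A x)"
  by (rule L2fun_bounded[OF finite_measure_axioms, of _ 1]) (auto simp: indicator_def)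

text \<open>The almost periodic functions form a lattice, so the best approximation of an indicator function
  by real almost periodic functions may be truncated to the unit interval. Hence the remainder is bounded
  and \<open>distal_orthogonal_eq_zero\<close> applies to it.\<close>

lemma distal_almost_periodic_indicator:
  assumes dist: "distal (C2_topology M) (lift_map M T)" and A[measurable]: "A \<in> sets M"
  shows "almost_periodic (\<lambda>x. indicator A x)"
proof -
  \<comment> \<open>Real valued, because the remainder must be a real function to define a density;
    the projection is accordingly over real scalars.\<close>
  define RA where "RA = {s. almost_periodic s \<and> (\<forall>x. Im (s x) = 0)}"
  let ?f = "\<lambda>x. indicator A x :: complex"
  note fL = L2fun_indicator[OF A]
  have RAL: "L2fun M s" if "s \<in> RA" for s using that almost_periodic_L2fun by (auto simp: RA_def)
  have "almost_periodic (\<lambda>x. 0)" unfolding almost_periodic_def using L2fun_zero[of M]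
    by (auto intro!: exI[of _ "{\<lambda>x. 0}"] simp: L2norm_def)
  then have RA0: "(\<lambda>x. 0) \<in> RA" by (simp add: RA_def)
  have RAlin: "(\<lambda>x. s x + of_real a * t x) \<in> RA" if "s \<in> RA" "t \<in> RA" for s t and a :: real
    using that almost_periodic_add_scaled by (auto simp: RA_def)
  obtain p where p: "L2fun M p" and cl: "\<And>e. e > 0 \<Longrightarrow> \<exists>s\<in>RA. L2norm M (\<lambda>x. p x - s x) < e"
    and o: "\<And>s. s \<in> RA \<Longrightarrow> Re (L2ip M (\<lambda>x. ?f x - p x) s) = 0"
    using L2_projection[of ?f RA, OF fL RAL RA0 RAlin] by blast
  have almost_periodic_p: "almost_periodic p" by (rule almost_periodic_closed[OF p]) (use cl in \<open>auto simp: RA_def\<close>)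
  \<comment> \<open>This map fixes \<open>0\<close> and \<open>1\<close>, so truncation leaves the
    indicator in place and can only bring \<open>p\<close> closer to it.\<close>
  define \<phi> where "\<phi> z = complex_of_real (max 0 (min 1 (Re z)))" for z
  have lip: "cmod (\<phi> a - \<phi> b) \<le> cmod (a - b)" for a b
  proof -
    have "cmod (\<phi> a - \<phi> b) = \<bar>max 0 (min 1 (Re a)) - max 0 (min 1 (Re b))\<bar>"
      unfolding \<phi>_def of_real_diff[symmetric] by (rule norm_of_real)
    also have "\<dots> \<le> \<bar>Re (a - b)\<bar>" by (auto simp: max_def min_def)
    also have "\<dots> \<le> cmod (a - b)" by (rule abs_Re_le_cmod)
    finally show ?thesis .
  qed
  define q where "q = (\<lambda>x. \<phi> (p x))"
  have almost_periodic_q: "almost_periodic q" unfolding q_def by (rule almost_periodic_contraction[OF almost_periodic_p lip]) (simp add: \<phi>_def)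
  then have qR: "q \<in> RA" by (simp add: RA_def q_def \<phi>_def)
  note q = almost_periodic_L2fun[OF almost_periodic_q]
  have fp: "L2fun M (\<lambda>x. ?f x - p x)" and fq: "L2fun M (\<lambda>x. ?f x - q x)" and pq: "L2fun M (\<lambda>x. p x - q x)"
    by (intro L2fun_diff fL p q)+
  have "cmod (?f x - q x) \<le> cmod (?f x - p x)" for x
    using lip[of "?f x" "p x"] by (simp add: q_def \<phi>_def indicator_def split: if_splits)
  then have le: "L2norm M (\<lambda>x. ?f x - q x) \<le> L2norm M (\<lambda>x. ?f x - p x)"
    using fq by (intro L2norm_mono(2) fp) (auto simp: L2fun_def)
  have "Re (L2ip M (\<lambda>x. ?f x - p x) p) = 0"
    by (rule L2ip_orthogonal_closure[OF fp p RAL cl o])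
  then have "Re (L2ip M (\<lambda>x. ?f x - p x) (\<lambda>x. p x - q x)) = 0"
    using o[OF qR] by (simp add: L2ip_diff_right[OF fp p q])
  \<comment> \<open>Pythagoras: \<open>p - q\<close> is orthogonal to \<open>?f - p\<close> in real
    part, so \<open>q\<close> can be as close to \<open>?f\<close> as \<open>p\<close> is only if
    \<open>p = q\<close> almost everywhere.\<close>
  then have "(L2norm M (\<lambda>x. (?f x - p x) + (p x - q x)))\<^sup>2 = (L2norm M (\<lambda>x. ?f x - p x))\<^sup>2 + (L2norm M (\<lambda>x. p x - q x))\<^sup>2"
    by (simp only: L2norm_square_add[OF fp pq])
  moreover have "(L2norm M (\<lambda>x. (?f x - p x) + (p x - q x)))\<^sup>2 \<le> (L2norm M (\<lambda>x. ?f x - p x))\<^sup>2"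
    using le by (intro power_mono) auto
  ultimately have pq0: "L2norm M (\<lambda>x. p x - q x) = 0" by simp
  have oq: "Re (L2ip M (\<lambda>x. ?f x - q x) s) = 0" if s: "s \<in> RA" for s
  proof -
    have "L2ip M (\<lambda>x. (?f x - p x) + (p x - q x)) s = L2ip M (\<lambda>x. ?f x - p x) s + L2ip M (\<lambda>x. p x - q x) s"
      by (rule L2ip_add_left[OF fp pq RAL[OF s]])
    moreover have "L2ip M (\<lambda>x. p x - q x) s = 0" using Cauchy_Schwarz_L2[OF pq RAL[OF s]] pq0 by simp
    ultimately show ?thesis using o[OF s] by simp
  qed
  define r where "r x = indicator A x - max 0 (min 1 (Re (p x)))" for x
  have r_eq: "(\<lambda>x. complex_of_real (r x)) = (\<lambda>x. ?f x - q x)"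
    by (auto simp: r_def q_def \<phi>_def indicator_def)
  have [measurable]: "p \<in> borel_measurable M" using p by (simp add: L2fun_def)
  have rm[measurable]: "r \<in> borel_measurable M" unfolding r_def by measurable
  have rb: "\<bar>r x\<bar> \<le> 1" for x by (auto simp: r_def indicator_def)
  have "AE x in M. r x = 0"
  proof (rule distal_orthogonal_eq_zero[OF dist rm rb])
    fix g assume g: "eigenfunction M T g"
    have gL: "L2fun M g" using g by (simp add: eigenfunction_def)
    let ?r = "\<lambda>x. complex_of_real (r x)"
    have rL: "L2fun M ?r" unfolding r_eq by (rule fq)
    \<comment> \<open>Eigenfunctions are complex, but their real and imaginary parts lie in
      \<open>RA\<close>. An inner product of real functions is real, so vanishing of its real part
      is enough.\<close>
    have part: "L2ip M ?r (\<lambda>x. complex_of_real (\<psi> (g x))) = 0 \<and> L2fun M (\<lambda>x. complex_of_real (\<psi> (g x)))"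
      if \<psi>: "\<psi> = Re \<or> \<psi> = Im" for \<psi>
    proof -
      have l: "cmod (complex_of_real (\<psi> a) - complex_of_real (\<psi> b)) \<le> cmod (a - b)" for a b
      proof -
        have "cmod (complex_of_real (\<psi> a) - complex_of_real (\<psi> b)) = \<bar>\<psi> (a - b)\<bar>"
          using \<psi> by (auto simp flip: of_real_diff)
        then show ?thesis using \<psi> abs_Re_le_cmod abs_Im_le_cmod by metis
      qed
      have "almost_periodic (\<lambda>x. complex_of_real (\<psi> (g x)))"
        by (rule almost_periodic_contraction[OF almost_periodic_eigenfunction[OF g] l]) (use \<psi> in auto)
      then have R: "(\<lambda>x. complex_of_real (\<psi> (g x))) \<in> RA" by (simp add: RA_def)
      have "L2ip M ?r (\<lambda>x. complex_of_real (\<psi> (g x))) = (\<integral>x. complex_of_real (r x * \<psi> (g x)) \<partial>M)"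
        by (simp add: L2ip_def)
      also have "\<dots> = complex_of_real (\<integral>x. r x * \<psi> (g x) \<partial>M)" by (rule integral_complex_of_real)
      finally have "L2ip M ?r (\<lambda>x. complex_of_real (\<psi> (g x))) = complex_of_real (\<integral>x. r x * \<psi> (g x) \<partial>M)" .
      moreover have "Re (L2ip M ?r (\<lambda>x. complex_of_real (\<psi> (g x)))) = 0" unfolding r_eq by (rule oq[OF R])
      ultimately show ?thesis using RAL[OF R] by simp
    qed
    have "g = (\<lambda>x. complex_of_real (Re (g x)) + \<i> * complex_of_real (Im (g x)))"
      by (intro ext complex_eqI) auto
    then have "L2ip M ?r g = L2ip M ?r (\<lambda>x. complex_of_real (Re (g x)) + \<i> * complex_of_real (Im (g x)))" by simp
    also have "\<dots> = L2ip M ?r (\<lambda>x. complex_of_real (Re (g x))) + L2ip M ?r (\<lambda>x. \<i> * complex_of_real (Im (g x)))"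
      by (rule L2ip_add_right[OF rL]) (use part[of Re] part[of Im] L2fun_cmult in auto)
    also have "\<dots> = 0" using part[of Re] part[of Im] by (simp add: L2ip_cmult_right)
    finally show "L2ip M ?r g = 0" .
  qed
  then have "AE x in M. ?f x - q x = 0"
  proof eventually_elim
    case (elim x)
    then show ?case using fun_cong[OF r_eq, of x] by simp
  qed
  then have "L2norm M (\<lambda>x. ?f x - q x) = 0" by (simp only: L2norm_eq_0_iff[OF fq])
  then show ?thesis using almost_periodic_q by (intro almost_periodic_closed[OF fL]) auto
qed

text \<open>Trades arbitrary centres for sets of the orbit itself: for each centre one time near it
  is picked, and the measure of a symmetric difference is the squared \<open>L^2\<close> distance of
  the indicators.\<close>

lemma almost_periodic_indicator_sets:
  assumes ap: "almost_periodic (\<lambda>x. indicator A x)" and A: "A \<in> sets M" and e: "e > 0"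
  obtains F where "finite F" "F \<subseteq> sets M" "\<And>n. \<exists>B\<in>F. measure M (sym_diff (Tpow n -` A) B) < e"
proof -
  \<comment> \<open>Two orbit points within \<open>d\<close> of one centre are within
    \<open>2 * d\<close> of each other, and \<open>(2 * d)\<^sup>2 = e\<close>.\<close>
  define d where "d = sqrt e / 2"
  have d0: "d > 0" using e by (simp add: d_def)
  obtain C where C: "finite C" "\<And>c. c \<in> C \<Longrightarrow> L2fun M c" "\<And>n. \<exists>c\<in>C. L2norm M (\<lambda>x. indicator A (Tpow n x) - c x) < d"
    using almost_periodicD[OF ap d0] by metis
  \<comment> \<open>The choice is arbitrary at centres that no orbit point comes near; those are
    never selected below.\<close>
  define N where "N c = (SOME n. L2norm M (\<lambda>x. indicator A (Tpow n x) - c x) < d)" for c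
  note iL = L2fun_Tpow[OF L2fun_indicator[OF A]]
  have meas: "Tpow n -` A \<in> sets M" for n
    using mp_Tpow[of n] measurable_sets[of "Tpow n" M M A] A by (auto simp: mp_map_def)
  have "\<exists>B\<in>(\<lambda>c. Tpow (N c) -` A) ` C. measure M (sym_diff (Tpow n -` A) B) < e" for n
  proof -
    obtain c where c: "c \<in> C" "L2norm M (\<lambda>x. indicator A (Tpow n x) - c x) < d" using C(3) by blast
    then have Nc: "L2norm M (\<lambda>x. indicator A (Tpow (N c) x) - c x) < d" unfolding N_def by (rule_tac someI)
    let ?D = "sym_diff (Tpow n -` A) (Tpow (N c) -` A)"
    have "measure M ?D = (\<integral>x. indicator ?D x \<partial>M)" using meas by simp
    also have "\<dots> = (L2norm M (\<lambda>x. indicator A (Tpow n x) - indicator A (Tpow (N c) x)))\<^sup>2"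
      unfolding L2norm_square by (intro Bochner_Integration.integral_cong refl) (auto simp: indicator_def)
    also have "\<dots> < (2 * d)\<^sup>2"
    proof (rule power_strict_mono)
      have "L2norm M (\<lambda>x. indicator A (Tpow n x) - indicator A (Tpow (N c) x))
        \<le> L2norm M (\<lambda>x. indicator A (Tpow n x) - c x) + L2norm M (\<lambda>x. c x - indicator A (Tpow (N c) x))"
        by (rule L2norm_triangle_diff[OF iL C(2)[OF c(1)] iL])
      then show "L2norm M (\<lambda>x. indicator A (Tpow n x) - indicator A (Tpow (N c) x)) < 2 * d"
        using c(2) Nc L2norm_minus_commute[of M c] by simp
    qed auto
    also have "\<dots> = e" using e by (simp add: d_def)
    finally show ?thesis using c(1) by blast
  qed
  then show thesis using C(1) meas by (intro that[of "(\<lambda>c. Tpow (N c) -` A) ` C"]) auto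
qed

text \<open>Composing both sides with \<open>T ^^ n\<close> leaves the inner product with an
  indicator unchanged. The moved indicator is close to one of finitely many centres, and
  \<open>n\<close> can be chosen so that the moved \<open>r\<close> is nearly orthogonal to all of
  them. In contrast to the coupling argument, \<open>r\<close> may be unbounded.\<close>

lemma orthogonal_eigenfunctions_almost_periodic_indicators_zero:
  assumes ap: "\<And>A. A \<in> sets M \<Longrightarrow> almost_periodic (\<lambda>x. indicator A x)" and r: "L2fun M r"
    and orth: "\<And>g. eigenfunction M T g \<Longrightarrow> L2ip M r g = 0"
  shows "AE x in M. r x = 0"
proof -
  have ip0: "L2ip M r (\<lambda>x. indicator A x) = 0" if A: "A \<in> sets M" for A
  proof -
    let ?i = "\<lambda>x. indicator A x :: complex"
    note iL = L2fun_indicator[OF A]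
    have "cmod (L2ip M r ?i) \<le> e * (L2norm M r + 1)" if e: "e > 0" for e
    proof -
      obtain C where C: "finite C" "\<And>c. c \<in> C \<Longrightarrow> L2fun M c" "\<And>n. \<exists>c\<in>C. L2norm M (\<lambda>x. indicator A (Tpow n x) - c x) < e"
        using almost_periodicD[OF ap[OF A] e] by metis
      obtain n where n: "\<And>c. c \<in> C \<Longrightarrow> cmod (L2ip M (\<lambda>x. r ((T ^^ n) x)) c) < e"
        by (rule exists_small_correlations[where h = "\<lambda>c. c", OF mp_T r orth e C(1,2)], assumption, assumption, rule that)
      have Tn: "T ^^ n = Tpow (int n)" by (simp add: Tpow_def)
      let ?r = "\<lambda>x. r (Tpow (int n) x)" and ?j = "\<lambda>x. indicator A (Tpow (int n) x) :: complex"
      note rn = L2fun_Tpow[OF r, of "int n"] and jn = L2fun_Tpow[OF iL, of "int n"]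
      obtain c where c: "c \<in> C" "L2norm M (\<lambda>x. ?j x - c x) < e" using C(3) by blast
      note cL = C(2)[OF c(1)]
      have "L2ip M r ?i = L2ip M ?r ?j" by (rule L2ip_mp_map[OF mp_Tpow r iL, symmetric])
      also have "\<dots> = L2ip M ?r (\<lambda>x. ?j x - c x) + L2ip M ?r c" by (simp add: L2ip_diff_right[OF rn jn cL])
      finally have "cmod (L2ip M r ?i) \<le> cmod (L2ip M ?r (\<lambda>x. ?j x - c x)) + cmod (L2ip M ?r c)"
        by (simp add: norm_triangle_ineq)
      also have "cmod (L2ip M ?r (\<lambda>x. ?j x - c x)) \<le> L2norm M ?r * L2norm M (\<lambda>x. ?j x - c x)"
        by (rule Cauchy_Schwarz_L2[OF rn L2fun_diff[OF jn cL]])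
      also have "L2norm M ?r = L2norm M r" by (rule L2norm_mp_map[OF mp_Tpow r])
      also have "L2norm M r * L2norm M (\<lambda>x. ?j x - c x) \<le> L2norm M r * e" using c(2) by (intro mult_left_mono) auto
      also have "cmod (L2ip M ?r c) \<le> e" using n[OF c(1)] unfolding Tn by simp
      finally show ?thesis by (simp add: algebra_simps)
    qed
    note bound = this
    have pos: "L2norm M r + 1 > 0" by (simp add: add_nonneg_pos)
    have "cmod (L2ip M r ?i) \<le> 0 + e" if "e > 0" for e
      using bound[of "e / (L2norm M r + 1)"] that pos by simp
    then have "cmod (L2ip M r ?i) \<le> 0" using field_le_epsilon by blast
    then show ?thesis by simp
  qed
  have rint: "integrable M r" by (rule L1_le_L2norm(1)[OF r])
  have eq: "L2ip M r (\<lambda>x. indicator A x) = (\<integral>x. r x * of_real (indicator A x) \<partial>M)" for A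
    unfolding L2ip_def by (intro Bochner_Integration.integral_cong refl) (auto simp: indicator_def)
  have int2: "integrable M (\<lambda>x. r x * of_real (indicator A x))" if A: "A \<in> sets M" for A
    using integrable_mult_cnj[OF r L2fun_indicator[OF A]]
    by (rule iffD1[OF Bochner_Integration.integrable_cong[OF refl], rotated]) (auto simp: indicator_def)
  have "AE x in M. Re (r x) = 0"
  proof (rule AE_zero_if_integrals_zero)
    show "(\<integral>x. Re (r x) * indicator A x \<partial>M) = 0" if A: "A \<in> sets M" for A
      using integral_Re[OF int2[OF A]] ip0[OF A] by (simp add: eq)
  qed (use rint in auto)
  moreover have "AE x in M. Im (r x) = 0"
  proof (rule AE_zero_if_integrals_zero)
    show "(\<integral>x. Im (r x) * indicator A x \<partial>M) = 0" if A: "A \<in> sets M" for A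
      using integral_Im[OF int2[OF A]] ip0[OF A] by (simp add: eq)
  qed (use rint in auto)
  ultimately show ?thesis by eventually_elim (simp add: complex_eq_iff)
qed

text \<open>The function \<open>g\<close> is projected on the linear span of the eigenfunctions; the
  remainder is orthogonal to every eigenfunction and hence null.\<close>

lemma discrete_spectrum_if_almost_periodic_indicators:
  assumes ap: "\<And>A. A \<in> sets M \<Longrightarrow> almost_periodic (\<lambda>x. indicator A x)"
  shows "discrete_spectrum M T"
  unfolding discrete_spectrum_def
proof (intro allI impI)
  fix g and e :: real assume g: "L2fun M g" and e: "e > 0"
  define V where "V = {s. \<exists>F c. finite F \<and> (\<forall>f\<in>F. eigenfunction M T f) \<and> s = (\<lambda>x. \<Sum>f\<in>F. c f * f x)}"
  have VI: "(\<lambda>x. \<Sum>f\<in>F. c f * f x) \<in> V" if "finite F" "\<forall>f\<in>F. eigenfunction M T f" for F c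
    unfolding V_def mem_Collect_eq by (intro exI[of _ F] exI[of _ c] conjI refl that)
  have eL: "L2fun M f" if "eigenfunction M T f" for f using that by (simp add: eigenfunction_def)
  have VL: "L2fun M s" if s: "s \<in> V" for s
  proof -
    obtain F c where "finite F" and Fc: "\<forall>f\<in>F. eigenfunction M T f" "s = (\<lambda>x. \<Sum>f\<in>F. c f * f x)"
      using s unfolding V_def mem_Collect_eq by blast
    show ?thesis unfolding Fc(2) using Fc(1) eL by (intro L2fun_sum L2fun_cmult) auto
  qed
  have V0: "(\<lambda>x. 0) \<in> V" using VI[of "{}"] by simp
  have Vlin: "(\<lambda>x. s x + of_real a * t x) \<in> V" if st: "s \<in> V" "t \<in> V" for s t and a :: real
  proof -
    obtain F c where F: "finite F" "\<forall>f\<in>F. eigenfunction M T f" and s: "s = (\<lambda>x. \<Sum>f\<in>F. c f * f x)"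
      using st(1) unfolding V_def mem_Collect_eq by blast
    obtain G d where G: "finite G" "\<forall>f\<in>G. eigenfunction M T f" and t: "t = (\<lambda>x. \<Sum>f\<in>G. d f * f x)"
      using st(2) unfolding V_def mem_Collect_eq by blast
    \<comment> \<open>Coefficients are extended by zero to the union, since \<open>F\<close> and
      \<open>G\<close> may overlap.\<close>
    let ?c = "\<lambda>f. (if f \<in> F then c f else 0) + of_real a * (if f \<in> G then d f else 0)"
    have "s x + of_real a * t x = (\<Sum>f\<in>F \<union> G. ?c f * f x)" for x
    proof -
      have "s x = (\<Sum>f\<in>F \<union> G. (if f \<in> F then c f else 0) * f x)"
        unfolding s by (rule sum.mono_neutral_cong_left) (use F G in auto)
      moreover have "t x = (\<Sum>f\<in>F \<union> G. (if f \<in> G then d f else 0) * f x)"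
        unfolding t by (rule sum.mono_neutral_cong_left) (use F G in auto)
      ultimately show ?thesis by (simp only: distrib_right sum.distrib sum_distrib_left mult.assoc)
    qed
    then have "(\<lambda>x. s x + of_real a * t x) = (\<lambda>x. \<Sum>f\<in>F \<union> G. ?c f * f x)" by (rule ext)
    then show ?thesis using VI[of "F \<union> G" ?c] F G by (simp only:) blast
  qed
  obtain p where p: "L2fun M p" and cl: "\<And>e. e > 0 \<Longrightarrow> \<exists>s\<in>V. L2norm M (\<lambda>x. p x - s x) < e"
    and o: "\<And>s. s \<in> V \<Longrightarrow> Re (L2ip M (\<lambda>x. g x - p x) s) = 0"
    using L2_projection[of g V, OF g VL V0 Vlin] by blast
  have r: "L2fun M (\<lambda>x. g x - p x)" by (rule L2fun_diff[OF g p])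
  have "AE x in M. g x - p x = 0"
  proof (rule orthogonal_eigenfunctions_almost_periodic_indicators_zero[OF ap r])
    fix u assume u: "eigenfunction M T u"
    have "(\<lambda>x. c * u x) \<in> V" for c using VI[of "{u}" "\<lambda>_. c"] u by simp
    note cu = o[OF this]
    \<comment> \<open>The multiples by \<open>1\<close> and \<open>\<i>\<close> turn real
      orthogonality into complex orthogonality.\<close>
    from cu[of 1] cu[of \<i>] show "L2ip M (\<lambda>x. g x - p x) u = 0"
      by (simp add: L2ip_cmult_right complex_eq_iff)
  qed
  then have gp0: "L2norm M (\<lambda>x. g x - p x) = 0" by (simp only: L2norm_eq_0_iff[OF r])
  obtain s where s: "s \<in> V" "L2norm M (\<lambda>x. p x - s x) < sqrt e" using cl[of "sqrt e"] e by auto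
  have "L2norm M (\<lambda>x. g x - s x) < sqrt e"
    using L2norm_triangle_diff[OF g p VL[OF s(1)]] gp0 s(2) by simp
  then have "(\<integral>x. (cmod (g x - s x))\<^sup>2 \<partial>M) < e" by (simp add: L2norm_def)
  moreover obtain F c where "finite F" "\<forall>f\<in>F. eigenfunction M T f" "s = (\<lambda>x. \<Sum>f\<in>F. c f * f x)"
    using s(1) unfolding V_def mem_Collect_eq by blast
  ultimately show "\<exists>F c. finite F \<and> (\<forall>f\<in>F. eigenfunction M T f) \<and> (\<integral>x. (cmod (g x - (\<Sum>f\<in>F. c f * f x)))\<^sup>2 \<partial>M) < e"
    by blast
qed

end

section \<open>Compactness of the space of self-couplings\<close>

lemma semiring_of_rectangles:
  assumes "space M = UNIV"
  shows "semiring_of_sets UNIV {A \<times> B | A B. A \<in> sets M \<and> B \<in> sets M}"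
proof
  let ?R = "{A \<times> B | A B. A \<in> sets M \<and> B \<in> sets M}"
  have RI: "A \<times> B \<in> ?R" if "A \<in> sets M" "B \<in> sets M" for A B using that by blast
  show "?R \<subseteq> Pow UNIV" by simp
  show "{} \<in> ?R" using RI[of "{}" "{}"] by simp
  fix X Y assume "X \<in> ?R" "Y \<in> ?R"
  then obtain A B C D where X: "X = A \<times> B" "A \<in> sets M" "B \<in> sets M" and Y: "Y = C \<times> D" "C \<in> sets M" "D \<in> sets M"
    by blast
  have "X \<inter> Y = (A \<inter> C) \<times> (B \<inter> D)" using X Y by auto
  then show "X \<inter> Y \<in> ?R" using X Y RI[of "A \<inter> C" "B \<inter> D"] by (simp only:) auto
  \<comment> \<open>The difference is cut along the first factor, which makes the two pieces
    disjoint.\<close>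
  let ?C = "{(A - C) \<times> B, (A \<inter> C) \<times> (B - D)}"
  have "?C \<subseteq> ?R" using RI[of "A - C" B] RI[of "A \<inter> C" "B - D"] X Y by auto
  moreover have "disjoint ?C" by (auto simp: disjoint_def)
  moreover have "X - Y = \<Union>?C" unfolding X(1) Y(1) by auto
  ultimately show "\<exists>C\<subseteq>?R. finite C \<and> disjoint C \<and> X - Y = \<Union>C" by (intro exI[of _ ?C]) simp
qed

lemma inner_regular_approx:
  fixes N :: "'b::polish_space measure"
  assumes "prob_space N" "sets N = sets borel" "A \<in> sets N" "e > 0"
  obtains K where "K \<subseteq> A" "compact K" "K \<in> sets N" "measure N (A - K) < e"
proof -
  interpret N: prob_space N by fact
  have A: "A \<in> sets borel" using assms by simp
  have fin: "emeasure N B \<noteq> \<infinity>" for B by simp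
  have "\<exists>K\<in>{K. K \<subseteq> A \<and> compact K}. emeasure N A < emeasure N K + ennreal e"
    by (rule SUP_approx_ennreal[OF assms(4) _ inner_regular[OF assms(2) fin A] fin])
      (auto intro: exI[of _ "{}"])
  then obtain K where K: "K \<subseteq> A" "compact K" "emeasure N A < emeasure N K + ennreal e" by blast
  have Ks: "K \<in> sets N" using K(2) assms(2) by (simp add: borel_compact)
  then have "measure N (A - K) = measure N A - measure N K" using K(1) assms(3) by (simp add: N.finite_measure_Diff)
  moreover have "measure N A < measure N K + e"
    using K(3) assms(4) by (simp add: N.emeasure_eq_measure ennreal_less_iff flip: ennreal_plus)
  ultimately show ?thesis using K Ks that by auto
qed

lemma outer_regular_approx:
  fixes N :: "'b::polish_space measure"
  assumes "prob_space N" "sets N = sets borel" "A \<in> sets N" "e > 0"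
  obtains U where "A \<subseteq> U" "open U" "U \<in> sets N" "measure N (U - A) < e"
proof -
  interpret N: prob_space N by fact
  have A: "A \<in> sets borel" using assms by simp
  have fin: "emeasure N B \<noteq> \<infinity>" for B by simp
  have "\<exists>U\<in>{U. A \<subseteq> U \<and> open U}. emeasure N U < emeasure N A + ennreal e"
    by (rule INF_approx_ennreal[OF assms(4) outer_regular[OF assms(2) fin A] fin])
  then obtain U where U: "A \<subseteq> U" "open U" "emeasure N U < emeasure N A + ennreal e" by blast
  have Us: "U \<in> sets N" using U(2) assms(2) by simp
  then have "measure N (U - A) = measure N U - measure N A" using U(1) assms(3) by (simp add: N.finite_measure_Diff)
  moreover have "measure N U < measure N A + e"
    using U(3) assms(4) by (simp add: N.emeasure_eq_measure ennreal_less_iff flip: ennreal_plus)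
  ultimately show ?thesis using U Us that by auto
qed

text \<open>A finitely additive function on rectangles with marginals \<open>M\<close> is countably additive: by regularity of
  \<open>M\<close> a rectangle is approximated from inside by compact ones and from outside by open ones.\<close>

lemma coupling_of_rectangle_function:
  fixes M :: "'a::polish_space measure" and \<beta> :: "'a set \<Rightarrow> 'a set \<Rightarrow> real"
  assumes prob: "prob_space M" and borel: "sets M = sets borel"
    and nonneg: "\<And>A B. A \<in> sets M \<Longrightarrow> B \<in> sets M \<Longrightarrow> 0 \<le> \<beta> A B"
    and marg: "\<And>A. A \<in> sets M \<Longrightarrow> \<beta> A UNIV = measure M A" "\<And>B. B \<in> sets M \<Longrightarrow> \<beta> UNIV B = measure M B"
    and super: "\<And>(I::nat set) A B J K. finite I \<Longrightarrow> (\<And>i. A i \<in> sets M) \<Longrightarrow> (\<And>i. B i \<in> sets M) \<Longrightarrow> J \<in> sets M \<Longrightarrow>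
      K \<in> sets M \<Longrightarrow> disjoint_family_on (\<lambda>i. A i \<times> B i) I \<Longrightarrow> (\<Union>i\<in>I. A i \<times> B i) \<subseteq> J \<times> K \<Longrightarrow> (\<Sum>i\<in>I. \<beta> (A i) (B i)) \<le> \<beta> J K"
    and sub: "\<And>(I::nat set) A B J K. finite I \<Longrightarrow> (\<And>i. A i \<in> sets M) \<Longrightarrow> (\<And>i. B i \<in> sets M) \<Longrightarrow> J \<in> sets M \<Longrightarrow>
      K \<in> sets M \<Longrightarrow> J \<times> K \<subseteq> (\<Union>i\<in>I. A i \<times> B i) \<Longrightarrow> \<beta> J K \<le> (\<Sum>i\<in>I. \<beta> (A i) (B i))"
  obtains \<rho> where "\<rho> \<in> C2 M" "\<And>A B. A \<in> sets M \<Longrightarrow> B \<in> sets M \<Longrightarrow> measure \<rho> (A \<times> B) = \<beta> A B"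
proof -
  interpret prob_space M by fact
  have sp: "space M = UNIV" using sets_eq_imp_space_eq[OF borel] by simp
  have top: "UNIV \<in> sets M" using sets.top[of M] by (simp add: sp)
  \<comment> \<open>\<open>A \<times> B\<close> is covered by \<open>C \<times> D\<close> and the
    strips \<open>(A - C) \<times> UNIV\<close> and \<open>UNIV \<times> (B - D)\<close>, whose
    values are marginals; the approximation error therefore depends on \<open>M\<close>
    alone.\<close>
  have diff: "\<beta> A B \<le> \<beta> C D + measure M (A - C) + measure M (B - D)"
    if s: "A \<in> sets M" "B \<in> sets M" "C \<in> sets M" "D \<in> sets M" for A B C D
  proof -
    let ?A = "\<lambda>i::nat. if i = 0 then C else if i = 1 then A - C else UNIV"
    let ?B = "\<lambda>i::nat. if i = 0 then D else if i = 1 then UNIV else B - D"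
    have "\<beta> A B \<le> (\<Sum>i\<in>{0,1,2}. \<beta> (?A i) (?B i))"
      by (rule sub) (use s top in \<open>auto simp: sets.Diff\<close>)
    also have "\<dots> = \<beta> C D + measure M (A - C) + measure M (B - D)" using s by (simp add: marg)
    finally show ?thesis .
  qed
  have mono: "\<beta> A B \<le> \<beta> C D" if "A \<times> B \<subseteq> C \<times> D" "A \<in> sets M" "B \<in> sets M" "C \<in> sets M" "D \<in> sets M" for A B C D
    using sub[of "{0}" "\<lambda>_. C" "\<lambda>_. D" A B] that by auto
  have empty: "\<beta> A B = 0" if "A \<times> B = {}" "A \<in> sets M" "B \<in> sets M" for A B
  proof (rule antisym)
    have "\<beta> A B \<le> (\<Sum>i\<in>({}::nat set). \<beta> A B)"
      by (rule sub[of "{}" "\<lambda>_. A" "\<lambda>_. B"]) (use that in simp_all)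
    then show "\<beta> A B \<le> 0" by simp
  qed (rule nonneg[OF that(2,3)])
  define \<rho> where "\<rho> = extend_measure UNIV {(A, B). A \<in> sets M \<and> B \<in> sets M} (\<lambda>(A, B). A \<times> B) (\<lambda>(A, B). ennreal (\<beta> A B))"
  have em: "emeasure \<rho> (A \<times> B) = ennreal (\<beta> A B)" if "A \<in> sets M" "B \<in> sets M" for A B
  proof (rule extend_measure_caratheodory_pair[OF \<rho>_def])
    show "A \<in> sets M \<and> B \<in> sets M" using that by simp
    show "semiring_of_sets UNIV {A \<times> B | A B. A \<in> sets M \<and> B \<in> sets M}" by (rule semiring_of_rectangles[OF sp])
    show "ennreal (\<beta> A B) = 0" if "A \<in> sets M \<and> B \<in> sets M" "A \<times> B = {}" for A B using empty that by simp
    show "ennreal (\<beta> A B) = ennreal (\<beta> C D)" if "A \<in> sets M \<and> B \<in> sets M" "C \<in> sets M \<and> D \<in> sets M" "A \<times> B = C \<times> D" for A B C D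
      using mono[of A B C D] mono[of C D A B] that by (intro arg_cong[where f=ennreal] antisym) auto
    show "0 \<le> ennreal (\<beta> A B)" for A B by simp
    fix A B :: "nat \<Rightarrow> 'a set" and J K
    assume "\<And>n. A n \<in> sets M \<and> B n \<in> sets M" and JK: "J \<in> sets M \<and> K \<in> sets M"
      and disj: "disjoint_family (\<lambda>n. A n \<times> B n)" and un: "(\<Union>i. A i \<times> B i) = J \<times> K"
    then have A: "\<And>n. A n \<in> sets M" and B: "\<And>n. B n \<in> sets M" by auto
    have J: "J \<in> sets M" and K: "K \<in> sets M" using JK by auto
    show "(\<Sum>n. ennreal (\<beta> (A n) (B n))) = ennreal (\<beta> J K)"
    proof (rule antisym)
      show "(\<Sum>n. ennreal (\<beta> (A n) (B n))) \<le> ennreal (\<beta> J K)"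
      proof (rule suminf_le_const[OF summableI])
        fix n
        have "(\<Sum>i<n. \<beta> (A i) (B i)) \<le> \<beta> J K"
        proof (rule super[OF _ A B J K])
          show "(\<Union>i\<in>{..<n}. A i \<times> B i) \<subseteq> J \<times> K" unfolding un[symmetric] by blast
        qed (use disj in \<open>auto simp: disjoint_family_on_def\<close>)
        then show "(\<Sum>i<n. ennreal (\<beta> (A i) (B i))) \<le> ennreal (\<beta> J K)"
          using nonneg A B by (simp add: sum_ennreal ennreal_leI)
      qed
      show "ennreal (\<beta> J K) \<le> (\<Sum>n. ennreal (\<beta> (A n) (B n)))"
      proof (rule ennreal_le_epsilon)
        fix e :: real assume e: "0 < e"
        \<comment> \<open>Shrinking \<open>J\<close> and \<open>K\<close> costs
          \<open>2 * d\<close>; enlarging the rectangle with index \<open>n\<close> costs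
          \<open>2 * d * (1/2)^n\<close>, at most \<open>4 * d\<close> in all.\<close>
        define d where "d = e / 6"
        have d: "d > 0" using e by (simp add: d_def)
        obtain J' where J': "J' \<subseteq> J" "compact J'" "J' \<in> sets M" "measure M (J - J') < d"
          using inner_regular_approx[OF prob borel J d] by blast
        obtain K' where K': "K' \<subseteq> K" "compact K'" "K' \<in> sets M" "measure M (K - K') < d"
          using inner_regular_approx[OF prob borel K d] by blast
        have "\<exists>U. A n \<subseteq> U \<and> open U \<and> U \<in> sets M \<and> measure M (U - A n) < d * (1/2)^n" for n
          using outer_regular_approx[OF prob borel A, of "d * (1/2)^n"] d by (metis mult_pos_pos zero_less_power half_gt_zero zero_less_one)
        then obtain U where U: "\<And>n. A n \<subseteq> U n" "\<And>n. open (U n)" "\<And>n. U n \<in> sets M" "\<And>n. measure M (U n - A n) < d * (1/2)^n"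
          by metis
        have "\<exists>V. B n \<subseteq> V \<and> open V \<and> V \<in> sets M \<and> measure M (V - B n) < d * (1/2)^n" for n
          using outer_regular_approx[OF prob borel B, of "d * (1/2)^n"] d by (metis mult_pos_pos zero_less_power half_gt_zero zero_less_one)
        then obtain V where V: "\<And>n. B n \<subseteq> V n" "\<And>n. open (V n)" "\<And>n. V n \<in> sets M" "\<And>n. measure M (V n - B n) < d * (1/2)^n"
          by metis
        have cov: "J' \<times> K' \<subseteq> (\<Union>n\<in>UNIV. U n \<times> V n)"
        proof
          fix z assume "z \<in> J' \<times> K'"
          then have "z \<in> (\<Union>i. A i \<times> B i)" unfolding un using J'(1) K'(1) by auto
          then show "z \<in> (\<Union>n\<in>UNIV. U n \<times> V n)" using U(1) V(1) by blast
        qed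
        obtain I where I: "finite I" "J' \<times> K' \<subseteq> (\<Union>n\<in>I. U n \<times> V n)"
          by (rule compactE_image[OF compact_Times[OF J'(2) K'(2)] open_Times[OF U(2) V(2)] cov]) (rule that)
        have "\<beta> J K \<le> \<beta> J' K' + 2 * d" using diff[OF J K J'(3) K'(3)] J'(4) K'(4) by linarith
        also have "\<beta> J' K' \<le> (\<Sum>n\<in>I. \<beta> (U n) (V n))" by (rule sub[OF I(1) U(3) V(3) J'(3) K'(3) I(2)])
        also have "\<dots> \<le> (\<Sum>n\<in>I. \<beta> (A n) (B n) + 2 * d * (1/2)^n)"
        proof (rule sum_mono)
          fix n show "\<beta> (U n) (V n) \<le> \<beta> (A n) (B n) + 2 * d * (1/2)^n"
            using diff[OF U(3) V(3) A B, of n n n n] U(4)[of n] V(4)[of n] by linarith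
        qed
        also have "\<dots> = (\<Sum>n\<in>I. \<beta> (A n) (B n)) + 2 * d * (\<Sum>n\<in>I. (1/2)^n)"
          by (simp add: sum.distrib sum_distrib_left)
        also have "(\<Sum>n\<in>I. (1/2::real)^n) \<le> 2"
          using sum_le_suminf[of "\<lambda>n. (1/2::real)^n" I] I(1) by (simp add: suminf_geometric summable_geometric)
        finally have "\<beta> J K \<le> (\<Sum>n\<in>I. \<beta> (A n) (B n)) + e" using d by (simp add: d_def)
        then have "ennreal (\<beta> J K) \<le> ennreal ((\<Sum>n\<in>I. \<beta> (A n) (B n)) + e)" by (rule ennreal_leI)
        also have "\<dots> = (\<Sum>n\<in>I. ennreal (\<beta> (A n) (B n))) + ennreal e"
          using nonneg A B e by (subst ennreal_plus) (auto intro!: sum_nonneg simp: sum_ennreal)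
        also have "\<dots> \<le> (\<Sum>n. ennreal (\<beta> (A n) (B n))) + ennreal e"
          by (intro add_right_mono sum_le_suminf summableI I) auto
        finally show "ennreal (\<beta> J K) \<le> (\<Sum>n. ennreal (\<beta> (A n) (B n))) + ennreal e" .
      qed
    qed
  qed
  have s: "sets \<rho> = sets (M \<Otimes>\<^sub>M M)"
  proof -
    have "sets \<rho> = sigma_sets UNIV ((\<lambda>(A, B). A \<times> B) ` {(A, B). A \<in> sets M \<and> B \<in> sets M})"
      unfolding \<rho>_def by (rule sets_extend_measure) simp
    also have "(\<lambda>(A, B). A \<times> B) ` {(A, B). A \<in> sets M \<and> B \<in> sets M} = {A \<times> B | A B. A \<in> sets M \<and> B \<in> sets M}"
      by auto
    finally show ?thesis by (simp add: sets_pair_measure sp)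
  qed
  have sp\<rho>: "space \<rho> = UNIV \<times> UNIV" using sets_eq_imp_space_eq[OF s] by (simp add: space_pair_measure sp)
  have "prob_space \<rho>"
    by (rule prob_spaceI) (use em[OF top top] marg(1)[OF top] prob_space in \<open>simp add: sp\<rho> sp\<close>)
  moreover have "emeasure \<rho> (A \<times> space M) = emeasure M A" "emeasure \<rho> (space M \<times> A) = emeasure M A" if "A \<in> sets M" for A
    using em[OF that top] em[OF top that] marg that by (simp_all add: sp emeasure_eq_measure)
  ultimately have "\<rho> \<in> C2 M" using s unfolding C2_def by blast
  moreover have "measure \<rho> (A \<times> B) = \<beta> A B" if "A \<in> sets M" "B \<in> sets M" for A B
    unfolding measure_def em[OF that] using nonneg[OF that] by simp
  ultimately show thesis by (rule that)
qed

text \<open>A coupling is identified with its values on rectangles, a point of a product of unit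
  intervals, which is compact by Tychonoff. The image is closed because the hypotheses of
  \<open>coupling_of_rectangle_function\<close> involve finitely many coordinates at a time and so
  survive pointwise limits; countable additivity is not such a condition and is recovered from
  regularity.\<close>

lemma compact_C2_topology:
  fixes M :: "'a::polish_space measure"
  assumes prob: "prob_space M" and borel: "sets M = sets borel"
  shows "compact_space (C2_topology M)"
proof -
  have sp: "space M = UNIV" using sets_eq_imp_space_eq[OF borel] by simp
  have top: "UNIV \<in> sets M" using sets.top[of M] by (simp add: sp)
  \<comment> \<open>The value \<open>0\<close> off measurable pairs lies in the unit interval and
    makes \<open>b = \<Phi> \<rho>\<close> an equation at all arguments.\<close>
  define \<Phi> :: "('a \<times> 'a) measure \<Rightarrow> 'a set \<times> 'a set \<Rightarrow> real" where
    "\<Phi> \<rho> = (\<lambda>(A, B). if A \<in> sets M \<and> B \<in> sets M then measure \<rho> (A \<times> B) else 0)" for \<rho>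
  have \<Phi>: "\<Phi> \<rho> (A, B) = measure \<rho> (A \<times> B)" if "A \<in> sets M" "B \<in> sets M" for \<rho> A B
    using that by (simp add: \<Phi>_def)
  define K where "K = \<Phi> ` C2 M"
  have rect: "A \<times> B \<in> sets \<rho>" if "\<rho> \<in> C2 M" "A \<in> sets M" "B \<in> sets M" for \<rho> A B
    using that C2D(1)[OF that(1)] by simp
  have C2m: "measure \<rho> (A \<times> UNIV) = measure M A" "measure \<rho> (UNIV \<times> A) = measure M A" if "\<rho> \<in> C2 M" "A \<in> sets M" for \<rho> A
    using C2D(4,5)[OF that] by (simp_all add: sp)
  have coord: "continuous_on UNIV (\<lambda>b. b i :: real)" for i :: "'a set \<times> 'a set" by simp
  have K_le: "f b \<le> g b" if b: "b \<in> closure K" and "continuous_on UNIV f" "continuous_on UNIV g"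
    "\<And>\<rho>. \<rho> \<in> C2 M \<Longrightarrow> f (\<Phi> \<rho>) \<le> g (\<Phi> \<rho>)" for b and f g :: "('a set \<times> 'a set \<Rightarrow> real) \<Rightarrow> real"
  proof -
    have "closed {b. f b \<le> g b}" by (intro closed_Collect_le that)
    moreover have "K \<subseteq> {b. f b \<le> g b}" using that(4) by (auto simp: K_def)
    ultimately have "closure K \<subseteq> {b. f b \<le> g b}" by (rule closure_minimal[rotated])
    then show ?thesis using b by auto
  qed
  have K_eq: "f b = g b" if b: "b \<in> closure K" and "continuous_on UNIV f" "continuous_on UNIV g"
    "\<And>\<rho>. \<rho> \<in> C2 M \<Longrightarrow> f (\<Phi> \<rho>) = g (\<Phi> \<rho>)" for b and f g :: "('a set \<times> 'a set \<Rightarrow> real) \<Rightarrow> real"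
    using K_le[OF that(1,2,3)] K_le[OF that(1,3,2)] that(4) by (intro antisym) auto
  have "closure K \<subseteq> K"
  proof
    fix b assume b: "b \<in> closure K"
    obtain \<rho> where \<rho>: "\<rho> \<in> C2 M" "\<And>A B. A \<in> sets M \<Longrightarrow> B \<in> sets M \<Longrightarrow> measure \<rho> (A \<times> B) = b (A, B)"
    proof (rule coupling_of_rectangle_function[OF prob borel, of "\<lambda>A B. b (A, B)"])
      show "0 \<le> b (A, B)" for A B
        by (rule K_le[OF b, of "\<lambda>_. 0"]) (auto simp: \<Phi>_def)
      show "b (A, UNIV) = measure M A" if A: "A \<in> sets M" for A
        by (rule K_eq[OF b, of "\<lambda>b. b (A, UNIV)" "\<lambda>_. measure M A"]) (use A top C2m in \<open>auto simp: \<Phi>\<close>)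
      show "b (UNIV, A) = measure M A" if A: "A \<in> sets M" for A
        by (rule K_eq[OF b, of "\<lambda>b. b (UNIV, A)" "\<lambda>_. measure M A"]) (use A top C2m in \<open>auto simp: \<Phi>\<close>)
    next
      fix I :: "nat set" and A B :: "nat \<Rightarrow> 'a set" and J L
      assume I: "finite I" and A: "\<And>i. A i \<in> sets M" and B: "\<And>i. B i \<in> sets M" and J: "J \<in> sets M" "L \<in> sets M"
        and disj: "disjoint_family_on (\<lambda>i. A i \<times> B i) I" and un: "(\<Union>i\<in>I. A i \<times> B i) \<subseteq> J \<times> L"
      show "(\<Sum>i\<in>I. b (A i, B i)) \<le> b (J, L)"
      proof (rule K_le[OF b, of "\<lambda>b. \<Sum>i\<in>I. b (A i, B i)" "\<lambda>b. b (J, L)"])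
        fix \<rho> assume r: "\<rho> \<in> C2 M"
        interpret \<rho>: prob_space \<rho> by (rule C2D(2)[OF r])
        have "(\<Sum>i\<in>I. measure \<rho> (A i \<times> B i)) = measure \<rho> (\<Union>i\<in>I. A i \<times> B i)"
          by (rule \<rho>.finite_measure_finite_Union[symmetric]) (use I disj rect[OF r A B] in auto)
        also have "\<dots> \<le> measure \<rho> (J \<times> L)" by (rule \<rho>.finite_measure_mono[OF un rect[OF r J]])
        finally show "(\<Sum>i\<in>I. \<Phi> \<rho> (A i, B i)) \<le> \<Phi> \<rho> (J, L)" by (simp add: \<Phi> A B J)
      qed (intro continuous_intros coord)+
    next
      fix I :: "nat set" and A B :: "nat \<Rightarrow> 'a set" and J L
      assume I: "finite I" and A: "\<And>i. A i \<in> sets M" and B: "\<And>i. B i \<in> sets M" and J: "J \<in> sets M" "L \<in> sets M"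
        and un: "J \<times> L \<subseteq> (\<Union>i\<in>I. A i \<times> B i)"
      show "b (J, L) \<le> (\<Sum>i\<in>I. b (A i, B i))"
      proof (rule K_le[OF b, of "\<lambda>b. b (J, L)" "\<lambda>b. \<Sum>i\<in>I. b (A i, B i)"])
        fix \<rho> assume r: "\<rho> \<in> C2 M"
        interpret \<rho>: prob_space \<rho> by (rule C2D(2)[OF r])
        have "measure \<rho> (J \<times> L) \<le> measure \<rho> (\<Union>i\<in>I. A i \<times> B i)"
          by (rule \<rho>.finite_measure_mono[OF un]) (use I rect[OF r A B] in auto)
        also have "\<dots> \<le> (\<Sum>i\<in>I. measure \<rho> (A i \<times> B i))"
          by (rule \<rho>.finite_measure_subadditive_finite[OF I]) (use rect[OF r A B] in auto)
        finally show "\<Phi> \<rho> (J, L) \<le> (\<Sum>i\<in>I. \<Phi> \<rho> (A i, B i))" by (simp add: \<Phi> A B J)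
      qed (intro continuous_intros coord)+
    qed (rule that)
    have "b (A, B) = \<Phi> \<rho> (A, B)" for A B
    proof (cases "A \<in> sets M \<and> B \<in> sets M")
      case True then show ?thesis by (simp add: \<Phi> \<rho>(2))
    next
      case False
      have "b (A, B) = 0" by (rule K_eq[OF b, of "\<lambda>b. b (A, B)" "\<lambda>_. 0"]) (use False in \<open>auto simp: \<Phi>_def\<close>)
      then show ?thesis using False by (auto simp: \<Phi>_def)
    qed
    then have "b = \<Phi> \<rho>" by auto
    then show "b \<in> K" using \<rho>(1) by (simp add: K_def)
  qed
  then have cK: "closed K" using closure_subset[of K] closure_eq[of K] by blast
  have "compactin (product_topology (\<lambda>i::'a set \<times> 'a set. euclidean::real topology) UNIV) (PiE UNIV (\<lambda>_. {0..1}))"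
    unfolding compactin_PiE by simp
  then have box: "compact (PiE UNIV (\<lambda>_::'a set \<times> 'a set. {0..1::real}))"
    by (simp add: euclidean_product_topology)
  have KP: "K \<subseteq> PiE UNIV (\<lambda>_. {0..1})"
    by (auto simp: K_def \<Phi>_def PiE_UNIV_domain intro: prob_space.prob_le_1[OF C2D(2)])
  have compK: "compact K" using compact_Int_closed[OF box cK] unfolding Int_absorb1[OF KP] .
  have inj: "inj_on \<Phi> (C2 M)"
  proof (rule inj_onI)
    fix \<rho> \<sigma> assume r: "\<rho> \<in> C2 M" "\<sigma> \<in> C2 M" "\<Phi> \<rho> = \<Phi> \<sigma>"
    then show "\<rho> = \<sigma>" by (intro C2_eqI[OF r(1,2)]) (metis \<Phi>)
  qed
  define g where "g = inv_into (C2 M) \<Phi>"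
  have g: "g b \<in> C2 M" "\<Phi> (g b) = b" if "b \<in> K" for b
    using that by (auto simp: g_def K_def inv_into_into f_inv_into_f)
  have gK: "g ` K = C2 M" unfolding g_def K_def using inj by simp
  \<comment> \<open>Continuity of the inverse is checked on the generators, which correspond to
    preimages under single coordinates.\<close>
  have "continuous_map (top_of_set K) (C2_topology M) g"
    unfolding C2_topology_def
  proof (rule continuous_on_generated_topo)
    fix V assume "V \<in> {{\<rho>\<in>C2 M. measure \<rho> (A \<times> B) \<in> U} | A B U. A \<in> sets M \<and> B \<in> sets M \<and> open U}"
    then obtain A B U where V: "V = {\<rho>\<in>C2 M. measure \<rho> (A \<times> B) \<in> U}" "A \<in> sets M" "B \<in> sets M" "open U" by blast
    have "g -` V \<inter> topspace (top_of_set K) = K \<inter> ((\<lambda>b. b (A, B)) -` U)"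
      using g V \<Phi>[OF V(2,3)] by (auto simp: V(1)) (metis)+
    moreover have "open ((\<lambda>b. b (A, B)) -` U)" by (rule open_vimage[OF V(4) coord])
    ultimately show "openin (top_of_set K) (g -` V \<inter> topspace (top_of_set K))" by (simp add: openin_open_Int)
  next
    show "g ` topspace (top_of_set K) \<subseteq> \<Union> {{\<rho>\<in>C2 M. measure \<rho> (A \<times> B) \<in> U} | A B U. A \<in> sets M \<and> B \<in> sets M \<and> open U}"
      using topspace_C2_topology[of M] gK by (simp add: C2_topology_def)
  qed
  moreover have "compactin (top_of_set K) K" using compK by (simp add: compactin_subtopology)
  ultimately have "compactin (C2_topology M) (g ` K)" by (rule image_compactin[rotated])
  then show ?thesis by (simp add: gK compact_space_def)
qed

section \<open>Equicontinuity\<close>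

text \<open>The rectangles differ within two strips whose measure is fixed by the marginals, so the
  bound is uniform over all couplings.\<close>

lemma C2_measure_rectangle_diff:
  assumes r: "\<rho> \<in> C2 M" and sp: "space M = UNIV"
    and s: "A \<in> sets M" "B \<in> sets M" "A' \<in> sets M" "B' \<in> sets M"
  shows "\<bar>measure \<rho> (A \<times> B) - measure \<rho> (A' \<times> B')\<bar> \<le> measure M (sym_diff A A') + measure M (sym_diff B B')"
proof -
  interpret \<rho>: prob_space \<rho> by (rule C2D(2)[OF r])
  have top: "UNIV \<in> sets M" using sets.top[of M] by (simp add: sp)
  have le: "measure \<rho> (C \<times> D) \<le> measure \<rho> (C' \<times> D') + (measure M (sym_diff C C') + measure M (sym_diff D D'))"
    if t: "C \<in> sets M" "D \<in> sets M" "C' \<in> sets M" "D' \<in> sets M" for C D C' D'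
  proof -
    let ?X = "sym_diff C C' \<times> UNIV" and ?Y = "UNIV \<times> sym_diff D D'"
    have sd: "sym_diff C C' \<in> sets M" "sym_diff D D' \<in> sets M" using t by auto
    have m: "C' \<times> D' \<in> sets \<rho>" "?X \<in> sets \<rho>" "?Y \<in> sets \<rho>" using C2D(1)[OF r] t sd top by (auto intro!: pair_measureI)
    have "measure \<rho> (C \<times> D) \<le> measure \<rho> (C' \<times> D' \<union> (?X \<union> ?Y))"
      by (rule \<rho>.finite_measure_mono) (use m in auto)
    also have "\<dots> \<le> measure \<rho> (C' \<times> D') + measure \<rho> (?X \<union> ?Y)"
      by (rule measure_Un_le) (use m in auto)
    also have "measure \<rho> (?X \<union> ?Y) \<le> measure \<rho> ?X + measure \<rho> ?Y"
      by (rule measure_Un_le) (use m in auto)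
    also have "measure \<rho> ?X = measure M (sym_diff C C')" using C2D(4)[OF r sd(1)] by (simp add: sp)
    also have "measure \<rho> ?Y = measure M (sym_diff D D')" using C2D(5)[OF r sd(2)] by (simp add: sp)
    finally show ?thesis by simp
  qed
  show ?thesis using le[OF s] le[OF s(3,4,1,2)] unfolding Un_commute[of "A' - A"] Un_commute[of "B' - B"] by linarith
qed

lemma C2_topology_limitin_measure:
  assumes "limitin (C2_topology M) z l F" "A \<in> sets M" "B \<in> sets M"
  shows "((\<lambda>k. measure (z k) (A \<times> B)) \<longlongrightarrow> measure l (A \<times> B)) F"
proof (rule topological_tendstoI)
  fix U assume U: "open U" "measure l (A \<times> B) \<in> U"
  have "openin (C2_topology M) {\<rho>\<in>C2 M. measure \<rho> (A \<times> B) \<in> U}"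
    unfolding C2_topology_def by (rule topology_generated_by_Basis) (use assms U in blast)
  moreover have "l \<in> C2 M" using assms(1) by (simp add: limitin_def)
  ultimately have "\<forall>\<^sub>F k in F. z k \<in> {\<rho>\<in>C2 M. measure \<rho> (A \<times> B) \<in> U}"
    using assms(1) U(2) unfolding limitin_def by blast
  then show "\<forall>\<^sub>F k in F. measure (z k) (A \<times> B) \<in> U" by eventually_elim simp
qed

context standard_aut begin

lemma zpow_in_C2: "\<rho> \<in> C2 M \<Longrightarrow> zpow (C2_topology M) (lift_map M T) n \<rho> \<in> C2 M"
  unfolding zpow_lift_map by (rule lift_map_in_C2[OF _ mp_Tpow])

text \<open>A failure gives pairs that come together while some images stay \<open>e\<close> apart.
  On a rectangle the images are compared through preimages of the sides, which are near finitely
  many fixed sets whatever the power. Convergence on finitely many rectangles thus controls all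
  powers at once, and the limits of the images coincide.\<close>

lemma equicontinuous_if_almost_periodic_indicators:
  assumes ap: "\<And>A. A \<in> sets M \<Longrightarrow> almost_periodic (\<lambda>x. indicator A x)"
  shows "equicontinuous (C2_topology M) (lift_map M T)"
  unfolding equicontinuous_def topspace_C2_topology
proof (intro allI impI)
  fix d and e :: real
  assume d: "Metric_space (C2 M) d \<and> Metric_space.mtopology (C2 M) d = C2_topology M" and e: "e > 0"
  let ?z = "zpow (C2_topology M) (lift_map M T)"
  interpret D: Metric_space "C2 M" d using d by simp
  have top: "D.mtopology = C2_topology M" using d by simp
  have seq: "\<exists>l r. l \<in> C2 M \<and> strict_mono r \<and> limitin D.mtopology (\<sigma> \<circ> r) l sequentially"
    if "range \<sigma> \<subseteq> C2 M" for \<sigma> :: "nat \<Rightarrow> ('a \<times> 'a) measure"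
    using compact_C2_topology[OF prob_space_axioms sets_M] that D.compact_space_sequentially by (simp add: top)
  show "\<exists>\<delta>>0. \<forall>z\<in>C2 M. \<forall>w\<in>C2 M. d z w < \<delta> \<longrightarrow> (\<forall>n. d (?z n z) (?z n w) < e)"
  proof (rule ccontr)
    assume "\<not> ?thesis"
    then have "\<exists>z w n. z \<in> C2 M \<and> w \<in> C2 M \<and> d z w < inverse (real (Suc k)) \<and> e \<le> d (?z n z) (?z n w)" for k
      by (metis inverse_positive_iff_positive not_le of_nat_0_less_iff zero_less_Suc)
    then obtain z w n where zw: "\<And>k. z k \<in> C2 M" "\<And>k. w k \<in> C2 M"
      and close: "\<And>k. d (z k) (w k) < inverse (real (Suc k))" and far: "\<And>k. e \<le> d (?z (n k) (z k)) (?z (n k) (w k))"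
      by metis
    \<comment> \<open>Three successive extractions: a limit for \<open>z\<close>, which
      \<open>w\<close> will share, then one for the images of \<open>z\<close>, then one for the
      images of \<open>w\<close>.\<close>
    obtain l r1 where l: "l \<in> C2 M" "strict_mono r1" "limitin D.mtopology (z \<circ> r1) l sequentially"
      using seq[of z] zw by blast
    obtain u r2 where u: "u \<in> C2 M" "strict_mono r2"
      "limitin D.mtopology ((\<lambda>k. ?z (n (r1 k)) (z (r1 k))) \<circ> r2) u sequentially"
      using seq[of "\<lambda>k. ?z (n (r1 k)) (z (r1 k))"] zw zpow_in_C2 by blast
    obtain v r3 where v: "v \<in> C2 M" "strict_mono r3"
      "limitin D.mtopology ((\<lambda>k. ?z (n (r1 (r2 k))) (w (r1 (r2 k)))) \<circ> r3) v sequentially"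
      using seq[of "\<lambda>k. ?z (n (r1 (r2 k))) (w (r1 (r2 k)))"] zw zpow_in_C2 by blast
    define r where "r k = r1 (r2 (r3 k))" for k
    have r: "strict_mono r" unfolding r_def using l(2) u(2) v(2) by (simp add: strict_mono_def)
    have lz: "limitin D.mtopology (\<lambda>k. z (r k)) l sequentially"
      using limitin_subsequence[OF strict_mono_o[OF u(2) v(2)] l(3)] by (simp add: comp_def r_def)
    have lu: "limitin D.mtopology (\<lambda>k. ?z (n (r k)) (z (r k))) u sequentially"
      using limitin_subsequence[OF v(2) u(3)] by (simp add: comp_def r_def)
    have lv: "limitin D.mtopology (\<lambda>k. ?z (n (r k)) (w (r k))) v sequentially"
      using v(3) by (simp add: comp_def r_def)
    have rk: "inverse (real (Suc (r k))) \<le> inverse (real (Suc k))" for k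
      using seq_suble[OF r, of k] by (simp add: field_simps)
    have lw: "limitin D.mtopology (\<lambda>k. w (r k)) l sequentially"
      unfolding D.limitin_metric
    proof (intro conjI allI impI l(1))
      fix \<epsilon> :: real assume "\<epsilon> > 0"
      then have "\<forall>\<^sub>F k in sequentially. d (z (r k)) l < \<epsilon> / 2"
        using lz unfolding D.limitin_metric by (auto elim!: allE[of _ "\<epsilon> / 2"] eventually_mono)
      moreover have "\<forall>\<^sub>F k in sequentially. inverse (real (Suc k)) < \<epsilon> / 2"
        by (rule order_tendstoD(2)[OF LIMSEQ_inverse_real_of_nat half_gt_zero[OF \<open>\<epsilon> > 0\<close>]])
      ultimately show "\<forall>\<^sub>F k in sequentially. w (r k) \<in> C2 M \<and> d (w (r k)) l < \<epsilon>"
      proof eventually_elim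
        case (elim k)
        have "d (w (r k)) l \<le> d (w (r k)) (z (r k)) + d (z (r k)) l" by (intro D.triangle zw l)
        then have "d (w (r k)) l < \<epsilon>" using elim close[of "r k"] rk[of k] D.commute[of "w (r k)" "z (r k)"] by linarith
        then show ?case using zw by simp
      qed
    qed
    have "u = v"
    proof (rule C2_eqI[OF u(1) v(1)])
      fix A B assume A: "A \<in> sets M" and B: "B \<in> sets M"
      note lim = C2_topology_limitin_measure[where M = M, folded top]
      have "\<bar>measure u (A \<times> B) - measure v (A \<times> B)\<bar> \<le> 0 + \<epsilon>" if \<epsilon>: "\<epsilon> > 0" for \<epsilon>
      proof -
        \<comment> \<open>Two errors from the sides for \<open>z\<close>, two for \<open>w\<close>,
          and one for comparing \<open>z\<close> with \<open>w\<close> on the fixed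
          rectangle.\<close>
        define \<eta> where "\<eta> = \<epsilon> / 5"
        have \<eta>: "\<eta> > 0" using \<epsilon> by (simp add: \<eta>_def)
        obtain F where F: "finite F" "F \<subseteq> sets M" "\<And>n. \<exists>A'\<in>F. measure M (sym_diff (Tpow n -` A) A') < \<eta>"
          using almost_periodic_indicator_sets[OF ap[OF A] A \<eta>] by blast
        obtain G where G: "finite G" "G \<subseteq> sets M" "\<And>n. \<exists>B'\<in>G. measure M (sym_diff (Tpow n -` B) B') < \<eta>"
          using almost_periodic_indicator_sets[OF ap[OF B] B \<eta>] by blast
        have "\<forall>\<^sub>F k in sequentially. \<forall>A'\<in>F. \<forall>B'\<in>G. \<bar>measure (z (r k)) (A' \<times> B') - measure (w (r k)) (A' \<times> B')\<bar> < \<eta>"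
        proof (intro eventually_ball_finite F(1) G(1) ballI)
          fix A' B' assume "A' \<in> F" "B' \<in> G"
          then have s: "A' \<in> sets M" "B' \<in> sets M" using F G by auto
          have "(\<lambda>k. \<bar>measure (z (r k)) (A' \<times> B') - measure (w (r k)) (A' \<times> B')\<bar>) \<longlonglongrightarrow> \<bar>measure l (A' \<times> B') - measure l (A' \<times> B')\<bar>"
            by (intro tendsto_intros lim[OF lz s] lim[OF lw s])
          then show "\<forall>\<^sub>F k in sequentially. \<bar>measure (z (r k)) (A' \<times> B') - measure (w (r k)) (A' \<times> B')\<bar> < \<eta>"
            using \<eta> by (intro order_tendstoD(2)) auto
        qed
        then have "\<forall>\<^sub>F k in sequentially. \<bar>measure (?z (n (r k)) (z (r k))) (A \<times> B) - measure (?z (n (r k)) (w (r k))) (A \<times> B)\<bar> \<le> \<epsilon>"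
        proof eventually_elim
          case (elim k)
          let ?A = "Tpow (n (r k)) -` A" and ?B = "Tpow (n (r k)) -` B"
          obtain A' where A': "A' \<in> F" "measure M (sym_diff ?A A') < \<eta>" using F(3) by blast
          obtain B' where B': "B' \<in> G" "measure M (sym_diff ?B B') < \<eta>" using G(3) by blast
          have s: "?A \<in> sets M" "?B \<in> sets M" "A' \<in> sets M" "B' \<in> sets M"
            using measurable_sets[of "Tpow (n (r k))" M M] mp_Tpow[of "n (r k)"] A B A' B' F G by (auto simp: mp_map_def)
          note diff = C2_measure_rectangle_diff[OF _ space_M s]
          have "\<bar>measure (z (r k)) (A' \<times> B') - measure (w (r k)) (A' \<times> B')\<bar> < \<eta>" using elim A' B' by blast
          then show ?case
            unfolding measure_zpow_lift_map[OF zw(1) A B] measure_zpow_lift_map[OF zw(2) A B]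
            using diff[OF zw(1)[of "r k"]] diff[OF zw(2)[of "r k"]] A'(2) B'(2) \<eta>_def by linarith
        qed
        moreover have "(\<lambda>k. \<bar>measure (?z (n (r k)) (z (r k))) (A \<times> B) - measure (?z (n (r k)) (w (r k))) (A \<times> B)\<bar>)
            \<longlonglongrightarrow> \<bar>measure u (A \<times> B) - measure v (A \<times> B)\<bar>"
          by (intro tendsto_intros lim[OF lu A B] lim[OF lv A B])
        ultimately show ?thesis using tendsto_upperbound[of _ _ sequentially \<epsilon>] by simp
      qed
      then have "\<bar>measure u (A \<times> B) - measure v (A \<times> B)\<bar> \<le> 0" using field_le_epsilon by blast
      then show "measure u (A \<times> B) = measure v (A \<times> B)" by simp
    qed
    have "\<forall>\<^sub>F k in sequentially. d (?z (n (r k)) (z (r k))) u < e / 2"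
      using lu e unfolding D.limitin_metric by (auto elim!: allE[of _ "e / 2"] eventually_mono)
    moreover have "\<forall>\<^sub>F k in sequentially. d (?z (n (r k)) (w (r k))) u < e / 2"
      using lv e unfolding D.limitin_metric \<open>u = v\<close> by (auto elim!: allE[of _ "e / 2"] eventually_mono)
    ultimately have "\<forall>\<^sub>F k in sequentially. False"
    proof eventually_elim
      case (elim k)
      have "d (?z (n (r k)) (z (r k))) (?z (n (r k)) (w (r k))) \<le> d (?z (n (r k)) (z (r k))) u + d u (?z (n (r k)) (w (r k)))"
        by (intro D.triangle zpow_in_C2 zw u)
      then show ?case using elim far[of "r k"] D.commute[of u] by simp
    qed
    then show False by simp
  qed
qed

end

theorem mainTheorem5:
  fixes M :: "'a::polish_space measure" and T :: "'a \<Rightarrow> 'a"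
  assumes "prob_space M" and "sets M = sets borel"
    and "mp_aut M T" and "ergodic M T"
    and "distal (C2_topology M) (lift_map M T)"
  shows "discrete_spectrum M T \<and> equicontinuous (C2_topology M) (lift_map M T)"
proof -
  interpret standard_aut M T
    using assms by (simp add: standard_aut_def standard_aut_axioms_def)
  have "almost_periodic (\<lambda>x. indicator A x)" if "A \<in> sets M" for A
    by (rule distal_almost_periodic_indicator[OF assms(5) that])
  then show ?thesis
    using discrete_spectrum_if_almost_periodic_indicators equicontinuous_if_almost_periodic_indicators by blast
qed

end
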